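(* There exists a universal constant $C>0$ such that for all positive integers $n,d$ and every convex polytope $K\subseteq\mathbb{R}^d$ with $\dim K=d$ and with $n$ vertices, $$L_K\le C\sqrt{\frac{n}{d}}.$$
   Context: A convex body $K\subset\mathbb{R}^d$ (compact convex set with non-empty interior) is called isotropic if $\mathrm{Vol}_d(K)=1$, its barycenter is at the origin, and there is a constant $L_K>0$ such that $\int_K\langle x,\theta\rangle^2\,dx=L_K^2$ for every $\theta\in S^{d-1}$. Every convex body $K\subset\mathbb{R}^d$ has an isotropic image $K_1$ under an invertible affine map, and its isotropy constant is $L_K:=L_{K_1}$ (this is well defined). A universal constant is one not depending on $n$, $d$ or $K$. *)

theory Defs
  imports "HOL-Analysis.Analysis" "HOL-Library.Function_Algebras"
begin

text \<open>
  The constant in the theorem must not depend on the dimension, so the dimension has to be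
  a bound variable of type \<^typ>\<open>nat\<close>.  Therefore \<open>\<real>\<^sup>d\<close> is the coordinate subspace
  \<open>Rd d\<close> of the sequence space \<^typ>\<open>nat \<Rightarrow> real\<close>, which carries the pointwise vector space
  structure and the product topology; on \<open>Rd d\<close> this is the usual topology.
\<close>

instantiation "fun" :: (type, real_vector) real_vector
begin

definition scaleR_fun :: "real \<Rightarrow> ('a \<Rightarrow> 'b) \<Rightarrow> 'a \<Rightarrow> 'b"
  where "scaleR_fun c f = (\<lambda>i. c *\<^sub>R f i)"

instance
  by standard (simp_all add: scaleR_fun_def plus_fun_def fun_eq_iff scaleR_add_right scaleR_add_left)

end

definition Rd :: "nat \<Rightarrow> (nat \<Rightarrow> real) set"
  where "Rd d = {x. \<forall>i\<ge>d. x i = 0}"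

definition inner_Rd :: "nat \<Rightarrow> (nat \<Rightarrow> real) \<Rightarrow> (nat \<Rightarrow> real) \<Rightarrow> real"
  where "inner_Rd d x y = (\<Sum>i<d. x i * y i)"

definition sphere_Rd :: "nat \<Rightarrow> (nat \<Rightarrow> real) set"
  where "sphere_Rd d = {\<theta> \<in> Rd d. inner_Rd d \<theta> \<theta> = 1}"

text \<open>
  The Lebesgue measure \<open>Vol\<^sub>d\<close> on the Borel sets, concentrated on \<open>Rd d\<close>.  Elements of the
  product space \<open>\<Pi>\<^sub>M i\<in>{..<d}. lborel\<close> are \<^const>\<open>undefined\<close> outside \<open>{..<d}\<close>, so
  they are transported to \<open>Rd d\<close>.
\<close>

definition vol_Rd :: "nat \<Rightarrow> (nat \<Rightarrow> real) measure"
  where "vol_Rd d =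
    distr (\<Pi>\<^sub>M i\<in>{..<d}. (lborel :: real measure)) borel (\<lambda>x i. if i < d then x i else 0)"

definition convex_body :: "nat \<Rightarrow> (nat \<Rightarrow> real) set \<Rightarrow> bool"
  where "convex_body d K \<longleftrightarrow>
    K \<subseteq> Rd d \<and> compact K \<and> convex K \<and> top_of_set (Rd d) interior_of K \<noteq> {}"

text \<open>\<open>K\<close> is isotropic with constant \<open>L\<close>; as \<open>K\<close> has volume 1, its barycenter is \<open>\<integral>\<^sub>K x dx\<close>.\<close>

definition isotropic_with :: "nat \<Rightarrow> (nat \<Rightarrow> real) set \<Rightarrow> real \<Rightarrow> bool"
  where "isotropic_with d K L \<longleftrightarrow>
    convex_body d K \<and>
    emeasure (vol_Rd d) K = 1 \<and>
    (\<forall>i<d. (LINT x:K|vol_Rd d. x i) = 0) \<and>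
    L > 0 \<and>
    (\<forall>\<theta>\<in>sphere_Rd d. (LINT x:K|vol_Rd d. (inner_Rd d x \<theta>)\<^sup>2) = L\<^sup>2)"

text \<open>
  An invertible affine self-map of \<open>Rd d\<close> is the restriction of a map of the ambient space with
  the following property, since every linear self-map of \<open>Rd d\<close> extends linearly.
\<close>

definition invertible_affine :: "nat \<Rightarrow> ((nat \<Rightarrow> real) \<Rightarrow> (nat \<Rightarrow> real)) \<Rightarrow> bool"
  where "invertible_affine d T \<longleftrightarrow>
    (\<exists>A b. linear A \<and> bij_betw A (Rd d) (Rd d) \<and> b \<in> Rd d \<and> T = (\<lambda>x. A x + b))"

definition isotropy_constant :: "nat \<Rightarrow> (nat \<Rightarrow> real) set \<Rightarrow> real"
  where "isotropy_constant d K =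
    (THE L. \<exists>T. invertible_affine d T \<and> isotropic_with d (T ` K) L)"

text \<open>
  The affine dimension of a nonempty set, as the dimension of its direction space;
  the library's \<open>aff_dim\<close> is restricted to the class \<^class>\<open>euclidean_space\<close>.
\<close>

definition affine_dim :: "(nat \<Rightarrow> real) set \<Rightarrow> nat"
  where "affine_dim K = dim {x - y | x y. x \<in> K \<and> y \<in> K}"

end

theory Submission
  imports Defs "HOL-Probability.Distributions" "HOL-Computational_Algebra.Polynomial"
begin

text \<open>
  The uniform measure on a polytope \<open>K\<close> with vertices \<open>v i\<close>, \<open>i < n\<close>, is a mixture of uniform measures on
  simplices with vertices among the \<open>v i\<close>.  Let \<open>K\<close> be isotropic, let \<open>w\<close> be a vertex and
  let \<open>A\<close> be the lower triangular matrix with positive diagonal for which the vectors \<open>z i = A (v i - w)\<close>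
  satisfy \<open>\<Sum>i. z i (z i)\<^sup>T = 1\<close>.  The second moments of a simplex are explicit, and Bessel's
  inequality bounds the integral of \<open>\<bar>A (x - w)\<bar>\<^sup>2\<close> over \<open>K\<close> by \<open>2 / d\<close>; by isotropy the same integral is
  at least \<open>L\<^sup>2 * (\<Sum>k. (A k k)\<^sup>2)\<close>.  Gram-Schmidt with pivoting finds \<open>d\<close> of the \<open>z i\<close> that span a
  parallelepiped of squared volume at least \<open>d! / n\<^sup>d\<close>.  The corresponding simplex with apex \<open>w\<close> lies in \<open>K\<close>,
  which has volume 1, so \<open>\<Prod>k. A k k \<ge> (d! n\<^sup>d) powr (- 1 / 2)\<close>.  The AM-GM inequality then gives
  \<open>\<Sum>k. (A k k)\<^sup>2 \<ge> 1 / n\<close>, hence \<open>L\<^sup>2 \<le> 2 * n / d\<close>.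

  As the isotropy constant is defined by a definite description, existence and uniqueness of the isotropic
  position matter as well.  Determinants are avoided: uniqueness of Haar measure shows that an
  invertible linear map scales volume by a constant, and only the constants of triangular and of
  orthogonal matrices are ever evaluated.
\<close>

section \<open>Volume on coordinate subspaces\<close>

text \<open>The normalization \<open>\<Sum>i. z i (z i)\<^sup>T = 1\<close> makes the upper bound
  independent of \<open>n\<close> and of the number of simplices. For a simplex on a set
  \<open>S\<close> of \<open>d + 1\<close> indices, the mean of
  \<open>\<bar>A (x - w)\<bar>\<^sup>2\<close> is \<open>\<bar>\<Sum>i\<in>S. z i\<bar>\<^sup>2 +
  (\<Sum>i\<in>S. \<bar>z i\<bar>\<^sup>2)\<close> divided by \<open>(d + 1) * (d + 2)\<close>.
  Bessel's inequality for the indicator vector of \<open>S\<close> bounds the first term by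
  \<open>d + 1\<close>; the second is at most the total \<open>d\<close>. The number
  \<open>n\<close> enters only through volume: pivoting loses a factor \<open>n\<close> in each of
  the \<open>d\<close> squared distances. The factor \<open>d!\<close> in
  \<open>1 / (d! n\<^sup>d)\<close> is estimated by \<open>d\<^sup>d\<close>; after the root of
  order \<open>d\<close> it costs a factor \<open>d\<close>, which AM-GM regains on passing from the
  geometric mean to the sum. The triangular shape of \<open>A\<close> serves twice: the volume
  factor is read off the diagonal, and the squared norm of each row is at least the square of its
  diagonal entry. The mixture need only hold almost everywhere. It comes from a linear program with
  generic cost, so no incidences between simplices have to be studied.\<close>

lemma sum_fun_apply: "(\<Sum>i\<in>S. f i) x = (\<Sum>i\<in>S. f i x)"
  for f :: "'a \<Rightarrow> 'b \<Rightarrow> 'c::comm_monoid_add"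
  by (induction S rule: infinite_finite_induct) auto

lemma scaleR_fun_apply [simp]: "(c *\<^sub>R f) x = c *\<^sub>R f x"
  by (simp add: scaleR_fun_def)

definition embed_Rd :: "nat \<Rightarrow> (nat \<Rightarrow> real) \<Rightarrow> nat \<Rightarrow> real"
  where "embed_Rd d x = (\<lambda>i. if i < d then x i else 0)"

lemma embed_Rd_in [simp]: "embed_Rd d x \<in> Rd d"
  by (simp add: embed_Rd_def Rd_def)

lemma Rd_add [intro]: "x \<in> Rd d \<Longrightarrow> y \<in> Rd d \<Longrightarrow> x + y \<in> Rd d"
  and Rd_diff [intro]: "x \<in> Rd d \<Longrightarrow> y \<in> Rd d \<Longrightarrow> x - y \<in> Rd d"
  and Rd_scaleR [intro]: "x \<in> Rd d \<Longrightarrow> c *\<^sub>R x \<in> Rd d"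
  and Rd_uminus [intro]: "x \<in> Rd d \<Longrightarrow> - x \<in> Rd d"
  and Rd_zero [intro, simp]: "0 \<in> Rd d"
  by (auto simp: Rd_def)

lemma Rd_sum [intro]: "(\<And>i. i \<in> S \<Longrightarrow> f i \<in> Rd d) \<Longrightarrow> sum f S \<in> Rd d"
  by (simp add: Rd_def sum_fun_apply)

lemma Rd_eqI: "x \<in> Rd d \<Longrightarrow> y \<in> Rd d \<Longrightarrow> (\<And>i. i < d \<Longrightarrow> x i = y i) \<Longrightarrow> x = y"
  unfolding Rd_def by (auto simp: fun_eq_iff) (metis not_le)

interpretation lborel_product: product_sigma_finite "\<lambda>_::nat. lborel :: real measure"
  by standard

text \<open>The index set is countable, so the Borel sets of the product topology are those of the
  product sigma-algebra.\<close>

lemma measurable_fun_borelI: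
  fixes f :: "'a \<Rightarrow> nat \<Rightarrow> real"
  assumes "\<And>i. (\<lambda>x. f x i) \<in> borel_measurable M"
  shows "f \<in> M \<rightarrow>\<^sub>M borel"
  using assms by (rule measurable_coordinatewise_then_product)

lemma measurable_coord [measurable]: "(\<lambda>x::nat \<Rightarrow> real. x i) \<in> borel_measurable borel"
  by (rule measurable_product_then_coordinatewise) simp

lemma measurable_coordD:
  fixes f :: "'a \<Rightarrow> nat \<Rightarrow> real"
  assumes "f \<in> M \<rightarrow>\<^sub>M borel"
  shows "(\<lambda>x. f x i) \<in> borel_measurable M"
  using measurable_compose[OF assms measurable_coord] .

lemma embed_measurable [measurable]: "embed_Rd d \<in> (\<Pi>\<^sub>M i\<in>{..<d}. lborel) \<rightarrow>\<^sub>M borel"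
proof (rule measurable_fun_borelI)
  fix i show "(\<lambda>x. embed_Rd d x i) \<in> borel_measurable (\<Pi>\<^sub>M i\<in>{..<d}. lborel)"
    by (cases "i < d") (auto simp: embed_Rd_def cong: measurable_cong_sets
      intro: measurable_component_singleton[where M = "\<lambda>_. lborel", simplified])
qed

lemma vol_Rd_eq: "vol_Rd d = distr (\<Pi>\<^sub>M i\<in>{..<d}. lborel) borel (embed_Rd d)"
  unfolding vol_Rd_def embed_Rd_def ..

lemma sets_vol_Rd [simp, measurable_cong]: "sets (vol_Rd d) = sets borel"
  and space_vol_Rd [simp]: "space (vol_Rd d) = UNIV"
  by (simp_all add: vol_Rd_eq)

lemma Rd_borel [measurable]: "Rd d \<in> sets borel"
proof -
  have "Rd d = {x. \<forall>i. d \<le> i \<longrightarrow> x i = 0}" by (auto simp: Rd_def)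
  also have "\<dots> \<in> sets borel" by measurable
  finally show ?thesis .
qed

text \<open>The measure lives on the whole sequence space; identities known only on
  \<open>Rd d\<close> enter integrals through this fact.\<close>

lemma AE_vol_Rd: "AE x in vol_Rd d. x \<in> Rd d"
  unfolding vol_Rd_eq using Rd_borel[of d] by (subst AE_distr_iff) auto

lemma nn_integral_vol_Rd:
  "f \<in> borel_measurable borel \<Longrightarrow>
    (\<integral>\<^sup>+x. f x \<partial>vol_Rd d) = (\<integral>\<^sup>+x. f (embed_Rd d x) \<partial>(\<Pi>\<^sub>M i\<in>{..<d}. lborel))"
  by (simp add: vol_Rd_eq nn_integral_distr)

lemma emeasure_vol_box:
  fixes A :: "nat \<Rightarrow> real set"
  assumes [measurable]: "\<And>i. i < d \<Longrightarrow> A i \<in> sets borel"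
  shows "emeasure (vol_Rd d) {x. \<forall>i<d. x i \<in> A i} = (\<Prod>i<d. emeasure lborel (A i))"
proof -
  have "{x::nat \<Rightarrow> real. i < d \<longrightarrow> x i \<in> A i} \<in> sets borel" for i
    using measurable_sets[OF measurable_coord assms[of i]] by (cases "i < d") (auto simp: vimage_def)
  then have "(\<Inter>i. {x::nat \<Rightarrow> real. i < d \<longrightarrow> x i \<in> A i}) \<in> sets borel" by auto
  also have "(\<Inter>i. {x::nat \<Rightarrow> real. i < d \<longrightarrow> x i \<in> A i}) = {x. \<forall>i<d. x i \<in> A i}" by auto
  finally have [measurable]: "{x. \<forall>i<d. x i \<in> A i} \<in> sets borel" .
  have "emeasure (vol_Rd d) {x. \<forall>i<d. x i \<in> A i}
     = emeasure (\<Pi>\<^sub>M i\<in>{..<d}. lborel) (embed_Rd d -` {x. \<forall>i<d. x i \<in> A i} \<inter> space (\<Pi>\<^sub>M i\<in>{..<d}. (lborel::real measure)))"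
    by (subst vol_Rd_eq, subst emeasure_distr) auto
  also have "embed_Rd d -` {x. \<forall>i<d. x i \<in> A i} \<inter> space (\<Pi>\<^sub>M i\<in>{..<d}. (lborel::real measure))
       = (\<Pi>\<^sub>E i\<in>{..<d}. A i)"
    by (auto simp: embed_Rd_def space_PiM)
  finally show ?thesis by (subst (asm) lborel_product.emeasure_PiM) auto
qed

lemma box_borel [measurable]: "{x::nat \<Rightarrow> real. \<forall>i<d. a i \<le> x i \<and> x i \<le> b i} \<in> sets borel"
  by measurable

lemma emeasure_vol_cbox:
  assumes "\<And>i. i < d \<Longrightarrow> a i \<le> b i"
  shows "emeasure (vol_Rd d) {x. \<forall>i<d. a i \<le> x i \<and> x i \<le> b i} = ennreal (\<Prod>i<d. b i - a i)"
proof -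
  have "emeasure (vol_Rd d) {x. \<forall>i<d. x i \<in> {a i..b i}} = (\<Prod>i<d. emeasure lborel {a i..b i})"
    by (rule emeasure_vol_box) auto
  also have "\<dots> = (\<Prod>i<d. ennreal (b i - a i))" using assms by (intro prod.cong) auto
  also have "\<dots> = ennreal (\<Prod>i<d. b i - a i)" using assms by (intro prod_ennreal) auto
  finally show ?thesis by simp
qed

lemma sigma_finite_vol_Rd: "sigma_finite_measure (vol_Rd d)"
proof
  let ?B = "\<lambda>k::nat. {x::nat \<Rightarrow> real. \<forall>i<d. - real k \<le> x i \<and> x i \<le> real k}"
  have cover: "\<exists>k. x \<in> ?B k" for x
  proof -
    obtain k where k: "(\<Sum>i<d. \<bar>x i\<bar>) \<le> real k" using real_arch_simple by blast
    have "\<bar>x i\<bar> \<le> real k" if "i < d" for i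
      using member_le_sum[of i "{..<d}" "\<lambda>i. \<bar>x i\<bar>"] that k by auto
    then have "\<forall>i<d. - real k \<le> x i \<and> x i \<le> real k" by (auto simp: abs_le_iff minus_le_iff)
    then show ?thesis by blast
  qed
  show "\<exists>A. countable A \<and> A \<subseteq> sets (vol_Rd d) \<and> \<Union>A = space (vol_Rd d) \<and>
        (\<forall>a\<in>A. emeasure (vol_Rd d) a \<noteq> \<infinity>)"
    using cover by (intro exI[of _ "range ?B"]) (auto simp: emeasure_vol_cbox)
qed

lemma measurable_plus_fun [measurable (raw)]:
  fixes f g :: "'a \<Rightarrow> nat \<Rightarrow> real"
  assumes "f \<in> M \<rightarrow>\<^sub>M borel" "g \<in> M \<rightarrow>\<^sub>M borel"
  shows "(\<lambda>x. f x + g x) \<in> M \<rightarrow>\<^sub>M borel"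
  using assms[THEN measurable_coordD] by (intro measurable_fun_borelI) simp

lemma measurable_uminus_fun [measurable (raw)]:
  fixes f :: "'a \<Rightarrow> nat \<Rightarrow> real"
  assumes "f \<in> M \<rightarrow>\<^sub>M borel"
  shows "(\<lambda>x. - f x) \<in> M \<rightarrow>\<^sub>M borel"
  using assms[THEN measurable_coordD] by (intro measurable_fun_borelI) simp

lemma measurable_minus_fun [measurable (raw)]:
  fixes f g :: "'a \<Rightarrow> nat \<Rightarrow> real"
  assumes [measurable]: "f \<in> M \<rightarrow>\<^sub>M borel" "g \<in> M \<rightarrow>\<^sub>M borel"
  shows "(\<lambda>x. f x - g x) \<in> M \<rightarrow>\<^sub>M borel"
  using measurable_plus_fun[OF assms(1) measurable_uminus_fun[OF assms(2)]] by simp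

text \<open>A product measure is determined by its values on boxes, and there each factor is a
  translate under \<open>lborel\<close>. Membership of \<open>b\<close> in \<open>Rd d\<close> keeps
  the shifted point in \<open>Rd d\<close>.\<close>

lemma vol_Rd_translation:
  assumes b: "b \<in> Rd d" and [measurable]: "f \<in> borel_measurable borel"
  shows "(\<integral>\<^sup>+x. f (x + b) \<partial>vol_Rd d) = (\<integral>\<^sup>+x. f x \<partial>vol_Rd d)"
proof -
  let ?P = "\<Pi>\<^sub>M i\<in>{..<d}. (lborel :: real measure)"
  let ?t = "\<lambda>x. \<lambda>i\<in>{..<d}. x i + b i"
  have t[measurable]: "?t \<in> ?P \<rightarrow>\<^sub>M ?P"
    by (rule measurable_restrict) (auto intro: borel_measurable_add
      measurable_component_singleton[where M = "\<lambda>_. lborel", simplified])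
  have "distr ?P ?P ?t = ?P"
  proof (rule lborel_product.PiM_eqI)
    fix A assume A: "\<And>i. i \<in> {..<d} \<Longrightarrow> A i \<in> sets (lborel::real measure)"
    then have [measurable]: "\<And>i. i \<in> {..<d} \<Longrightarrow> A i \<in> sets borel" by simp
    have m: "(\<lambda>y. y + b i) -` A i \<in> sets borel" if "i<d" for i
      using measurable_sets[of "\<lambda>y. y + b i" borel borel "A i"] that by auto
    have "emeasure (distr ?P ?P ?t) (Pi\<^sub>E {..<d} A) = emeasure ?P (?t -` (Pi\<^sub>E {..<d} A) \<inter> space ?P)"
      by (rule emeasure_distr) (auto intro!: sets_PiM_I_finite A)
    also have "?t -` (Pi\<^sub>E {..<d} A) \<inter> space ?P = (\<Pi>\<^sub>E i\<in>{..<d}. (\<lambda>y. y + b i) -` A i)"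
      by (auto simp: space_PiM PiE_iff)
    also have "emeasure ?P \<dots> = (\<Prod>i<d. emeasure lborel ((\<lambda>y. y + b i) -` A i))"
      by (rule lborel_product.emeasure_PiM) (auto simp: m)
    also have "\<dots> = (\<Prod>i<d. emeasure lborel (A i))"
    proof (rule prod.cong)
      fix i assume i: "i \<in> {..<d}"
      have "emeasure lborel (A i) = emeasure (distr lborel borel ((+) (b i))) (A i)"
        by (simp add: lborel_distr_plus)
      also have "\<dots> = emeasure lborel ((+) (b i) -` A i)"
        using i by (subst emeasure_distr) auto
      also have "(+) (b i) -` A i = (\<lambda>y. y + b i) -` A i" by (auto simp: add.commute)
      finally show "emeasure lborel ((\<lambda>y. y + b i) -` A i) = emeasure lborel (A i)" by simp
    qed simp
    finally show "emeasure (distr ?P ?P ?t) (Pi\<^sub>E {..<d} A) = (\<Prod>i\<in>{..<d}. emeasure lborel (A i))" .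
  qed auto
  note eq = this
  have e: "embed_Rd d (?t x) = embed_Rd d x + b" for x
    using b by (force simp: embed_Rd_def Rd_def fun_eq_iff)
  have [measurable]: "(\<lambda>x. x + b) \<in> borel \<rightarrow>\<^sub>M borel"
    by (intro measurable_plus_fun) auto
  have "(\<integral>\<^sup>+x. f x \<partial>vol_Rd d) = (\<integral>\<^sup>+x. f (embed_Rd d x) \<partial>distr ?P ?P ?t)"
    by (subst eq) (simp add: nn_integral_vol_Rd)
  also have "\<dots> = (\<integral>\<^sup>+x. f (embed_Rd d (?t x)) \<partial>?P)"
    by (rule nn_integral_distr) auto
  also have "\<dots> = (\<integral>\<^sup>+x. f (embed_Rd d x + b) \<partial>?P)" by (simp only: e)
  also have "\<dots> = (\<integral>\<^sup>+x. f (x + b) \<partial>vol_Rd d)" by (rule nn_integral_vol_Rd[symmetric]) auto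
  finally show ?thesis by simp
qed

text \<open>Only additivity of \<open>T\<close> on \<open>Rd d\<close> enters: this is the uniqueness argument for Haar measure.\<close>

lemma vol_Rd_haar:
  assumes [measurable]: "T \<in> borel \<rightarrow>\<^sub>M borel" "f \<in> borel_measurable borel" "g \<in> borel_measurable borel"
    and add: "\<And>x y. x \<in> Rd d \<Longrightarrow> y \<in> Rd d \<Longrightarrow> T (x + y) = T x + T y"
    and T: "\<And>x. x \<in> Rd d \<Longrightarrow> T x \<in> Rd d"
    and surj: "\<And>y. y \<in> Rd d \<Longrightarrow> \<exists>x\<in>Rd d. T x = y"
  shows "(\<integral>\<^sup>+x. f (T x) \<partial>vol_Rd d) * (\<integral>\<^sup>+x. g x \<partial>vol_Rd d)
    = (\<integral>\<^sup>+x. g (T x) \<partial>vol_Rd d) * (\<integral>\<^sup>+x. f (- x) \<partial>vol_Rd d)" (is "?F * ?G = ?GT * ?FN")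
proof -
  let ?\<mu> = "vol_Rd d"
  interpret sigma_finite_measure ?\<mu> by (rule sigma_finite_vol_Rd)
  interpret pair_sigma_finite ?\<mu> ?\<mu> ..
  have AEm: "AE x in ?\<mu>. x \<in> Rd d" by (rule AE_vol_Rd)
  have [measurable]: "(\<lambda>(x, y). f (T x) * g (y + T x)) \<in> borel_measurable (?\<mu> \<Otimes>\<^sub>M ?\<mu>)" by measurable
  have [measurable]: "(\<lambda>(x, y). f (T x - y) * g (T x)) \<in> borel_measurable (?\<mu> \<Otimes>\<^sub>M ?\<mu>)" by measurable
  have "?F * ?G = (\<integral>\<^sup>+x. f (T x) * ?G \<partial>?\<mu>)" by (rule nn_integral_multc[symmetric]) measurable
  \<comment> \<open>For fixed \<open>x\<close> the integral of \<open>g\<close> is unchanged by the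
    shift by \<open>T x\<close>.\<close>
  also have "\<dots> = (\<integral>\<^sup>+x. (\<integral>\<^sup>+y. f (T x) * g (y + T x) \<partial>?\<mu>) \<partial>?\<mu>)"
    using AEm by (intro nn_integral_cong_AE) (auto elim!: eventually_mono simp: nn_integral_cmult vol_Rd_translation T)
  also have "\<dots> = (\<integral>\<^sup>+y. (\<integral>\<^sup>+x. f (T x) * g (y + T x) \<partial>?\<mu>) \<partial>?\<mu>)"
    by (rule Fubini'[symmetric]) measurable
  also have "\<dots> = (\<integral>\<^sup>+y. (\<integral>\<^sup>+x. f (T x - y) * g (T x) \<partial>?\<mu>) \<partial>?\<mu>)"
  proof (rule nn_integral_cong_AE)
    show "AE y in ?\<mu>. (\<integral>\<^sup>+x. f (T x) * g (y + T x) \<partial>?\<mu>) = (\<integral>\<^sup>+x. f (T x - y) * g (T x) \<partial>?\<mu>)"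
      using AEm
    proof eventually_elim
      case (elim y)
      then obtain z where z: "z \<in> Rd d" "T z = y" using surj by blast
      \<comment> \<open>With \<open>T z = y\<close>, the substitution of \<open>x + z\<close> for
        \<open>x\<close> removes \<open>y\<close> from the argument of \<open>f\<close> and adds it
        in that of \<open>g\<close>.\<close>
      have "(\<integral>\<^sup>+x. f (T x - y) * g (T x) \<partial>?\<mu>) = (\<integral>\<^sup>+x. f (T (x + z) - y) * g (T (x + z)) \<partial>?\<mu>)"
        by (rule vol_Rd_translation[symmetric]) (use z in measurable)
      also have "\<dots> = (\<integral>\<^sup>+x. f (T x) * g (y + T x) \<partial>?\<mu>)"
        using AEm by (intro nn_integral_cong_AE) (auto elim!: eventually_mono simp: add z add.commute)
      finally show ?case by simp
    qed
  qed
  also have "\<dots> = (\<integral>\<^sup>+x. (\<integral>\<^sup>+y. f (T x - y) * g (T x) \<partial>?\<mu>) \<partial>?\<mu>)"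
    by (rule Fubini') measurable
  also have "\<dots> = (\<integral>\<^sup>+x. ?FN * g (T x) \<partial>?\<mu>)"
  proof (rule nn_integral_cong_AE)
    show "AE x in ?\<mu>. (\<integral>\<^sup>+y. f (T x - y) * g (T x) \<partial>?\<mu>) = ?FN * g (T x)"
      using AEm
    proof eventually_elim
      case (elim x)
      have "(\<integral>\<^sup>+y. f (T x - y) * g (T x) \<partial>?\<mu>) = (\<integral>\<^sup>+y. f (T x - (y + T x)) \<partial>?\<mu>) * g (T x)"
        by (subst vol_Rd_translation[where b = "T x"]) (use elim T in \<open>auto simp: nn_integral_multc\<close>)
      then show ?case by simp
    qed
  qed
  also have "\<dots> = ?FN * ?GT" by (rule nn_integral_cmult) measurable
  finally show ?thesis by (simp add: mult.commute)
qed

section \<open>Linear maps and the scaling of volume\<close>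

definition mv :: "nat \<Rightarrow> (nat \<Rightarrow> nat \<Rightarrow> real) \<Rightarrow> (nat \<Rightarrow> real) \<Rightarrow> nat \<Rightarrow> real"
  where "mv d M x = (\<lambda>i. if i < d then \<Sum>j<d. M i j * x j else 0)"

text \<open>Tested on \<open>Rd d\<close> only: \<open>mv d M\<close> discards all coordinates from
  \<open>d\<close> on, so it is never injective on the whole sequence space.\<close>

definition mutual_inverse :: "nat \<Rightarrow> (nat \<Rightarrow> nat \<Rightarrow> real) \<Rightarrow> (nat \<Rightarrow> nat \<Rightarrow> real) \<Rightarrow> bool"
  where "mutual_inverse d M N \<longleftrightarrow> (\<forall>x\<in>Rd d. mv d M (mv d N x) = x \<and> mv d N (mv d M x) = x)"

definition axis_Rd :: "nat \<Rightarrow> nat \<Rightarrow> real"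
  where "axis_Rd j = (\<lambda>i. if i = j then 1 else 0)"

lemma mv_apply: "i < d \<Longrightarrow> mv d M x i = (\<Sum>j<d. M i j * x j)"
  by (simp add: mv_def)

lemma mv_in [simp, intro]: "mv d M x \<in> Rd d"
  by (simp add: mv_def Rd_def)

lemma linear_mv: "linear (mv d M)"
  by (rule linearI) (auto simp: mv_def fun_eq_iff algebra_simps sum.distrib sum_distrib_left)

lemma mv_add: "mv d M (x + y) = mv d M x + mv d M y"
  and mv_diff: "mv d M (x - y) = mv d M x - mv d M y"
  and mv_scaleR: "mv d M (c *\<^sub>R x) = c *\<^sub>R mv d M x"
  and mv_zero: "mv d M 0 = 0"
  and mv_sum: "mv d M (sum f S) = (\<Sum>i\<in>S. mv d M (f i))"
  by (fact linear_add[OF linear_mv] linear_diff[OF linear_mv] linear_cmul[OF linear_mv]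
    linear_0[OF linear_mv] linear_sum[OF linear_mv])+

lemma continuous_coord [continuous_intros]: "continuous_on S (\<lambda>x::nat \<Rightarrow> real. x i)"
  by (rule continuous_on_product_then_coordinatewise) (rule continuous_on_id)

lemma continuous_mv [continuous_intros]: "continuous_on S (mv d M)"
proof (rule continuous_on_coordinatewise_then_product)
  fix i
  show "continuous_on S (\<lambda>x. mv d M x i)"
    by (cases "i < d") (auto simp: mv_def intro!: continuous_intros)
qed

lemma mv_measurable [measurable]: "mv d M \<in> borel \<rightarrow>\<^sub>M borel"
  by (rule borel_measurable_continuous_onI) (rule continuous_mv)

lemma axis_Rd_apply: "axis_Rd j i = (if i = j then 1 else 0)"
  by (simp add: axis_Rd_def)

lemma axis_in [simp, intro]: "j < d \<Longrightarrow> axis_Rd j \<in> Rd d"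
  by (simp add: axis_Rd_def Rd_def)

lemma sum_axis [simp]: "j < d \<Longrightarrow> (\<Sum>i<d. f i * axis_Rd j i) = (f j :: real)"
  by (simp add: axis_Rd_def if_distrib[of "\<lambda>x. _ * x"] sum.delta cong: if_cong)

lemma sum_axis' [simp]: "j < d \<Longrightarrow> (\<Sum>i<d. axis_Rd j i * f i) = (f j :: real)"
  using sum_axis[of j d f] by (simp add: mult.commute)

lemma mv_axis: "j < d \<Longrightarrow> i < d \<Longrightarrow> mv d M (axis_Rd j) i = M i j"
  by (simp add: mv_apply)

lemma Rd_expand: "x \<in> Rd d \<Longrightarrow> x = (\<Sum>j<d. x j *\<^sub>R axis_Rd j)"
  by (rule Rd_eqI[of _ d])
    (auto intro!: Rd_sum Rd_scaleR simp: sum_fun_apply axis_Rd_apply if_distrib[of "\<lambda>x. _ * x"] cong: if_cong)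

lemma linear_eq_mv:
  assumes "linear A" "\<And>x. x \<in> Rd d \<Longrightarrow> A x \<in> Rd d" "x \<in> Rd d"
  shows "A x = mv d (\<lambda>i j. A (axis_Rd j) i) x"
proof (rule Rd_eqI[of _ d])
  fix i assume "i < d"
  have "A x = (\<Sum>j<d. x j *\<^sub>R A (axis_Rd j))"
    by (subst Rd_expand[OF assms(3)]) (simp add: linear_sum[OF assms(1)] linear_cmul[OF assms(1)])
  then show "A x i = mv d (\<lambda>i j. A (axis_Rd j) i) x i"
    using \<open>i < d\<close> by (simp add: mv_apply sum_fun_apply mult.commute)
qed (use assms in auto)

lemma Rd_span: "Rd d \<subseteq> span (axis_Rd ` {..<d})"
proof
  fix x assume "x \<in> Rd d"
  then have "x = (\<Sum>j<d. x j *\<^sub>R axis_Rd j)" by (rule Rd_expand)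
  also have "\<dots> \<in> span (axis_Rd ` {..<d})"
    by (intro span_sum span_scale span_base) auto
  finally show "x \<in> span (axis_Rd ` {..<d})" .
qed

lemma subspace_Rd: "subspace (Rd d)"
  by (auto simp: subspace_def)

lemma inj_axis: "inj_on axis_Rd S"
  by (auto simp: inj_on_def axis_Rd_def fun_eq_iff split: if_splits)

lemma independent_axis: "independent (axis_Rd ` {..<d})"
proof (rule independent_if_scalars_zero)
  fix f x assume s: "(\<Sum>x\<in>axis_Rd ` {..<d}. f x *\<^sub>R x) = 0" and "x \<in> axis_Rd ` {..<d}"
  then obtain j where j: "j < d" "x = axis_Rd j" by auto
  from s have "(\<Sum>i<d. f (axis_Rd i) *\<^sub>R axis_Rd i) j = 0"
    by (subst (asm) sum.reindex[OF inj_axis]) simp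
  then show "f x = 0" using j
    by (simp add: sum_fun_apply axis_Rd_def if_distrib[of "\<lambda>x. _ * x"] cong: if_cong)
qed simp

text \<open>Dimension count: the images of the axis vectors are \<open>d\<close> independent vectors
  inside a span of \<open>d\<close> vectors, so a vector outside their span could be adjoined to
  give too many independent ones. The columns of \<open>N\<close> are preimages of the axis
  vectors.\<close>

lemma inj_mv_imp_inverse:
  assumes inj: "\<And>x. x \<in> Rd d \<Longrightarrow> mv d M x = 0 \<Longrightarrow> x = 0"
  shows "\<exists>N. mutual_inverse d M N"
proof -
  let ?E = "axis_Rd ` {..<d}"
  have sp: "span ?E \<subseteq> Rd d" by (rule span_minimal) (auto simp: subspace_Rd)
  have injE: "inj_on (mv d M) (span ?E)"
  proof (rule inj_onI)
    fix x y assume "x \<in> span ?E" "y \<in> span ?E" "mv d M x = mv d M y"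
    then show "x = y" using inj[of "x - y"] sp by (auto simp: mv_diff)
  qed
  have ind: "independent (mv d M ` ?E)"
    by (rule linear_independent_injective_image[OF linear_mv independent_axis injE])
  have card: "card (mv d M ` ?E) = d"
    using card_image[OF inj_on_subset[OF injE span_superset]] by (simp add: card_image inj_axis)
  have surj: "\<exists>x\<in>Rd d. mv d M x = y" if y: "y \<in> Rd d" for y
  proof -
    have "y \<in> span (mv d M ` ?E)"
    proof (rule ccontr)
      assume n: "y \<notin> span (mv d M ` ?E)"
      then have "independent (insert y (mv d M ` ?E))" using ind by (rule independent_insertI)
      moreover have "insert y (mv d M ` ?E) \<subseteq> span ?E" using y Rd_span[of d] by auto
      ultimately have "card (insert y (mv d M ` ?E)) \<le> card ?E"
        using independent_span_bound[of ?E] by blast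
      moreover have "y \<notin> mv d M ` ?E" using n span_base by metis
      ultimately show False by (simp add: card card_image inj_axis)
    qed
    also have "span (mv d M ` ?E) = mv d M ` span ?E" by (rule linear_span_image[OF linear_mv])
    finally show ?thesis using sp by auto
  qed
  then obtain g where g: "\<And>y. y \<in> Rd d \<Longrightarrow> g y \<in> Rd d" "\<And>y. y \<in> Rd d \<Longrightarrow> mv d M (g y) = y" by metis
  define N where "N = (\<lambda>i j. g (axis_Rd j) i)"
  have MN: "mv d M (mv d N x) = x" if "x \<in> Rd d" for x
  proof -
    have "mv d N (axis_Rd j) = g (axis_Rd j)" if "j < d" for j
      using that g by (intro Rd_eqI[of _ d]) (auto simp: mv_axis N_def)
    then have "mv d M (mv d N (\<Sum>j<d. x j *\<^sub>R axis_Rd j)) = (\<Sum>j<d. x j *\<^sub>R axis_Rd j)"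
      by (simp add: mv_sum mv_scaleR g)
    then show ?thesis by (simp only: Rd_expand[OF that, symmetric])
  qed
  have "mv d N (mv d M x) = x" if "x \<in> Rd d" for x
    using inj[of "mv d N (mv d M x) - x"] MN[of "mv d M x"] that by (auto simp: mv_diff)
  with MN show ?thesis by (auto simp: mutual_inverse_def)
qed

lemma mutual_inverse_sym: "mutual_inverse d M N \<Longrightarrow> mutual_inverse d N M"
  by (auto simp: mutual_inverse_def)

text \<open>The factor belongs to preimages: for an invertible matrix it is the reciprocal of the
  absolute determinant, hence the inverted products of diagonal entries below.\<close>

definition scales :: "nat \<Rightarrow> ((nat \<Rightarrow> real) \<Rightarrow> nat \<Rightarrow> real) \<Rightarrow> real \<Rightarrow> bool"
  where "scales d T c \<longleftrightarrow> T \<in> borel \<rightarrow>\<^sub>M borel \<and> c > 0 \<and>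
    (\<forall>f\<in>borel_measurable borel. (\<integral>\<^sup>+x. f (T x) \<partial>vol_Rd d) = ennreal c * (\<integral>\<^sup>+x. f x \<partial>vol_Rd d))"

lemma scales_nn: "scales d T c \<Longrightarrow> f \<in> borel_measurable borel \<Longrightarrow>
    (\<integral>\<^sup>+x. f (T x) \<partial>vol_Rd d) = ennreal c * (\<integral>\<^sup>+x. f x \<partial>vol_Rd d)"
  and scales_pos: "scales d T c \<Longrightarrow> c > 0"
  and scales_measurable: "scales d T c \<Longrightarrow> T \<in> borel \<rightarrow>\<^sub>M borel"
  by (auto simp: scales_def)

lemma scales_emeasure:
  assumes "scales d T c" "S \<in> sets borel"
  shows "emeasure (vol_Rd d) (T -` S) = ennreal c * emeasure (vol_Rd d) S"
proof -
  have m: "T -` S \<in> sets borel" using measurable_sets[OF scales_measurable[OF assms(1)] assms(2)] by simp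
  have "(\<integral>\<^sup>+x. indicator S (T x) \<partial>vol_Rd d) = ennreal c * (\<integral>\<^sup>+x. indicator S x \<partial>vol_Rd d)"
    by (rule scales_nn[OF assms(1)]) (use assms(2) in simp)
  moreover have "indicator S (T x) = (indicator (T -` S) x :: ennreal)" for x
    by (simp add: indicator_def)
  ultimately show ?thesis using m assms(2) by simp
qed

lemma scales_comp:
  assumes "scales d S c" "scales d T c'"
  shows "scales d (\<lambda>x. S (T x)) (c * c')"
proof -
  note [measurable] = scales_measurable[OF assms(1)] scales_measurable[OF assms(2)]
  have "(\<integral>\<^sup>+x. f (S (T x)) \<partial>vol_Rd d) = ennreal (c * c') * (\<integral>\<^sup>+x. f x \<partial>vol_Rd d)"
    if [measurable]: "f \<in> borel_measurable borel" for f
    using scales_nn[OF assms(2), of "\<lambda>x. f (S x)"] scales_nn[OF assms(1), of f]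
      scales_pos[OF assms(1)] scales_pos[OF assms(2)]
    by (simp add: ennreal_mult' mult_ac)
  then show ?thesis
    using scales_pos[OF assms(1)] scales_pos[OF assms(2)] by (auto simp: scales_def)
qed

lemma scales_cong:
  assumes "scales d T c" "\<And>x. x \<in> Rd d \<Longrightarrow> T x = T' x" "T' \<in> borel \<rightarrow>\<^sub>M borel"
  shows "scales d T' c"
proof -
  have "(\<integral>\<^sup>+x. f (T' x) \<partial>vol_Rd d) = (\<integral>\<^sup>+x. f (T x) \<partial>vol_Rd d)" for f :: "_ \<Rightarrow> ennreal"
    using AE_vol_Rd[of d] by (intro nn_integral_cong_AE) (auto elim!: eventually_mono simp: assms(2))
  then show ?thesis using assms by (auto simp: scales_def)
qed

lemma emeasure_vol_unit: "emeasure (vol_Rd d) {x. \<forall>i<d. 0 \<le> x i \<and> x i \<le> 1} = 1"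
  using emeasure_vol_cbox[of d "\<lambda>_. 0" "\<lambda>_. 1"] by simp

text \<open>The unit cube has volume 1, so the volume of its preimage recovers the factor.\<close>

lemma scales_unique:
  assumes "scales d T c" "scales d T c'"
  shows "c = c'"
  using scales_emeasure[OF assms(1), of "{x. \<forall>i<d. 0 \<le> x i \<and> x i \<le> 1}"]
    scales_emeasure[OF assms(2), of "{x. \<forall>i<d. 0 \<le> x i \<and> x i \<le> 1}"]
    scales_pos[OF assms(1)] scales_pos[OF assms(2)]
  by (simp add: emeasure_vol_unit)

lemma scales_translation: "b \<in> Rd d \<Longrightarrow> scales d (\<lambda>x. x + b) 1"
  by (auto simp: scales_def vol_Rd_translation)

lemma scales_id: "scales d (\<lambda>x. x) 1"
  by (auto simp: scales_def)

text \<open>The Haar identity for the identity map, with the indicator of the unit cube as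
  \<open>g\<close>: the factors coming from \<open>g\<close> are 1 and cancel.\<close>

lemma vol_Rd_reflect:
  assumes [measurable]: "f \<in> borel_measurable borel"
  shows "(\<integral>\<^sup>+x. f (- x) \<partial>vol_Rd d) = (\<integral>\<^sup>+x. f x \<partial>vol_Rd d)"
proof -
  let ?g = "indicator {x::nat \<Rightarrow> real. \<forall>i<d. 0 \<le> x i \<and> x i \<le> 1} :: _ \<Rightarrow> ennreal"
  have "(\<integral>\<^sup>+x. f x \<partial>vol_Rd d) * (\<integral>\<^sup>+x. ?g x \<partial>vol_Rd d) = (\<integral>\<^sup>+x. ?g x \<partial>vol_Rd d) * (\<integral>\<^sup>+x. f (- x) \<partial>vol_Rd d)"
    by (rule vol_Rd_haar[of "\<lambda>x. x"]) auto
  then show ?thesis by (simp add: emeasure_vol_unit)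
qed

text \<open>The Haar identity gives proportionality, with the volume of the preimage of the unit
  cube as factor. It remains to see that this volume is neither zero nor infinite.\<close>

lemma scales_exists:
  assumes inv: "mutual_inverse d M N"
  shows "\<exists>c. scales d (mv d M) c"
proof -
  let ?B = "{x::nat \<Rightarrow> real. \<forall>i<d. 0 \<le> x i \<and> x i \<le> 1}"
  let ?g = "indicator ?B :: _ \<Rightarrow> ennreal"
  define c where "c = (\<integral>\<^sup>+x. ?g (mv d M x) \<partial>vol_Rd d)"
  have eq: "(\<integral>\<^sup>+x. f (mv d M x) \<partial>vol_Rd d) = c * (\<integral>\<^sup>+x. f x \<partial>vol_Rd d)"
    if [measurable]: "f \<in> borel_measurable borel" for f
  proof -
    have "(\<integral>\<^sup>+x. f (mv d M x) \<partial>vol_Rd d) * (\<integral>\<^sup>+x. ?g x \<partial>vol_Rd d) = c * (\<integral>\<^sup>+x. f (- x) \<partial>vol_Rd d)"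
      unfolding c_def
    proof (rule vol_Rd_haar)
      fix y assume "y \<in> Rd d"
      then show "\<exists>x\<in>Rd d. mv d M x = y" using inv by (intro bexI[of _ "mv d N y"]) (auto simp: mutual_inverse_def)
    qed (auto simp: mv_add)
    then show ?thesis by (simp add: emeasure_vol_unit vol_Rd_reflect)
  qed
  have "c \<noteq> 0"
  proof
    assume "c = 0"
    then have "emeasure (vol_Rd d) UNIV = 0" using eq[of "\<lambda>_. 1"] by simp
    moreover have "emeasure (vol_Rd d) ?B \<le> emeasure (vol_Rd d) UNIV" by (rule emeasure_mono) auto
    ultimately show False by (simp add: emeasure_vol_unit)
  qed
  moreover have "c < \<infinity>"
  proof -
    \<comment> \<open>Absolute row sums of \<open>N\<close>: since \<open>x = N (M x)\<close>, the
      preimage of the cube lies in the box with half-widths \<open>r i\<close>.\<close>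
    define r where "r = (\<lambda>i. \<Sum>j<d. \<bar>N i j\<bar>)"
    have r0: "r i \<ge> 0" for i by (simp add: r_def sum_nonneg)
    have sub: "\<forall>i<d. - r i \<le> x i \<and> x i \<le> r i" if "x \<in> Rd d" "mv d M x \<in> ?B" for x
    proof (intro allI impI)
      fix i assume i: "i < d"
      have "x i = (\<Sum>j<d. N i j * mv d M x j)"
        using inv that i mv_apply[of i d N "mv d M x"] by (simp add: mutual_inverse_def)
      also have "\<bar>\<dots>\<bar> \<le> (\<Sum>j<d. \<bar>N i j * mv d M x j\<bar>)" by (rule sum_abs)
      also have "\<dots> \<le> r i" unfolding r_def using that
        by (intro sum_mono) (auto simp: abs_mult intro!: mult_left_le)
      finally show "- r i \<le> x i \<and> x i \<le> r i" by linarith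
    qed
    have "c \<le> (\<integral>\<^sup>+x. indicator {x. \<forall>i<d. - r i \<le> x i \<and> x i \<le> r i} x \<partial>vol_Rd d)"
      unfolding c_def using AE_vol_Rd[of d] sub
      by (intro nn_integral_mono_AE) (force elim!: eventually_mono simp: indicator_def)
    also have "\<dots> = emeasure (vol_Rd d) {x. \<forall>i<d. - r i \<le> x i \<and> x i \<le> r i}"
      by (rule nn_integral_indicator) simp
    also have "\<dots> < \<infinity>" by (subst emeasure_vol_cbox) (use r0 in \<open>auto intro: order_trans[of _ 0]\<close>)
    finally show ?thesis .
  qed
  ultimately obtain c' where "c = ennreal c'" "c' > 0"
    by (cases c) (auto simp: less_le)
  then show ?thesis using eq by (auto simp: scales_def)
qed

text \<open>Elementary matrices: a shear if \<open>r k = 1\<close>, a dilation of one axis if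
  \<open>r\<close> is supported at \<open>k\<close>. Triangular matrices with positive diagonal are
  products of them.\<close>

definition row_matrix :: "nat \<Rightarrow> (nat \<Rightarrow> real) \<Rightarrow> nat \<Rightarrow> nat \<Rightarrow> real"
  where "row_matrix k r = (\<lambda>i. if i = k then r else axis_Rd i)"

lemma mv_row: "i < d \<Longrightarrow> mv d (row_matrix k r) x i = (if i = k then \<Sum>j<d. r j * x j else x i)"
  using sum_axis[of i d x] by (auto simp: mv_apply row_matrix_def mult.commute)

text \<open>Elementary matrices with the same \<open>k\<close> are closed under composition, so
  relations between them are checked on a single row.\<close>

lemma mv_row_comp:
  assumes k: "k < d"
  shows "mv d (row_matrix k r) (mv d (row_matrix k s) x) =
    mv d (row_matrix k (\<lambda>j. if j = k then r k * s k else r j + r k * s j)) x"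
proof (rule Rd_eqI[of _ d])
  fix i assume i: "i < d"
  have split: "(\<Sum>j<d. f j) = f k + (\<Sum>j\<in>{..<d} - {k}. f j)" for f :: "nat \<Rightarrow> real"
    using k by (subst sum.remove[of _ k]) auto
  show "mv d (row_matrix k r) (mv d (row_matrix k s) x) i =
    mv d (row_matrix k (\<lambda>j. if j = k then r k * s k else r j + r k * s j)) x i"
  proof (cases "i = k")
    case True
    have "(\<Sum>j<d. r j * mv d (row_matrix k s) x j) = r k * (\<Sum>j<d. s j * x j) + (\<Sum>j\<in>{..<d} - {k}. r j * x j)"
      by (subst split) (use k in \<open>auto simp: mv_row intro!: sum.cong\<close>)
    also have "\<dots> = (\<Sum>j<d. (if j = k then r k * s k else r j + r k * s j) * x j)"
      by (subst (1 2) split) (simp add: algebra_simps sum.distrib sum_distrib_left)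
    finally show ?thesis using i True by (simp add: mv_row)
  qed (use i in \<open>simp add: mv_row\<close>)
qed auto

lemma mv_row_id: "k < d \<Longrightarrow> x \<in> Rd d \<Longrightarrow> mv d (row_matrix k (axis_Rd k)) x = x"
  using sum_axis[of k d x] by (intro Rd_eqI[of _ d]) (auto simp: mv_row mult.commute)

lemma row_inverse:
  assumes "k < d" "r k \<noteq> 0"
  shows "mutual_inverse d (row_matrix k r) (row_matrix k (\<lambda>j. if j = k then 1 / r k else - r j / r k))"
proof -
  have "(\<lambda>j. if j = k then r k * (1 / r k) else r j + r k * (- r j / r k)) = axis_Rd k"
    "(\<lambda>j. if j = k then 1 / r k * r k else - r j / r k + 1 / r k * r j) = axis_Rd k"
    using assms by (auto simp: axis_Rd_def)
  with assms mv_row_id[OF assms(1)] show ?thesis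
    by (simp add: mutual_inverse_def mv_row_comp cong: if_cong)
qed

lemma hyperplane_borel [measurable]: "{x::nat \<Rightarrow> real. (\<Sum>j<d. \<phi> j * x j) = \<beta>} \<in> sets borel"
  by measurable

text \<open>With \<open>\<phi>\<close> as row \<open>k\<close>, an elementary matrix turns the
  hyperplane into a coordinate hyperplane, which is a box with a one-point factor.\<close>

lemma hyperplane_null:
  assumes k: "k < d" "\<phi> k \<noteq> 0"
  shows "emeasure (vol_Rd d) {x. (\<Sum>j<d. \<phi> j * x j) = \<beta>} = 0"
proof -
  obtain c where c: "scales d (mv d (row_matrix k \<phi>)) c"
    using scales_exists[OF row_inverse[of k d \<phi>]] k by blast
  let ?A = "\<lambda>i. if i = k then {\<beta>} else UNIV"
  have "emeasure (vol_Rd d) {x. \<forall>i<d. x i \<in> ?A i} = (\<Prod>i<d. emeasure lborel (?A i))"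
    by (rule emeasure_vol_box) auto
  also have "\<dots> = 0" using k by (intro prod_zero bexI[of _ k]) auto
  also have "{x. \<forall>i<d. x i \<in> ?A i} = {x. x k = \<beta>}" using k by auto
  finally have "emeasure (vol_Rd d) {x. x k = \<beta>} = 0" .
  moreover have "{x::nat \<Rightarrow> real. x k = \<beta>} \<in> sets borel" by measurable
  ultimately have "emeasure (vol_Rd d) (mv d (row_matrix k \<phi>) -` {x. x k = \<beta>}) = 0"
    using scales_emeasure[OF c] by (simp del: vimage_Collect_eq)
  then show ?thesis using k by (simp add: vimage_def mv_row)
qed

text \<open>Doubling coordinate \<open>k\<close> conjugates the shear to its square, so the factor
  satisfies \<open>c = c * c\<close>.\<close>

lemma scales_shear:
  assumes k: "k < d" "r k = 1"
  shows "scales d (mv d (row_matrix k r)) 1"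
proof -
  let ?S = "mv d (row_matrix k r)" and ?D = "mv d (row_matrix k (\<lambda>j. 2 * axis_Rd k j))"
  obtain c where c: "scales d ?S c" using scales_exists[OF row_inverse[of k d r]] k by fastforce
  obtain c' where c': "scales d ?D c'"
    using scales_exists[OF row_inverse[of k d "\<lambda>j. 2 * axis_Rd k j"]] k by (auto simp: axis_Rd_def)
  have "(\<lambda>x. ?D (?S x)) = (\<lambda>x. ?S (?S (?D x)))"
  proof
    fix x show "?D (?S x) = ?S (?S (?D x))"
      unfolding mv_row_comp[OF k(1)]
      by (rule arg_cong[where f = "\<lambda>r. mv d (row_matrix k r) x"]) (auto simp: axis_Rd_def k)
  qed
  then have "c' * c = c * (c * c')"
    using scales_unique[OF _ scales_comp[OF c scales_comp[OF c c']]] scales_comp[OF c' c] by metis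
  then have "c = 1" using scales_pos[OF c] scales_pos[OF c'] by simp
  with c show ?thesis by simp
qed

text \<open>The map is a dilation of coordinate \<open>k\<close> followed by a shear. The preimage
  of the unit cube under the dilation is a box with one side \<open>1 / r k\<close> and all others
  1.\<close>

lemma scales_row:
  assumes k: "k < d" "r k > 0"
  shows "scales d (mv d (row_matrix k r)) (1 / r k)"
proof -
  let ?a = "\<lambda>j. if j = k then r k else 0"
  let ?D = "mv d (row_matrix k ?a)"
  let ?B = "{x::nat \<Rightarrow> real. \<forall>i<d. 0 \<le> x i \<and> x i \<le> 1}"
  let ?s = "\<lambda>j. if j = k then 1 else r j"
  obtain c where c: "scales d ?D c" using scales_exists[OF row_inverse[of k d ?a]] k by auto
  have row: "(\<Sum>j<d. ?a j * x j) = r k * x k" for x :: "nat \<Rightarrow> real"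
    using k by (simp add: if_distrib[of "\<lambda>x. x * _"] cong: if_cong)
  have "0 \<le> ?D x i \<and> ?D x i \<le> 1 \<longleftrightarrow> 0 \<le> x i \<and> x i \<le> (if i = k then 1 / r k else 1)" if "i < d" for x i
  proof (cases "i = k")
    case True
    then show ?thesis unfolding mv_row[OF that] row using k(2)
      by (simp add: zero_le_mult_iff pos_le_divide_eq mult.commute)
  qed (use that in \<open>simp add: mv_row\<close>)
  then have "?D -` ?B = {x. \<forall>i<d. 0 \<le> x i \<and> x i \<le> (if i = k then 1 / r k else 1)}" by blast
  then have "emeasure (vol_Rd d) (?D -` ?B) = ennreal (\<Prod>i<d. (if i = k then 1 / r k else 1))"
    using emeasure_vol_cbox[of d "\<lambda>_. 0" "\<lambda>i. if i = k then 1 / r k else 1"] k by simp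
  also have "\<dots> = ennreal (1 / r k)" using k by (simp add: prod.delta)
  finally have "ennreal c = ennreal (1 / r k)"
    using scales_emeasure[OF c box_borel[of d "\<lambda>_. 0" "\<lambda>_. 1"]] by (simp add: emeasure_vol_unit)
  then have "c = 1 / r k" using scales_pos[OF c] k by (simp add: ennreal_inj)
  have "scales d (\<lambda>x. mv d (row_matrix k ?s) (?D x)) (1 * c)"
    by (rule scales_comp[OF _ c]) (rule scales_shear, use k in auto)
  moreover have "mv d (row_matrix k ?s) (?D x) = mv d (row_matrix k r) x" for x
    unfolding mv_row_comp[OF k(1)]
    by (rule arg_cong[where f = "\<lambda>r. mv d (row_matrix k r) x"]) auto
  ultimately show ?thesis using \<open>c = 1 / r k\<close> by simp
qed

text \<open>The permutation \<open>p\<close> covers lower and upper triangular matrices at once.\<close>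

lemma scales_triangular:
  assumes p: "bij_betw p {..<d} {..<d}"
    and tri: "\<And>i j. i < j \<Longrightarrow> j < d \<Longrightarrow> A (p i) (p j) = 0"
    and pos: "\<And>i. i < d \<Longrightarrow> A i i > 0"
  shows "scales d (mv d A) (1 / (\<Prod>i<d. A i i))"
proof -
  \<comment> \<open>\<open>B m\<close> has the rows \<open>p 0, ..., p (m - 1)\<close> of
    \<open>A\<close> and the rows of the identity elsewhere. Passing to \<open>Suc m\<close>
    multiplies on the right by one elementary matrix, because the rows already placed vanish in
    column \<open>p m\<close>.\<close>
  define B where "B = (\<lambda>m i. if i \<in> p ` {..<m} then A i else axis_Rd i)"
  have pd: "p i < d" if "i < d" for i using p that by (auto simp: bij_betw_def)
  have pinj: "p i = p j \<longleftrightarrow> i = j" if "i < d" "j < d" for i j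
    using p that by (auto simp: bij_betw_def inj_on_def)
  have "m \<le> d \<Longrightarrow> scales d (mv d (B m)) (\<Prod>i<m. 1 / A (p i) (p i))" for m
  proof (induction m)
    case 0
    have "x = mv d (B 0) x" if "x \<in> Rd d" for x
      using that by (intro Rd_eqI[of _ d]) (auto simp: mv_apply B_def axis_Rd_def if_distrib[of "\<lambda>x. x * _"] cong: if_cong)
    then show ?case using scales_cong[OF scales_id] by simp
  next
    case (Suc m)
    then have m: "m < d" and IH: "scales d (mv d (B m)) (\<Prod>i<m. 1 / A (p i) (p i))" by auto
    let ?R = "row_matrix (p m) (A (p m))"
    have eq: "mv d (B m) (mv d ?R x) = mv d (B (Suc m)) x" for x
    proof (rule Rd_eqI[of _ d])
      fix i assume i: "i < d"
      consider "i = p m" | "i \<in> p ` {..<m}" | "i \<notin> p ` {..<Suc m}"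
        by (auto simp: lessThan_Suc)
      then show "mv d (B m) (mv d ?R x) i = mv d (B (Suc m)) x i"
      proof cases
        case 1
        then have "i \<notin> p ` {..<m}" using m pinj by (auto simp: image_iff)
        then have B: "B m i = axis_Rd i" "B (Suc m) i = A (p m)" using 1 by (auto simp: B_def)
        have "mv d (B m) (mv d ?R x) i = mv d ?R x i"
          using i by (simp add: mv_apply[OF i, of "B m"] B)
        also have "\<dots> = mv d (B (Suc m)) x i"
          unfolding mv_apply[OF i] B by (simp add: 1 row_matrix_def)
        finally show ?thesis .
      next
        case 2
        then obtain l where l: "i = p l" "l < m" by auto
        then have B: "B m i = A i" "B (Suc m) i = A i" by (auto simp: B_def)
        have "A i j * mv d ?R x j = A i j * x j" if "j < d" for j
          using tri[of l m] l m that by (cases "j = p m") (auto simp: mv_row)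
        then have "(\<Sum>j<d. A i j * mv d ?R x j) = (\<Sum>j<d. A i j * x j)" by (intro sum.cong) auto
        then show ?thesis using i by (simp only: mv_apply[OF i] B)
      next
        case 3
        then have "B m i = axis_Rd i" "B (Suc m) i = axis_Rd i" "i \<noteq> p m" by (auto simp: B_def)
        then show ?thesis using i by (simp add: mv_apply[of i d "B _"] mv_row)
      qed
    qed auto
    have "scales d (\<lambda>x. mv d (B m) (mv d ?R x)) ((\<Prod>i<m. 1 / A (p i) (p i)) * (1 / A (p m) (p m)))"
      by (rule scales_comp[OF IH scales_row]) (use m pd pos in auto)
    then show ?case by (simp add: eq mult.commute)
  qed
  from this[of d] have *: "scales d (mv d (B d)) (\<Prod>i<d. 1 / A (p i) (p i))" by simp
  have "mv d (B d) = mv d A"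
    using p by (intro ext Rd_eqI[of _ d]) (auto simp: mv_apply B_def bij_betw_def)
  moreover have "(\<Prod>i<d. 1 / A (p i) (p i)) = 1 / (\<Prod>i<d. A i i)"
    using prod.reindex_bij_betw[OF p, of "\<lambda>i. 1 / A i i"] by (simp add: prod_dividef)
  ultimately show ?thesis using * by simp
qed

section \<open>Dilations and similarities\<close>

lemma measurable_scaleR_fun [measurable (raw)]:
  fixes f :: "'a \<Rightarrow> nat \<Rightarrow> real"
  assumes "f \<in> M \<rightarrow>\<^sub>M borel"
  shows "(\<lambda>x. c *\<^sub>R f x) \<in> M \<rightarrow>\<^sub>M borel"
  using assms[THEN measurable_coordD] by (intro measurable_fun_borelI) simp

lemma scales_dilation:
  assumes r: "r > 0"
  shows "scales d (\<lambda>x. r *\<^sub>R x) (1 / r ^ d)"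
proof -
  let ?D = "mv d (\<lambda>i j. if i = j then r else 0)"
  have "scales d ?D (1 / (\<Prod>i<d. r))"
    using scales_triangular[of "\<lambda>i. i" d "\<lambda>i j. if i = j then r else 0"] r by (simp add: bij_betw_def)
  moreover have "?D x = r *\<^sub>R x" if "x \<in> Rd d" for x
    using that by (intro Rd_eqI[of _ d]) (auto simp: mv_apply if_distrib[of "\<lambda>x. x * _"] cong: if_cong)
  ultimately show ?thesis
    using scales_cong[of d ?D] by simp
qed

text \<open>Such a map and the dilation by \<open>r\<close> have the same preimage of the unit ball
  up to a null set. The ball has positive finite volume, so the factors agree; that volume is never
  computed.\<close>

lemma scales_ball:
  assumes M: "mutual_inverse d M N" and r: "r > 0"
    and norm: "\<And>x. x \<in> Rd d \<Longrightarrow> (\<Sum>i<d. (mv d M x i)\<^sup>2) = r\<^sup>2 * (\<Sum>i<d. (x i)\<^sup>2)"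
  shows "scales d (mv d M) (1 / r ^ d)"
proof -
  obtain c where c: "scales d (mv d M) c" using scales_exists[OF M] by blast
  let ?B = "{x::nat \<Rightarrow> real. (\<Sum>i<d. (x i)\<^sup>2) \<le> 1}"
  have [measurable]: "?B \<in> sets borel" by measurable
  have sD: "scales d (\<lambda>x. r *\<^sub>R x) (1 / r ^ d)" by (rule scales_dilation[OF r])
  have "emeasure (vol_Rd d) (mv d M -` ?B) = emeasure (vol_Rd d) ((\<lambda>x. r *\<^sub>R x) -` ?B)"
    using AE_vol_Rd[of d]
    by (intro emeasure_eq_AE) (auto elim!: eventually_mono simp: norm power_mult_distrib sum_distrib_left
        intro!: measurable_sets_borel[OF mv_measurable] measurable_sets_borel[OF scales_measurable[OF sD]])
  then have eq: "ennreal c * emeasure (vol_Rd d) ?B = ennreal (1 / r ^ d) * emeasure (vol_Rd d) ?B"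
    by (simp add: scales_emeasure[OF c] scales_emeasure[OF sD] del: vimage_Collect_eq)
  have "emeasure (vol_Rd d) ?B \<noteq> 0"
  proof
    assume z: "emeasure (vol_Rd d) ?B = 0"
    \<comment> \<open>A coordinate in \<open>[0, 1]\<close> dominates its square, so the squares sum
      to at most \<open>d / (d + 1)\<close>. The \<open>+ 1\<close> also covers
      \<open>d = 0\<close>.\<close>
    have "{x. \<forall>i<d. 0 \<le> x i \<and> x i \<le> 1 / (real d + 1)} \<subseteq> ?B"
    proof safe
      fix x :: "nat \<Rightarrow> real" assume x: "\<forall>i<d. 0 \<le> x i \<and> x i \<le> 1 / (real d + 1)"
      have "(\<Sum>i<d. (x i)\<^sup>2) \<le> (\<Sum>i<d. 1 / (real d + 1))"
      proof (rule sum_mono)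
        fix i assume "i \<in> {..<d}"
        then have i: "0 \<le> x i" "x i \<le> 1 / (real d + 1)" using x by auto
        then have "x i \<le> 1" by (auto intro: order_trans)
        then have "x i * x i \<le> x i * 1" using i by (intro mult_left_mono) auto
        then show "(x i)\<^sup>2 \<le> 1 / (real d + 1)" using i by (simp add: power2_eq_square)
      qed
      also have "\<dots> \<le> 1" by (simp add: field_simps)
      finally show "(\<Sum>i<d. (x i)\<^sup>2) \<le> 1" .
    qed
    then have "emeasure (vol_Rd d) {x. \<forall>i<d. 0 \<le> x i \<and> x i \<le> 1 / (real d + 1)} \<le> 0"
      using emeasure_mono[of _ ?B "vol_Rd d"] z by auto
    then show False using emeasure_vol_cbox[of d "\<lambda>_. 0" "\<lambda>_. 1 / (real d + 1)"]
      by (simp add: prod_pos less_eq_real_def not_less power_le_zero_eq)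
  qed
  moreover have "emeasure (vol_Rd d) ?B \<noteq> \<infinity>"
  proof -
    have "?B \<subseteq> {x. \<forall>i<d. - 1 \<le> x i \<and> x i \<le> 1}"
    proof safe
      fix x :: "nat \<Rightarrow> real" and i assume x: "(\<Sum>i<d. (x i)\<^sup>2) \<le> 1" and i: "i < d"
      have "(x i)\<^sup>2 \<le> (\<Sum>i<d. (x i)\<^sup>2)" using i by (intro member_le_sum) auto
      with x have "\<bar>x i\<bar> \<le> 1" using abs_square_le_1[of "x i"] by linarith
      then show "- 1 \<le> x i" "x i \<le> 1" by auto
    qed
    then have "emeasure (vol_Rd d) ?B \<le> emeasure (vol_Rd d) {x. \<forall>i<d. - 1 \<le> x i \<and> x i \<le> 1}"
      by (intro emeasure_mono) auto
    also have "\<dots> < \<infinity>" using emeasure_vol_cbox[of d "\<lambda>_. -1" "\<lambda>_. 1"] by simp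
    finally show ?thesis by simp
  qed
  ultimately have "ennreal c = ennreal (1 / r ^ d)"
    using eq ennreal_mult_cancel_left[of "emeasure (vol_Rd d) ?B" "ennreal c" "ennreal (1 / r ^ d)"]
    by (simp add: mult.commute)
  then have "c = 1 / r ^ d" using scales_pos[OF c] r by (simp add: ennreal_inj)
  with c show ?thesis by simp
qed

section \<open>Orthogonalization and moments of the standard simplex\<close>

text \<open>A right inverse suffices: it makes \<open>N\<close> injective, hence invertible, and
  then \<open>M\<close> agrees with the inverse of \<open>N\<close>.\<close>

lemma mutual_inverseI:
  assumes MN: "\<And>x. x \<in> Rd d \<Longrightarrow> mv d M (mv d N x) = x"
  shows "mutual_inverse d M N"
proof -
  have "\<exists>N'. mutual_inverse d N N'"
    by (rule inj_mv_imp_inverse) (metis MN mv_zero)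
  then obtain N' where N': "mutual_inverse d N N'" ..
  have "mv d M y = mv d N' y" if "y \<in> Rd d" for y
    using N' that MN[of "mv d N' y"] by (simp add: mutual_inverse_def)
  with N' MN show ?thesis by (simp add: mutual_inverse_def)
qed

definition tr :: "(nat \<Rightarrow> nat \<Rightarrow> real) \<Rightarrow> nat \<Rightarrow> nat \<Rightarrow> real"
  where "tr M = (\<lambda>i j. M j i)"

lemma inner_mv: "inner_Rd d (mv d M x) y = inner_Rd d x (mv d (tr M) y)"
proof -
  have "inner_Rd d (mv d M x) y = (\<Sum>i<d. \<Sum>j<d. M i j * x j * y i)"
    by (simp add: inner_Rd_def mv_apply sum_distrib_right)
  also have "\<dots> = (\<Sum>j<d. \<Sum>i<d. M i j * x j * y i)" by (rule sum.swap)
  also have "\<dots> = inner_Rd d x (mv d (tr M) y)"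
    by (simp add: inner_Rd_def mv_apply sum_distrib_left tr_def mult_ac)
  finally show ?thesis .
qed

lemma orthogonal_inverse:
  assumes "r \<noteq> 0" and orth: "\<And>i j. i < d \<Longrightarrow> j < d \<Longrightarrow> inner_Rd d (Q i) (Q j) = (if i = j then r\<^sup>2 else 0)"
  shows "mutual_inverse d Q (\<lambda>i j. tr Q i j / r\<^sup>2)"
proof (rule mutual_inverseI, rule Rd_eqI[of _ d])
  fix x i assume x: "x \<in> Rd d" and i: "i < d"
  have "mv d Q (mv d (\<lambda>i j. tr Q i j / r\<^sup>2) x) i = (\<Sum>k<d. \<Sum>j<d. Q i k * Q j k / r\<^sup>2 * x j)"
    using i by (simp add: mv_apply tr_def sum_distrib_left mult_ac)
  also have "\<dots> = (\<Sum>j<d. \<Sum>k<d. Q i k * Q j k / r\<^sup>2 * x j)" by (rule sum.swap)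
  also have "\<dots> = (\<Sum>j<d. inner_Rd d (Q i) (Q j) / r\<^sup>2 * x j)"
    by (simp add: inner_Rd_def sum_distrib_right sum_divide_distrib)
  also have "\<dots> = (\<Sum>j<d. if i = j then x j else 0)"
    using assms i by (intro sum.cong) auto
  also have "\<dots> = x i" using i by simp
  finally show "mv d Q (mv d (\<lambda>i j. tr Q i j / r\<^sup>2) x) i = x i" .
qed auto

text \<open>The hypothesis concerns the rows of \<open>Q\<close>. Two-sidedness of the inverse
  transfers it to the columns, and that is what makes \<open>Q\<close> multiply norms by
  \<open>r\<close>.\<close>

lemma orthogonal_scales:
  assumes r: "r > 0" and orth: "\<And>i j. i < d \<Longrightarrow> j < d \<Longrightarrow> inner_Rd d (Q i) (Q j) = (if i = j then r\<^sup>2 else 0)"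
  shows "scales d (mv d Q) (1 / r ^ d)"
proof (rule scales_ball[OF orthogonal_inverse r])
  fix x assume x: "x \<in> Rd d"
  have inv: "mutual_inverse d Q (\<lambda>i j. tr Q i j / r\<^sup>2)"
    using orthogonal_inverse[of r d Q] assms by simp
  have "mv d (tr Q) (mv d Q x) = r\<^sup>2 *\<^sub>R mv d (\<lambda>i j. tr Q i j / r\<^sup>2) (mv d Q x)"
    using r by (intro Rd_eqI[of _ d]) (auto simp: mv_apply sum_distrib_left)
  also have "\<dots> = r\<^sup>2 *\<^sub>R x" using inv x by (simp add: mutual_inverse_def)
  finally have "inner_Rd d (mv d Q x) (mv d Q x) = inner_Rd d x (r\<^sup>2 *\<^sub>R x)"
    by (simp add: inner_mv)
  then show "(\<Sum>i<d. (mv d Q x i)\<^sup>2) = r\<^sup>2 * (\<Sum>i<d. (x i)\<^sup>2)"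
    by (simp add: inner_Rd_def power2_eq_square sum_distrib_left mult_ac)
qed (use assms in auto)

text \<open>The axis vectors are orthonormalized in their order, so row \<open>i\<close> involves
  only the first \<open>i + 1\<close> coordinates, and its diagonal entry is the normalizing factor
  of a residual with leading entry 1. It is applied to the scatter form of the points and to the
  covariance form of the body.\<close>

lemma gram_schmidt:
  fixes b :: "(nat \<Rightarrow> real) \<Rightarrow> (nat \<Rightarrow> real) \<Rightarrow> real"
  assumes lin: "\<And>y. linear (\<lambda>x. b x y)" and sym: "\<And>x y. b x y = b y x"
    and pd: "\<And>x. x \<in> Rd d \<Longrightarrow> x \<noteq> 0 \<Longrightarrow> b x x > 0"
  shows "\<exists>A. (\<forall>i<d. A i \<in> Rd (Suc i) \<and> A i i > 0) \<and>
    (\<forall>i<d. \<forall>j<d. b (A i) (A j) = (if i = j then 1 else 0))"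
proof -
  note l = linear_add[OF lin] linear_diff[OF lin] linear_cmul[OF lin] linear_sum[OF lin]
  have "m \<le> d \<Longrightarrow> \<exists>A. (\<forall>i<m. A i \<in> Rd (Suc i) \<and> A i i > 0) \<and>
    (\<forall>i<m. \<forall>j<m. b (A i) (A j) = (if i = j then 1 else 0))" for m
  proof (induction m)
    case (Suc m)
    then obtain A where A: "\<And>i. i < m \<Longrightarrow> A i \<in> Rd (Suc i)" "\<And>i. i < m \<Longrightarrow> A i i > 0"
      and orth: "\<And>i j. i < m \<Longrightarrow> j < m \<Longrightarrow> b (A i) (A j) = (if i = j then 1 else 0)" by auto
    have Rd_mono: "x \<in> Rd i \<Longrightarrow> i \<le> j \<Longrightarrow> x \<in> Rd j" for x i j by (auto simp: Rd_def)
    define r where "r = axis_Rd m - (\<Sum>l<m. b (axis_Rd m) (A l) *\<^sub>R A l)"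
    have rin: "r \<in> Rd (Suc m)"
      unfolding r_def by (intro Rd_diff Rd_sum Rd_scaleR axis_in) (auto intro: Rd_mono[OF A(1)])
    have "A l m = 0" if "l < m" for l using A(1)[OF that] that by (auto simp: Rd_def)
    then have rm: "r m = 1" by (simp add: r_def sum_fun_apply axis_Rd_def)
    then have "r \<noteq> 0" by auto
    then have pos: "b r r > 0" using pd[of r] Rd_mono[OF rin] Suc by auto
    have o: "b r (A j) = 0" if "j < m" for j
      using that by (simp add: r_def l orth if_distrib[of "\<lambda>x. _ * x"] cong: if_cong)
    define a where "a = (1 / sqrt (b r r)) *\<^sub>R r"
    have "b a a = 1"
    proof -
      have "b a a = (1 / sqrt (b r r)) * ((1 / sqrt (b r r)) * b r r)"
        unfolding a_def by (simp add: l(3)) (subst sym, simp add: l(3))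
      then show ?thesis using pos by (simp add: real_div_sqrt)
    qed
    moreover have ba: "b a (A j) = 0" if "j < m" for j
      using o[OF that] by (simp add: a_def l(3))
    moreover have "b (A j) a = 0" if "j < m" for j
      using ba[OF that] by (subst sym)
    moreover have "a \<in> Rd (Suc m)" "a m > 0" using rin rm pos by (auto simp: a_def)
    ultimately show ?case using A orth
      by (intro exI[of _ "A(m := a)"]) (auto simp: less_Suc_eq)
  qed simp
  from this[of d] show ?thesis by simp
qed

section \<open>Moments of the standard simplex\<close>

lemma nn_integral_vol_prod:
  fixes f :: "nat \<Rightarrow> real \<Rightarrow> ennreal"
  assumes [measurable]: "\<And>i. f i \<in> borel_measurable borel"
  shows "(\<integral>\<^sup>+x. (\<Prod>i<d. f i (x i)) \<partial>vol_Rd d) = (\<Prod>i<d. \<integral>\<^sup>+t. f i t \<partial>lborel)"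
proof -
  have "(\<integral>\<^sup>+x. (\<Prod>i<d. f i (x i)) \<partial>vol_Rd d) = (\<integral>\<^sup>+x. (\<Prod>i<d. f i (embed_Rd d x i)) \<partial>(\<Pi>\<^sub>M i\<in>{..<d}. lborel))"
    by (rule nn_integral_vol_Rd) measurable
  also have "\<dots> = (\<integral>\<^sup>+x. (\<Prod>i<d. f i (x i)) \<partial>(\<Pi>\<^sub>M i\<in>{..<d}. lborel))"
    by (simp add: embed_Rd_def)
  also have "\<dots> = (\<Prod>i<d. \<integral>\<^sup>+t. f i t \<partial>lborel)"
    by (rule lborel_product.product_nn_integral_prod) auto
  finally show ?thesis .
qed

definition std_simplex :: "nat \<Rightarrow> (nat \<Rightarrow> real) set"
  where "std_simplex d = {x \<in> Rd d. (\<forall>i<d. 0 \<le> x i) \<and> (\<Sum>i<d. x i) \<le> 1}"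

lemma std_simplex_borel [measurable]: "std_simplex d \<in> sets borel"
proof -
  have "std_simplex d = Rd d \<inter> {x. (\<forall>i<d. 0 \<le> x i) \<and> (\<Sum>i<d. x i) \<le> 1}"
    by (auto simp: std_simplex_def)
  also have "\<dots> \<in> sets borel" by measurable
  finally show ?thesis .
qed

lemma nn_integral_exp_Ici:
  fixes s :: real
  shows "(\<integral>\<^sup>+t. ennreal (exp (- t)) * indicator {s..} t \<partial>lborel) = ennreal (exp (- s))"
proof -
  have lim: "((\<lambda>t::real. - exp (- t)) \<longlongrightarrow> - 0) at_top"
    by (intro tendsto_minus filterlim_compose[OF exp_at_bot filterlim_uminus_at_bot_at_top])
  have "(\<integral>\<^sup>+t. ennreal (exp (- t)) * indicator {s..} t \<partial>lborel) = ennreal (- 0 - (- exp (- s)))"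
    by (rule nn_integral_FTC_atLeast[OF _ _ _ lim]) (auto intro!: derivative_eq_intros)
  then show ?thesis by simp
qed

text \<open>Integrating the monomial against \<open>exp (- \<Sum> x i)\<close> factors over the coordinates; slicing
  that weight into the dilated simplices \<open>\<Sum> x i \<le> t\<close> gives \<open>fact (d + \<Sum> m i)\<close> times the moment.\<close>

lemma std_simplex_moment:
  "(\<integral>\<^sup>+x. ennreal (\<Prod>i<d. x i ^ m i) * indicator (std_simplex d) x \<partial>vol_Rd d)
    = ennreal ((\<Prod>i<d. fact (m i)) / fact (d + (\<Sum>i<d. m i)))"
proof -
  let ?\<mu> = "vol_Rd d"
  interpret sigma_finite_measure ?\<mu> by (rule sigma_finite_vol_Rd)
  interpret pair_sigma_finite ?\<mu> "lborel :: real measure" ..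
  \<comment> \<open>The monomial is cut off outside the orthant factor by factor, so that its
    integral against the exponential weight splits into one-dimensional Gamma integrals.\<close>
  define h :: "(nat \<Rightarrow> real) \<Rightarrow> ennreal" where
    "h = (\<lambda>x. (\<Prod>i<d. ennreal (x i ^ m i) * indicator {0..} (x i)))"
  define S :: "(nat \<Rightarrow> real) \<Rightarrow> real" where "S = (\<lambda>x. \<Sum>i<d. x i)"
  define k where "k = d + (\<Sum>i<d. m i)"
  have [measurable]: "h \<in> borel_measurable borel" "S \<in> borel_measurable borel"
    by (simp_all add: h_def S_def)
  have h0: "h x = 0" if "i < d" "x i < 0" for x i
    unfolding h_def using that by (intro prod_zero bexI[of _ i]) auto
  have hpos: "h x = ennreal (\<Prod>i<d. x i ^ m i)" if "\<And>i. i < d \<Longrightarrow> 0 \<le> x i" for x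
    unfolding h_def using that by (subst prod_ennreal[symmetric]) auto
  define I where "I = (\<integral>\<^sup>+x. h x * indicator {..1} (S x) \<partial>?\<mu>)"
  have I: "(\<integral>\<^sup>+x. ennreal (\<Prod>i<d. x i ^ m i) * indicator (std_simplex d) x \<partial>?\<mu>) = I"
    unfolding I_def
  proof (rule nn_integral_cong_AE)
    show "AE x in ?\<mu>. ennreal (\<Prod>i<d. x i ^ m i) * indicator (std_simplex d) x = h x * indicator {..1} (S x)"
      using AE_vol_Rd
    proof eventually_elim
      case (elim x)
      show ?case
      proof (cases "\<forall>i<d. 0 \<le> x i")
        case True
        with elim show ?thesis by (auto simp: hpos indicator_def std_simplex_def S_def)
      next
        case False
        then show ?thesis using h0[of _ x] by (auto simp: indicator_def std_simplex_def not_le)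
      qed
    qed
  qed
  \<comment> \<open>Homogeneity: a dilation by \<open>t\<close> contributes the degree of the
    monomial and another \<open>d\<close> from the volume, together the exponent
    \<open>k\<close>.\<close>
  have scaled: "(\<integral>\<^sup>+x. h x * indicator {..t} (S x) \<partial>?\<mu>) = ennreal (t ^ k) * I" if t: "t > 0" for t :: real
  proof -
    have "h (t *\<^sub>R x) * indicator {..t} (S (t *\<^sub>R x)) = ennreal (t ^ (\<Sum>i<d. m i)) * (h x * indicator {..1} (S x))" for x
    proof -
      have "h (t *\<^sub>R x) = (\<Prod>i<d. ennreal (t ^ m i) * (ennreal (x i ^ m i) * indicator {0..} (x i)))"
        unfolding h_def using t
        by (intro prod.cong) (auto simp: indicator_def zero_le_mult_iff power_mult_distrib ennreal_mult)
      also have "\<dots> = ennreal (t ^ (\<Sum>i<d. m i)) * h x"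
        using t by (simp add: prod.distrib h_def power_sum prod_ennreal)
      moreover have "S (t *\<^sub>R x) = t * S x" by (simp add: S_def sum_distrib_left)
      ultimately show ?thesis using t by (auto simp: indicator_def mult_ac)
    qed
    then have "ennreal (t ^ (\<Sum>i<d. m i)) * I = (\<integral>\<^sup>+x. h (t *\<^sub>R x) * indicator {..t} (S (t *\<^sub>R x)) \<partial>?\<mu>)"
      by (simp add: I_def nn_integral_cmult)
    also have "\<dots> = ennreal (1 / t ^ d) * (\<integral>\<^sup>+x. h x * indicator {..t} (S x) \<partial>?\<mu>)"
      by (rule scales_nn[OF scales_dilation[OF t]]) measurable
    finally have "ennreal (t ^ d) * (ennreal (t ^ (\<Sum>i<d. m i)) * I) =
        ennreal (t ^ d) * (ennreal (1 / t ^ d) * (\<integral>\<^sup>+x. h x * indicator {..t} (S x) \<partial>?\<mu>))" by simp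
    then show ?thesis
      using t by (simp add: mult.assoc[symmetric] ennreal_mult[symmetric] k_def power_add)
  qed
  have neg: "(\<integral>\<^sup>+x. h x * indicator {..t} (S x) \<partial>?\<mu>) = 0" if "t < 0" for t :: real
  proof -
    have "h x * indicator {..t} (S x) = 0" for x
    proof (cases "\<forall>i<d. 0 \<le> x i")
      case True
      then have "0 \<le> S x" by (auto simp: S_def intro!: sum_nonneg)
      then show ?thesis using that by (auto simp: indicator_def)
    next
      case False
      then show ?thesis using h0[of _ x] by (auto simp: not_le)
    qed
    then have "(\<integral>\<^sup>+x. h x * indicator {..t} (S x) \<partial>?\<mu>) = (\<integral>\<^sup>+x. 0 \<partial>?\<mu>)"
      by (intro nn_integral_cong)
    then show ?thesis by simp
  qed
  have "(\<integral>\<^sup>+x. h x * ennreal (exp (- S x)) \<partial>?\<mu>)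
      = (\<integral>\<^sup>+x. (\<Prod>i<d. ennreal (x i ^ m i * exp (- x i)) * indicator {0..} (x i)) \<partial>?\<mu>)"
  proof (rule nn_integral_cong)
    fix x
    have "ennreal (exp (- S x)) = (\<Prod>i<d. ennreal (exp (- x i)))"
      by (subst prod_ennreal) (auto simp: S_def sum_negf[symmetric] exp_sum simp del: sum_negf)
    then have "h x * ennreal (exp (- S x)) = (\<Prod>i<d. ennreal (x i ^ m i) * indicator {0..} (x i) * ennreal (exp (- x i)))"
      by (simp add: h_def prod.distrib)
    also have "\<dots> = (\<Prod>i<d. ennreal (x i ^ m i * exp (- x i)) * indicator {0..} (x i))"
      by (intro prod.cong) (auto simp: indicator_def ennreal_mult)
    finally show "h x * ennreal (exp (- S x)) = (\<Prod>i<d. ennreal (x i ^ m i * exp (- x i)) * indicator {0..} (x i))" .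
  qed
  also have "\<dots> = (\<Prod>i<d. \<integral>\<^sup>+t. ennreal (t ^ m i * exp (- t)) * indicator {0..} t \<partial>lborel)"
    by (rule nn_integral_vol_prod) measurable
  also have "\<dots> = ennreal (\<Prod>i<d. fact (m i))"
    by (simp add: nn_intergal_power_times_exp_Ici prod_ennreal)
  finally have E1: "(\<integral>\<^sup>+x. h x * ennreal (exp (- S x)) \<partial>?\<mu>) = ennreal (\<Prod>i<d. fact (m i))" .
  have "(\<integral>\<^sup>+x. h x * ennreal (exp (- S x)) \<partial>?\<mu>) =
      (\<integral>\<^sup>+x. (\<integral>\<^sup>+t. h x * (ennreal (exp (- t)) * indicator {S x..} t) \<partial>lborel) \<partial>?\<mu>)"
    by (simp add: nn_integral_cmult nn_integral_exp_Ici)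
  also have "\<dots> = (\<integral>\<^sup>+x. (\<integral>\<^sup>+t. h x * (ennreal (exp (- t)) * indicator {..t} (S x)) \<partial>lborel) \<partial>?\<mu>)"
    by (intro nn_integral_cong) (auto simp: indicator_def)
  also have "\<dots> = (\<integral>\<^sup>+t. (\<integral>\<^sup>+x. h x * (ennreal (exp (- t)) * indicator {..t} (S x)) \<partial>?\<mu>) \<partial>lborel)"
  proof (rule Fubini'[symmetric])
    have [measurable]: "Measurable.pred (?\<mu> \<Otimes>\<^sub>M lborel) (\<lambda>p. S (fst p) \<le> snd p)" by measurable
    have "(\<lambda>(x, t). h x * (ennreal (exp (- t)) * indicator {..t} (S x))) =
      (\<lambda>p. h (fst p) * (ennreal (exp (- snd p)) * (if S (fst p) \<le> snd p then 1 else 0)))"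
      by (auto simp: indicator_def fun_eq_iff)
    also have "\<dots> \<in> borel_measurable (?\<mu> \<Otimes>\<^sub>M lborel)" by measurable
    finally show "(\<lambda>(x, t). h x * (ennreal (exp (- t)) * indicator {..t} (S x))) \<in> borel_measurable (?\<mu> \<Otimes>\<^sub>M lborel)" .
  qed
  also have "\<dots> = (\<integral>\<^sup>+t. ennreal (exp (- t)) * (\<integral>\<^sup>+x. h x * indicator {..t} (S x) \<partial>?\<mu>) \<partial>lborel)"
  proof (rule nn_integral_cong)
    fix t :: real
    have "(\<integral>\<^sup>+x. h x * (ennreal (exp (- t)) * indicator {..t} (S x)) \<partial>?\<mu>)
      = (\<integral>\<^sup>+x. ennreal (exp (- t)) * (h x * indicator {..t} (S x)) \<partial>?\<mu>)"
      by (simp add: mult_ac)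
    then show "(\<integral>\<^sup>+x. h x * (ennreal (exp (- t)) * indicator {..t} (S x)) \<partial>?\<mu>)
      = ennreal (exp (- t)) * (\<integral>\<^sup>+x. h x * indicator {..t} (S x) \<partial>?\<mu>)"
      by (simp add: nn_integral_cmult)
  qed
  also have "\<dots> = (\<integral>\<^sup>+t. (ennreal (t ^ k * exp (- t)) * indicator {0..} t) * I \<partial>lborel)"
  proof (rule nn_integral_cong_AE)
    \<comment> \<open>Neither \<open>scaled\<close> nor \<open>neg\<close> speaks about
      \<open>t = 0\<close>, which is a null set.\<close>
    have "AE t in lborel. t \<noteq> (0::real)" by (rule AE_lborel_singleton)
    then show "AE t in lborel. ennreal (exp (- t)) * (\<integral>\<^sup>+x. h x * indicator {..t} (S x) \<partial>?\<mu>) =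
        (ennreal (t ^ k * exp (- t)) * indicator {0..} t) * I"
    proof eventually_elim
      case (elim t)
      then consider "t > 0" | "t < 0" by linarith
      then show ?case
        by cases (auto simp: scaled neg ennreal_mult mult_ac)
    qed
  qed
  also have "\<dots> = ennreal (fact k) * I"
    by (subst nn_integral_multc) (auto simp: nn_intergal_power_times_exp_Ici)
  finally have "ennreal (fact k) * I = ennreal (\<Prod>i<d. fact (m i))" using E1 by simp
  then have "ennreal (1 / fact k) * (ennreal (fact k) * I) = ennreal (1 / fact k) * ennreal (\<Prod>i<d. fact (m i))" by simp
  then have "I = ennreal ((\<Prod>i<d. fact (m i)) / fact k)"
    by (simp add: mult.assoc[symmetric] ennreal_mult[symmetric] prod_nonneg)
  then show ?thesis unfolding I k_def .
qed

lemma has_integral_std_simplex_monomial: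
  "has_bochner_integral (vol_Rd d) (\<lambda>x. (\<Prod>i<d. x i ^ m i) * indicator (std_simplex d) x)
    ((\<Prod>i<d. fact (m i)) / fact (d + (\<Sum>i<d. m i)))"
proof (rule has_bochner_integral_nn_integral)
  have "(\<integral>\<^sup>+x. ennreal ((\<Prod>i<d. x i ^ m i) * indicator (std_simplex d) x) \<partial>vol_Rd d) =
    (\<integral>\<^sup>+x. ennreal (\<Prod>i<d. x i ^ m i) * indicator (std_simplex d) x \<partial>vol_Rd d)"
    by (intro nn_integral_cong) (auto simp: indicator_def)
  then show "(\<integral>\<^sup>+x. ennreal ((\<Prod>i<d. x i ^ m i) * indicator (std_simplex d) x) \<partial>vol_Rd d) =
    ennreal ((\<Prod>i<d. fact (m i)) / fact (d + (\<Sum>i<d. m i)))"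
    using std_simplex_moment[of d m] by simp
qed (auto simp: indicator_def std_simplex_def intro!: prod_nonneg divide_nonneg_nonneg AE_I2)

lemma prod_power_delta: "(k :: nat) < d \<Longrightarrow> (\<Prod>i<d. (x i :: real) ^ (if i = k then 1 else 0)) = x k"
proof -
  assume "k < d"
  have "(\<Prod>i<d. (x i :: real) ^ (if i = k then 1 else 0)) = (\<Prod>i<d. if i = k then x i else 1)"
    by (intro prod.cong) auto
  with \<open>k < d\<close> show ?thesis by (simp add: prod.delta)
qed

lemma has_integral_std_simplex:
  shows "has_bochner_integral (vol_Rd d) (\<lambda>x. indicator (std_simplex d) x :: real) (1 / fact d)"
    and "k < d \<Longrightarrow> has_bochner_integral (vol_Rd d) (\<lambda>x. x k * indicator (std_simplex d) x) (1 / fact (d + 1))"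
    and "k < d \<Longrightarrow> l < d \<Longrightarrow> has_bochner_integral (vol_Rd d) (\<lambda>x. x k * x l * indicator (std_simplex d) x)
      ((if k = l then 2 else 1) / fact (d + 2))"
proof -
  let ?e = "\<lambda>k i. if i = k then 1 else 0 :: nat"
  show "has_bochner_integral (vol_Rd d) (\<lambda>x. indicator (std_simplex d) x :: real) (1 / fact d)"
    using has_integral_std_simplex_monomial[of d "\<lambda>_. 0"] by simp
  show "has_bochner_integral (vol_Rd d) (\<lambda>x. x k * indicator (std_simplex d) x) (1 / fact (d + 1))" if k: "k < d"
  proof -
    have "(\<Prod>i<d. fact (?e k i)) = (1::real)" by (intro prod.neutral) auto
    moreover have "(\<Sum>i<d. ?e k i) = 1" using k by simp
    ultimately show ?thesis
      using has_integral_std_simplex_monomial[of d "?e k"] by (simp only: prod_power_delta[OF k])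
  qed
  show "has_bochner_integral (vol_Rd d) (\<lambda>x. x k * x l * indicator (std_simplex d) x)
      ((if k = l then 2 else 1) / fact (d + 2))" if k: "k < d" and l: "l < d"
  proof -
    have "(\<Prod>i<d. fact (?e k i + ?e l i)) = (\<Prod>i<d. if i = k then (if k = l then 2 else 1) else (1::real))"
      by (intro prod.cong) auto
    also have "\<dots> = (if k = l then 2 else 1)" using k by (simp add: prod.delta)
    finally have "(\<Prod>i<d. fact (?e k i + ?e l i)) = (if k = l then 2 else (1::real))" .
    moreover have "(\<Sum>i<d. ?e k i + ?e l i) = 2" using k l by (simp add: sum.distrib)
    ultimately show ?thesis
      using has_integral_std_simplex_monomial[of d "\<lambda>i. ?e k i + ?e l i"]
      by (simp only: power_add prod.distrib prod_power_delta[OF k] prod_power_delta[OF l])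
  qed
qed

lemma emeasure_std_simplex: "emeasure (vol_Rd d) (std_simplex d) = ennreal (1 / fact d)"
  using std_simplex_moment[of d "\<lambda>_. 0"] by simp

text \<open>The integrand is the square of the affine function with value \<open>a0\<close> at the
  origin and \<open>a j\<close> at the axis vertex \<open>j\<close>. In these barycentric terms the
  result is symmetric in all \<open>d + 1\<close> vertex values: the square of their sum plus the
  sum of their squares.\<close>

lemma nn_integral_std_simplex_square:
  fixes a :: "nat \<Rightarrow> real"
  shows "(\<integral>\<^sup>+x. ennreal ((a0 * (1 - (\<Sum>j<d. x j)) + (\<Sum>j<d. a j * x j))\<^sup>2) * indicator (std_simplex d) x \<partial>vol_Rd d)
    = ennreal (((a0 + (\<Sum>j<d. a j))\<^sup>2 + a0\<^sup>2 + (\<Sum>j<d. (a j)\<^sup>2)) / fact (d + 2))"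
proof -
  define b where "b = (\<lambda>j. a j - a0)"
  let ?I = "\<lambda>x. indicator (std_simplex d) x :: real"
  define c where "c = a0\<^sup>2 * (1 / fact d) + (\<Sum>j<d. (2 * a0 * b j) * (1 / fact (d + 1)))
    + (\<Sum>j<d. \<Sum>l<d. (b j * b l) * ((if j = l then 2 else 1) / fact (d + 2)))"
  have "has_bochner_integral (vol_Rd d) (\<lambda>x. a0\<^sup>2 * ?I x + (\<Sum>j<d. (2 * a0 * b j) * (x j * ?I x))
      + (\<Sum>j<d. \<Sum>l<d. (b j * b l) * (x j * x l * ?I x))) c"
    unfolding c_def
    by (intro has_bochner_integral_add has_bochner_integral_sum has_bochner_integral_mult_right
        has_integral_std_simplex) auto
  also have "(\<lambda>x. a0\<^sup>2 * ?I x + (\<Sum>j<d. (2 * a0 * b j) * (x j * ?I x))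
      + (\<Sum>j<d. \<Sum>l<d. (b j * b l) * (x j * x l * ?I x))) =
    (\<lambda>x. (a0 * (1 - (\<Sum>j<d. x j)) + (\<Sum>j<d. a j * x j))\<^sup>2 * ?I x)"
  proof
    fix x :: "nat \<Rightarrow> real"
    have "a0 * (1 - (\<Sum>j<d. x j)) + (\<Sum>j<d. a j * x j) = a0 + (\<Sum>j<d. b j * x j)"
      by (simp add: b_def algebra_simps sum_subtractf sum_distrib_left)
    moreover have "(a0 + T)\<^sup>2 = a0\<^sup>2 + 2 * a0 * T + T * T" for T :: real
      by (simp add: power2_eq_square algebra_simps)
    moreover have "2 * a0 * (\<Sum>j<d. b j * x j) = (\<Sum>j<d. 2 * a0 * b j * x j)"
      by (simp add: sum_distrib_left mult.assoc)
    ultimately have "(a0 * (1 - (\<Sum>j<d. x j)) + (\<Sum>j<d. a j * x j))\<^sup>2 =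
        a0\<^sup>2 + (\<Sum>j<d. 2 * a0 * b j * x j) + (\<Sum>j<d. \<Sum>l<d. (b j * x j) * (b l * x l))"
      by (simp only: sum_product)
    then show "a0\<^sup>2 * ?I x + (\<Sum>j<d. (2 * a0 * b j) * (x j * ?I x))
      + (\<Sum>j<d. \<Sum>l<d. (b j * b l) * (x j * x l * ?I x)) =
      (a0 * (1 - (\<Sum>j<d. x j)) + (\<Sum>j<d. a j * x j))\<^sup>2 * ?I x"
      by (auto simp: indicator_def mult_ac)
  qed
  finally have hb: "has_bochner_integral (vol_Rd d)
    (\<lambda>x. (a0 * (1 - (\<Sum>j<d. x j)) + (\<Sum>j<d. a j * x j))\<^sup>2 * ?I x) c" .
  have "(\<integral>\<^sup>+x. ennreal ((a0 * (1 - (\<Sum>j<d. x j)) + (\<Sum>j<d. a j * x j))\<^sup>2) * indicator (std_simplex d) x \<partial>vol_Rd d)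
    = (\<integral>\<^sup>+x. ennreal ((a0 * (1 - (\<Sum>j<d. x j)) + (\<Sum>j<d. a j * x j))\<^sup>2 * ?I x) \<partial>vol_Rd d)"
    by (intro nn_integral_cong) (auto simp: indicator_def)
  also have "\<dots> = ennreal c"
    using hb by (subst nn_integral_eq_integral) (auto simp: has_bochner_integral_iff)
  also have "c = ((a0 + (\<Sum>j<d. a j))\<^sup>2 + a0\<^sup>2 + (\<Sum>j<d. (a j)\<^sup>2)) / fact (d + 2)"
  proof -
    define s q where "s = (\<Sum>j<d. a j)" and "q = (\<Sum>j<d. (a j)\<^sup>2)"
    have B: "(\<Sum>j<d. b j) = s - real d * a0" by (simp add: b_def s_def sum_subtractf)
    have Q: "(\<Sum>j<d. (b j)\<^sup>2) = q - 2 * a0 * s + real d * a0\<^sup>2"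
      by (simp add: b_def q_def s_def power2_diff sum_subtractf sum.distrib sum_distrib_left algebra_simps)
    have "(\<Sum>j<d. \<Sum>l<d. (b j * b l) * ((if j = l then 2 else 1) / fact (d + 2)))
      = (\<Sum>j<d. \<Sum>l<d. (b j * b l + (if j = l then b j * b l else 0)) / fact (d + 2))"
      by (intro sum.cong) auto
    also have "\<dots> = ((\<Sum>j<d. b j)\<^sup>2 + (\<Sum>j<d. (b j)\<^sup>2)) / fact (d + 2)"
      by (simp add: sum.distrib sum_divide_distrib[symmetric] sum_product power2_eq_square)
    finally have "c = a0\<^sup>2 / fact d + 2 * a0 * (\<Sum>j<d. b j) / fact (d + 1) + ((\<Sum>j<d. b j)\<^sup>2 + (\<Sum>j<d. (b j)\<^sup>2)) / fact (d + 2)"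
      by (simp add: c_def sum_distrib_left sum_divide_distrib)
    also have "\<dots> = ((real d + 2) * (real d + 1) * a0\<^sup>2 + (real d + 2) * (2 * a0 * (s - real d * a0))
        + (s - real d * a0)\<^sup>2 + (q - 2 * a0 * s + real d * a0\<^sup>2)) / fact (d + 2)"
    proof -
      have f: "fact (d + 1) = (real d + 1) * fact d" "fact (d + 2) = (real d + 2) * ((real d + 1) * fact d)"
        by (simp_all add: algebra_simps)
      have nz: "real d + 1 \<noteq> 0" "real d + 2 \<noteq> 0" "fact d \<noteq> (0::real)" by auto
      show ?thesis unfolding B Q f using nz by (simp add: add_divide_distrib)
    qed
    also have "(real d + 2) * (real d + 1) * a0\<^sup>2 + (real d + 2) * (2 * a0 * (s - real d * a0))
        + (s - real d * a0)\<^sup>2 + (q - 2 * a0 * s + real d * a0\<^sup>2) = (a0 + s)\<^sup>2 + a0\<^sup>2 + q"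
      by (simp add: power2_eq_square algebra_simps)
    finally show ?thesis by (simp add: s_def q_def)
  qed
  finally show ?thesis .
qed

section \<open>Convex hulls of indexed points and a linear program\<close>

text \<open>Working with indices makes a simplex a set of numbers and a triangulation a finite
  family of such sets; the points need not be distinct.\<close>

definition ihull :: "(nat \<Rightarrow> nat \<Rightarrow> real) \<Rightarrow> nat set \<Rightarrow> (nat \<Rightarrow> real) set"
  where "ihull v S = {\<Sum>i\<in>S. l i *\<^sub>R v i | l. (\<forall>i\<in>S. 0 \<le> l i) \<and> sum l S = 1}"

definition aff_indep :: "(nat \<Rightarrow> nat \<Rightarrow> real) \<Rightarrow> nat set \<Rightarrow> bool"
  where "aff_indep v S \<longleftrightarrow>
    (\<forall>\<delta>. sum \<delta> S = (0::real) \<longrightarrow> (\<Sum>i\<in>S. \<delta> i *\<^sub>R v i) = 0 \<longrightarrow> (\<forall>i\<in>S. \<delta> i = 0))"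

lemma ihullI: "(\<And>i. i \<in> S \<Longrightarrow> 0 \<le> l i) \<Longrightarrow> sum l S = 1 \<Longrightarrow> (\<Sum>i\<in>S. l i *\<^sub>R v i) = x \<Longrightarrow> x \<in> ihull v S"
  by (auto simp: ihull_def)

lemma ihull_eq_convex_hull:
  assumes "finite S"
  shows "convex hull (v ` S) = ihull v S"
proof
  show "convex hull (v ` S) \<subseteq> ihull v S"
  proof (rule hull_minimal)
    show "v ` S \<subseteq> ihull v S"
    proof safe
      fix i assume i: "i \<in> S"
      show "v i \<in> ihull v S"
        using assms i by (intro ihullI[of _ "\<lambda>j. if j = i then 1 else 0"])
          (auto simp: if_distrib[of "\<lambda>c. c *\<^sub>R _"] cong: if_cong)
    qed
    show "convex (ihull v S)"
    proof (rule convexI)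
      fix x y :: "nat \<Rightarrow> real" and a b :: real
      assume "x \<in> ihull v S" "y \<in> ihull v S" and ab: "0 \<le> a" "0 \<le> b" "a + b = 1"
      then obtain l m where "\<forall>i\<in>S. 0 \<le> l i" "sum l S = 1" "x = (\<Sum>i\<in>S. l i *\<^sub>R v i)"
        "\<forall>i\<in>S. 0 \<le> m i" "sum m S = 1" "y = (\<Sum>i\<in>S. m i *\<^sub>R v i)" by (auto simp: ihull_def)
      with ab show "a *\<^sub>R x + b *\<^sub>R y \<in> ihull v S"
        by (intro ihullI[of _ "\<lambda>i. a * l i + b * m i"])
          (auto simp: sum.distrib sum_distrib_left[symmetric] scaleR_sum_right scaleR_add_left)
    qed
  qed
  show "ihull v S \<subseteq> convex hull (v ` S)"
  proof
    fix x assume "x \<in> ihull v S"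
    then obtain l where l: "\<forall>i\<in>S. 0 \<le> l i" "sum l S = 1" "x = (\<Sum>i\<in>S. l i *\<^sub>R v i)"
      by (auto simp: ihull_def)
    show "x \<in> convex hull (v ` S)"
      unfolding l(3) by (rule convex_sum[OF assms convex_convex_hull]) (use l in \<open>auto intro: hull_inc\<close>)
  qed
qed

lemma ihull_in_Rd: "(\<And>i. i \<in> S \<Longrightarrow> v i \<in> Rd d) \<Longrightarrow> ihull v S \<subseteq> Rd d"
  by (auto simp: ihull_def)

lemma sum_split_bij:
  fixes f :: "nat \<Rightarrow> 'a::comm_monoid_add"
  assumes "finite S" "b \<in> S" "bij_betw e {..<m} (S - {b})"
  shows "sum f S = f b + (\<Sum>j<m. f (e j))"
  using assms by (simp add: sum.remove[of S b] sum.reindex_bij_betw[OF assms(3)])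

lemma edge_enum:
  assumes "finite S" "b \<in> S" "card S = Suc m"
  obtains e where "bij_betw e {..<m} (S - {b})"
  using ex_bij_betw_nat_finite[of "S - {b}"] assms by (auto simp: atLeast0LessThan)

lemma inner_Rd_sum: "inner_Rd d \<phi> (\<Sum>i\<in>S. l i *\<^sub>R v i) = (\<Sum>i\<in>S. l i * inner_Rd d \<phi> (v i))"
proof -
  have "inner_Rd d \<phi> (\<Sum>i\<in>S. l i *\<^sub>R v i) = (\<Sum>k<d. \<Sum>i\<in>S. l i * (\<phi> k * v i k))"
    by (simp add: inner_Rd_def sum_fun_apply sum_distrib_left mult_ac)
  also have "\<dots> = (\<Sum>i\<in>S. \<Sum>k<d. l i * (\<phi> k * v i k))" by (rule sum.swap)
  finally show ?thesis by (simp add: inner_Rd_def sum_distrib_left)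
qed

lemma AE_hyperplane:
  assumes "\<phi> \<in> Rd d" "\<phi> \<noteq> 0"
  shows "AE x in vol_Rd d. inner_Rd d \<phi> x \<noteq> \<beta>"
proof -
  obtain k where k: "k < d" "\<phi> k \<noteq> 0"
    using assms Rd_eqI[of \<phi> d 0] by auto
  have "{x. inner_Rd d \<phi> x = \<beta>} \<in> null_sets (vol_Rd d)"
    using hyperplane_null[where k = k and d = d and \<phi> = \<phi> and \<beta> = \<beta>] k hyperplane_borel by (auto simp: null_sets_def inner_Rd_def)
  then show ?thesis by (rule AE_I') auto
qed

text \<open>At most \<open>d\<close> points lie on a hyperplane. The rows of \<open>P\<close> are
  their edge vectors padded by zero rows; a zero row excludes an inverse, so \<open>P\<close> has a
  nonzero kernel vector, and this is a normal of the hyperplane.\<close>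

lemma AE_not_in_flat_ihull:
  assumes S: "finite S" "card S \<le> d" "\<And>i. i \<in> S \<Longrightarrow> v i \<in> Rd d"
  shows "AE x in vol_Rd d. x \<notin> ihull v S"
proof (cases "S = {}")
  case False
  then obtain b where b: "b \<in> S" by auto
  define m where "m = card S - 1"
  have "card S > 0" using S b by (auto simp: card_gt_0_iff)
  then have m: "card S = Suc m" "m < d" using S by (simp_all add: m_def)
  obtain e where e: "bij_betw e {..<m} (S - {b})" using edge_enum[OF S(1) b m(1)] .
  define P where "P = (\<lambda>i. if i < m then v (e i) - v b else 0)"
  have "\<not> (\<forall>x\<in>Rd d. mv d P x = 0 \<longrightarrow> x = 0)"
  proof
    assume "\<forall>x\<in>Rd d. mv d P x = 0 \<longrightarrow> x = 0"
    then obtain N where "mutual_inverse d P N" using inj_mv_imp_inverse[of d P] by blast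
    then have "mv d P (mv d N (axis_Rd m)) m = axis_Rd m m"
      using m by (simp add: mutual_inverse_def)
    then show False using m by (simp add: mv_apply P_def axis_Rd_def)
  qed
  then obtain \<phi> where \<phi>: "\<phi> \<in> Rd d" "mv d P \<phi> = 0" "\<phi> \<noteq> 0" by auto
  have "inner_Rd d \<phi> (v i) = inner_Rd d \<phi> (v b)" if "i \<in> S" for i
  proof (cases "i = b")
    case False
    then have "i \<in> e ` {..<m}" using e that by (auto simp: bij_betw_def)
    then obtain j where j: "j < m" "i = e j" by auto
    have "0 = mv d P \<phi> j" using \<phi> by simp
    also have "\<dots> = (\<Sum>k<d. (v i k - v b k) * \<phi> k)" using j m by (simp add: mv_apply P_def)
    also have "\<dots> = inner_Rd d \<phi> (v i) - inner_Rd d \<phi> (v b)"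
      by (simp add: inner_Rd_def algebra_simps sum_subtractf)
    finally show ?thesis by simp
  qed simp
  then have "inner_Rd d \<phi> x = inner_Rd d \<phi> (v b)" if "x \<in> ihull v S" for x
    using that by (auto simp: ihull_def inner_Rd_sum sum_distrib_right[symmetric])
  with AE_hyperplane[OF \<phi>(1,3), of "inner_Rd d \<phi> (v b)"] show ?thesis
    by (auto elim!: eventually_mono)
qed (simp add: ihull_def)

text \<open>The columns of \<open>M\<close> are the edge vectors from \<open>b\<close>. A kernel
  vector extends to an affine dependence by giving \<open>b\<close> minus the sum of its entries as
  weight.\<close>

lemma aff_indep_matrix:
  assumes S: "finite S" "card S = Suc d" "\<And>i. i \<in> S \<Longrightarrow> v i \<in> Rd d" "aff_indep v S"
  shows "\<exists>b e M N. b \<in> S \<and> bij_betw e {..<d} (S - {b}) \<and> mutual_inverse d M N \<and>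
    (\<forall>x. mv d M x + v b = (1 - (\<Sum>j<d. x j)) *\<^sub>R v b + (\<Sum>j<d. x j *\<^sub>R v (e j)))"
proof -
  obtain b where b: "b \<in> S" using S by fastforce
  obtain e where e: "bij_betw e {..<d} (S - {b})" using edge_enum[OF S(1) b S(2)] .
  have eS: "e j \<in> S - {b}" if "j < d" for j using e that by (auto simp: bij_betw_def)
  define M where "M = (\<lambda>i j. v (e j) i - v b i)"
  have M: "mv d M x = (\<Sum>j<d. x j *\<^sub>R (v (e j) - v b))" for x
    using eS S(3) b by (intro Rd_eqI[of _ d]) (auto simp: mv_apply M_def sum_fun_apply mult.commute intro!: Rd_sum Rd_scaleR Rd_diff)
  have param: "mv d M x + v b = (1 - (\<Sum>j<d. x j)) *\<^sub>R v b + (\<Sum>j<d. x j *\<^sub>R v (e j))" for x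
    by (simp add: M scaleR_diff_right scaleR_diff_left sum_subtractf scaleR_sum_left)
  have "x = 0" if x: "x \<in> Rd d" "mv d M x = 0" for x
  proof -
    define \<delta> where "\<delta> = (\<lambda>i. if i = b then - (\<Sum>j<d. x j) else x (inv_into {..<d} e i))"
    have \<delta>e: "\<delta> (e j) = x j" if "j < d" for j
      using eS[OF that] that e by (auto simp: \<delta>_def bij_betw_def inv_into_f_f)
    have \<delta>b: "\<delta> b = - (\<Sum>j<d. x j)" by (simp add: \<delta>_def)
    have "sum \<delta> S = 0" using \<delta>e by (simp add: sum_split_bij[OF S(1) b e] \<delta>b)
    moreover have "(\<Sum>i\<in>S. \<delta> i *\<^sub>R v i) = 0"
    proof -
      have "(\<Sum>i\<in>S. \<delta> i *\<^sub>R v i) = - (\<Sum>j<d. x j) *\<^sub>R v b + (\<Sum>j<d. x j *\<^sub>R v (e j))"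
        using \<delta>e by (simp add: sum_split_bij[OF S(1) b e] \<delta>b)
      also have "\<dots> = mv d M x" by (simp add: M scaleR_diff_right sum_subtractf scaleR_sum_left)
      finally show ?thesis using x by simp
    qed
    ultimately have "\<delta> i = 0" if "i \<in> S" for i using S(4) that by (auto simp: aff_indep_def)
    then have "x j = 0" if "j < d" for j using \<delta>e[OF that] eS[OF that] by simp
    then show ?thesis using x by (intro Rd_eqI[of _ d]) auto
  qed
  then obtain N where "mutual_inverse d M N" using inj_mv_imp_inverse by blast
  with b e param show ?thesis by blast
qed

lemma affine_coordinates:
  assumes S: "finite S" "card S = Suc d" "\<And>i. i \<in> S \<Longrightarrow> v i \<in> Rd d" "aff_indep v S" and x: "x \<in> Rd d"
  shows "\<exists>\<beta>. sum \<beta> S = 1 \<and> (\<Sum>i\<in>S. \<beta> i *\<^sub>R v i) = x"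
proof -
  obtain b e M N where b: "b \<in> S" and e: "bij_betw e {..<d} (S - {b})" and MN: "mutual_inverse d M N"
    and param: "\<forall>x. mv d M x + v b = (1 - (\<Sum>j<d. x j)) *\<^sub>R v b + (\<Sum>j<d. x j *\<^sub>R v (e j))"
    using aff_indep_matrix[OF S] by blast
  define y where "y = mv d N (x - v b)"
  have y: "mv d M y + v b = x" using MN Rd_diff[OF x S(3)[OF b]] by (simp add: mutual_inverse_def y_def)
  define \<beta> where "\<beta> = (\<lambda>i. if i = b then 1 - (\<Sum>j<d. y j) else y (inv_into {..<d} e i))"
  have \<beta>e: "\<beta> (e j) = y j" if "j < d" for j
    using that e by (auto simp: \<beta>_def bij_betw_def inv_into_f_f)
  have \<beta>b: "\<beta> b = 1 - (\<Sum>j<d. y j)" by (simp add: \<beta>_def)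
  show ?thesis
    using \<beta>e by (intro exI[of _ \<beta>]) (simp add: sum_split_bij[OF S(1) b e] \<beta>b param[rule_format, symmetric] y)
qed

lemma aff_indep_mono:
  assumes "finite S" "S' \<subseteq> S" "aff_indep v S"
  shows "aff_indep v S'"
  unfolding aff_indep_def
proof (intro allI impI)
  fix \<delta> assume \<delta>: "sum \<delta> S' = (0::real)" "(\<Sum>i\<in>S'. \<delta> i *\<^sub>R v i) = 0"
  let ?\<delta> = "\<lambda>i. if i \<in> S' then \<delta> i else 0"
  have "sum ?\<delta> S = sum \<delta> S'" using assms by (simp add: sum.If_cases Int_absorb1 if_distrib)
  moreover have "(\<Sum>i\<in>S. ?\<delta> i *\<^sub>R v i) = (\<Sum>i\<in>S'. \<delta> i *\<^sub>R v i)"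
    using assms by (intro sum.mono_neutral_cong_right) auto
  ultimately have "\<forall>i\<in>S. ?\<delta> i = 0" using assms(3) \<delta> by (simp only: aff_indep_def) blast
  then show "\<forall>i\<in>S'. \<delta> i = 0" using assms(2) by (metis subsetD)
qed

lemma aff_indep_unique:
  assumes "aff_indep v S" "sum \<alpha> S = sum \<beta> S" "(\<Sum>i\<in>S. \<alpha> i *\<^sub>R v i) = (\<Sum>i\<in>S. \<beta> i *\<^sub>R v i)" "i \<in> S"
  shows "\<alpha> i = (\<beta> i :: real)"
proof -
  have "(\<Sum>i\<in>S. (\<alpha> i - \<beta> i) *\<^sub>R v i) = 0" "(\<Sum>i\<in>S. \<alpha> i - \<beta> i) = 0"
    using assms by (auto simp: scaleR_diff_left sum_subtractf)
  then show ?thesis using assms(1,4) unfolding aff_indep_def by (auto dest: spec[of _ "\<lambda>i. \<alpha> i - \<beta> i"])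
qed

text \<open>A further point has affine coordinates over any \<open>d + 1\<close> of the others;
  together with the weight \<open>- 1\<close> at that point they form a dependence.\<close>

lemma aff_indep_card_le:
  assumes S: "finite S" "\<And>i. i \<in> S \<Longrightarrow> v i \<in> Rd d" "aff_indep v S"
  shows "card S \<le> Suc d"
proof (rule ccontr)
  assume "\<not> card S \<le> Suc d"
  then have "Suc d \<le> card S" by simp
  then obtain S' where S': "S' \<subseteq> S" "card S' = Suc d" by (rule obtain_subset_with_card_n)
  then obtain i where i: "i \<in> S" "i \<notin> S'" using \<open>\<not> card S \<le> Suc d\<close> by (metis order_refl subsetI card_mono S(1) finite_subset)
  have fin: "finite S'" using S' S finite_subset by blast
  obtain \<beta> where \<beta>: "sum \<beta> S' = 1" "(\<Sum>i\<in>S'. \<beta> i *\<^sub>R v i) = v i"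
    using affine_coordinates[OF fin S'(2) _ aff_indep_mono[OF S(1) S'(1) S(3)], of "v i"] S S' i by blast
  let ?\<delta> = "\<lambda>j. if j = i then - 1 else \<beta> j"
  have ind: "aff_indep v (insert i S')" using aff_indep_mono[OF S(1) _ S(3), of "insert i S'"] i S' by blast
  have "sum ?\<delta> (insert i S') = 0" "(\<Sum>j\<in>insert i S'. ?\<delta> j *\<^sub>R v j) = 0"
  proof -
    have "sum ?\<delta> S' = sum \<beta> S'" "(\<Sum>j\<in>S'. ?\<delta> j *\<^sub>R v j) = (\<Sum>j\<in>S'. \<beta> j *\<^sub>R v j)"
      using i by (auto intro!: sum.cong)
    then show "sum ?\<delta> (insert i S') = 0" "(\<Sum>j\<in>insert i S'. ?\<delta> j *\<^sub>R v j) = 0"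
      using fin i \<beta> by auto
  qed
  then have "?\<delta> i = 0" using ind unfolding aff_indep_def by blast
  then show False by simp
qed

text \<open>A linear program: among all representations of \<open>x\<close> as a convex combination of the points,
  minimise a linear cost.  The optimal supports form a regular triangulation.\<close>

definition rep :: "nat \<Rightarrow> (nat \<Rightarrow> nat \<Rightarrow> real) \<Rightarrow> (nat \<Rightarrow> real) \<Rightarrow> (nat \<Rightarrow> real) \<Rightarrow> bool"
  where "rep n v x l \<longleftrightarrow> l \<in> Rd n \<and> (\<forall>i<n. 0 \<le> l i) \<and> sum l {..<n} = 1 \<and> (\<Sum>i<n. l i *\<^sub>R v i) = x"

definition supp :: "nat \<Rightarrow> (nat \<Rightarrow> real) \<Rightarrow> nat set"
  where "supp n l = {i. i < n \<and> l i \<noteq> 0}"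

lemma supp_subset: "supp n l \<subseteq> {..<n}" and finite_supp [simp]: "finite (supp n l)"
  by (auto simp: supp_def)

lemma sum_supp:
  assumes "\<And>i. i < n \<Longrightarrow> l i = 0 \<Longrightarrow> f i = 0"
  shows "sum f (supp n l) = sum f {..<n}"
  using assms by (intro sum.mono_neutral_left) (auto simp: supp_def)

text \<open>Caratheodory's argument with a cost: move along an affine dependence of the support, in
  a direction that does not raise the cost, until a coefficient vanishes.\<close>

lemma rep_reduce_support:
  fixes c :: "nat \<Rightarrow> real"
  assumes "rep n v x l"
  shows "\<exists>l'. rep n v x l' \<and> inner_Rd n c l' \<le> inner_Rd n c l \<and> aff_indep v (supp n l')"
  using assms
proof (induction "card (supp n l)" arbitrary: l rule: less_induct)
  case less
  show ?case
  proof (cases "aff_indep v (supp n l)")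
    case True
    then show ?thesis using less.prems by blast
  next
    case False
    let ?S = "supp n l"
    obtain \<delta>0 where \<delta>0: "sum \<delta>0 ?S = (0::real)" "(\<Sum>i\<in>?S. \<delta>0 i *\<^sub>R v i) = 0" "\<exists>i\<in>?S. \<delta>0 i \<noteq> 0"
      using False by (auto simp: aff_indep_def)
    \<comment> \<open>Both a dependence and its negative are admissible; the sign is chosen so that
      the cost does not increase.\<close>
    define s where "s = (if (\<Sum>i\<in>?S. c i * \<delta>0 i) \<le> 0 then 1 else - 1 :: real)"
    define \<delta> where "\<delta> = (\<lambda>i. if i \<in> ?S then s * \<delta>0 i else 0)"
    have \<delta>out: "\<delta> i = 0" if "l i = 0" for i using that by (simp add: \<delta>_def supp_def)
    have \<delta>Rd: "\<delta> \<in> Rd n" by (auto simp: \<delta>_def Rd_def supp_def)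
    have lpos: "l i > 0" if "i \<in> ?S" for i
      using less.prems that by (auto simp: rep_def supp_def less_le)
    have \<delta>in: "\<delta> i = s * \<delta>0 i" if "i \<in> ?S" for i using that by (simp add: \<delta>_def)
    have to_supp: "(\<Sum>i<n. g (\<delta> i) i) = (\<Sum>i\<in>?S. g (s * \<delta>0 i) i)"
      if "\<And>i. g 0 i = 0" for g :: "real \<Rightarrow> nat \<Rightarrow> 'c::comm_monoid_add"
    proof -
      have "(\<Sum>i<n. g (\<delta> i) i) = (\<Sum>i\<in>?S. g (\<delta> i) i)"
        using that by (intro sum_supp[symmetric]) (simp add: \<delta>out)
      then show ?thesis using \<delta>in by simp
    qed
    have sum0: "sum \<delta> {..<n} = 0"
      using to_supp[of "\<lambda>a _. a"] \<delta>0(1) by (simp add: sum_distrib_left[symmetric])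
    have "(\<Sum>i<n. \<delta> i *\<^sub>R v i) = s *\<^sub>R (\<Sum>i\<in>?S. \<delta>0 i *\<^sub>R v i)"
      using to_supp[of "\<lambda>a i. a *\<^sub>R v i"] by (simp add: scaleR_sum_right)
    then have vec0: "(\<Sum>i<n. \<delta> i *\<^sub>R v i) = 0" using \<delta>0(2) by simp
    have cost: "inner_Rd n c \<delta> \<le> 0"
    proof -
      have "inner_Rd n c \<delta> = s * (\<Sum>i\<in>?S. c i * \<delta>0 i)"
        using to_supp[of "\<lambda>a i. c i * a"] by (simp add: inner_Rd_def sum_distrib_left mult_ac)
      then show ?thesis by (simp add: s_def)
    qed
    define J where "J = {i\<in>?S. \<delta> i < 0}"
    have "J \<noteq> {}"
    proof
      assume "J = {}"
      then have "\<forall>i\<in>?S. 0 \<le> \<delta> i" by (auto simp: J_def not_less)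
      moreover have "sum \<delta> ?S = 0" using sum0 by (subst sum_supp) (auto simp: \<delta>out)
      ultimately have "\<forall>i\<in>?S. \<delta> i = 0" by (simp add: sum_nonneg_eq_0_iff)
      then show False using \<delta>0(3) by (auto simp: \<delta>in s_def split: if_splits)
    qed
    have "finite J" by (simp add: J_def)
    \<comment> \<open>Ratio test: the largest step that keeps every coefficient nonnegative. It is
      attained at an index \<open>j\<close> of \<open>J\<close>, which then leaves the
      support.\<close>
    define t where "t = Min ((\<lambda>i. l i / - \<delta> i) ` J)"
    have "t \<in> (\<lambda>i. l i / - \<delta> i) ` J"
      unfolding t_def using \<open>J \<noteq> {}\<close> \<open>finite J\<close> by (intro Min_in) auto
    then obtain j where j: "j \<in> J" "t = l j / - \<delta> j" by blast
    have tle: "t \<le> l i / - \<delta> i" if "i \<in> J" for i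
      unfolding t_def using \<open>finite J\<close> that by (intro Min_le) auto
    have t0: "t > 0" using j lpos by (auto simp: J_def divide_pos_neg)
    define l' where "l' = l + t *\<^sub>R \<delta>"
    have "rep n v x l'"
      unfolding rep_def
    proof (intro conjI allI impI)
      show "l' \<in> Rd n" using less.prems \<delta>Rd by (auto simp: rep_def l'_def)
      show "sum l' {..<n} = 1" using less.prems sum0 by (simp add: rep_def l'_def sum.distrib sum_distrib_left[symmetric])
      have "(\<Sum>i<n. l' i *\<^sub>R v i) = (\<Sum>i<n. l i *\<^sub>R v i) + t *\<^sub>R (\<Sum>i<n. \<delta> i *\<^sub>R v i)"
        by (simp add: l'_def scaleR_add_left sum.distrib scaleR_sum_right)
      then show "(\<Sum>i<n. l' i *\<^sub>R v i) = x" using less.prems vec0 by (simp add: rep_def)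
      fix i assume i: "i < n"
      show "0 \<le> l' i"
      proof (cases "i \<in> J")
        case True
        then show ?thesis using tle[OF True] by (simp add: l'_def J_def field_simps)
      next
        case False
        then have "\<delta> i \<ge> 0" by (auto simp: J_def \<delta>_def)
        then show ?thesis using less.prems t0 i by (simp add: l'_def rep_def)
      qed
    qed
    moreover have "supp n l' \<subset> supp n l"
    proof -
      have "l' j = 0" using j by (simp add: l'_def J_def)
      moreover have "l' i = 0" if "l i = 0" for i using that \<delta>out by (simp add: l'_def)
      moreover have "j \<in> ?S" using j by (simp add: J_def)
      ultimately show ?thesis by (auto simp: supp_def)
    qed
    then have "card (supp n l') < card (supp n l)" by (intro psubset_card_mono) auto
    moreover have "inner_Rd n c l' \<le> inner_Rd n c l"
    proof -
      have "inner_Rd n c l' = inner_Rd n c l + t * inner_Rd n c \<delta>"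
        by (simp add: inner_Rd_def l'_def algebra_simps sum.distrib sum_distrib_left)
      then show ?thesis using cost t0 by (simp add: mult_nonneg_nonpos)
    qed
    ultimately show ?thesis using less.hyps[of l'] by (meson order_trans)
  qed
qed

text \<open>The minimum exists by finiteness: a representation with affinely independent support is
  determined by that support, so there are finitely many, and each representation costs at least as
  much as one of them.\<close>

lemma rep_optimal:
  fixes c :: "nat \<Rightarrow> real"
  assumes "rep n v x l0"
  shows "\<exists>l. rep n v x l \<and> aff_indep v (supp n l) \<and> (\<forall>m. rep n v x m \<longrightarrow> inner_Rd n c l \<le> inner_Rd n c m)"
proof -
  define F where "F = {l. rep n v x l \<and> aff_indep v (supp n l)}"
  have "inj_on (supp n) F"
  proof (rule inj_onI)
    fix l m assume lm: "l \<in> F" "m \<in> F" "supp n l = supp n m"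
    have eqs: "sum f (supp n l) = 1 \<and> (\<Sum>i\<in>supp n l. f i *\<^sub>R v i) = x" if "f \<in> F" "supp n f = supp n l" for f
      using that sum_supp[of n f f] sum_supp[of n f "\<lambda>i. f i *\<^sub>R v i"] by (auto simp: F_def rep_def)
    show "l = m"
    proof (rule Rd_eqI[of _ n])
      fix i assume i: "i < n"
      show "l i = m i"
      proof (cases "i \<in> supp n l")
        case True
        have "aff_indep v (supp n l)" using lm(1) by (simp add: F_def)
        then show ?thesis
          by (rule aff_indep_unique[OF _ _ _ True])
            (simp_all add: eqs[OF lm(1) refl] eqs[OF lm(2) lm(3)[symmetric]])
      next
        case False
        then show ?thesis using i lm(3) by (auto simp: supp_def)
      qed
    qed (use lm in \<open>auto simp: F_def rep_def\<close>)
  qed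
  moreover have "supp n ` F \<subseteq> Pow {..<n}" using supp_subset by blast
  ultimately have fin: "finite F" by (metis finite_Pow_iff finite_imageD finite_lessThan finite_subset)
  moreover have "F \<noteq> {}" using rep_reduce_support[OF assms] by (auto simp: F_def)
  ultimately obtain l where l: "l \<in> F" "\<And>m. m \<in> F \<Longrightarrow> inner_Rd n c l \<le> inner_Rd n c m"
    using ex_is_arg_min_if_finite[of F "inner_Rd n c"] by (auto simp: is_arg_min_linorder)
  have "inner_Rd n c l \<le> inner_Rd n c m" if "rep n v x m" for m
    using rep_reduce_support[OF that, of c] l(2) by (force simp: F_def)
  with l show ?thesis by (auto simp: F_def)
qed

text \<open>Nonnegative reduced cost: shifting a small weight \<open>t\<close> to point
  \<open>i\<close> and subtracting \<open>t * \<beta> j\<close> on the support again represents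
  \<open>x\<close>, so optimality forbids a gain.\<close>

lemma rep_dual:
  fixes c :: "nat \<Rightarrow> real"
  assumes l: "rep n v x l" and opt: "\<And>m. rep n v x m \<Longrightarrow> inner_Rd n c l \<le> inner_Rd n c m"
    and i: "i < n" "i \<notin> supp n l"
    and \<beta>: "sum \<beta> (supp n l) = 1" "(\<Sum>j\<in>supp n l. \<beta> j *\<^sub>R v j) = v i"
  shows "(\<Sum>j\<in>supp n l. \<beta> j * c j) \<le> c i"
proof -
  let ?S = "supp n l"
  have lpos: "l j > 0" if "j \<in> ?S" for j using l that by (auto simp: rep_def supp_def less_le)
  have "?S \<noteq> {}" using \<beta> by auto
  \<comment> \<open>Small enough that \<open>l j - t * \<beta> j\<close> stays nonnegative on the
    support; adding 1 to the absolute value keeps the denominators positive.\<close>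
  define t where "t = Min ((\<lambda>j. l j / (1 + \<bar>\<beta> j\<bar>)) ` ?S)"
  have tle: "t \<le> l j / (1 + \<bar>\<beta> j\<bar>)" if "j \<in> ?S" for j unfolding t_def using that by (intro Min_le) auto
  have t0: "t > 0" unfolding t_def using lpos \<open>?S \<noteq> {}\<close> by (subst Min_gr_iff) (auto intro!: divide_pos_pos)
  define \<delta> where "\<delta> = (\<lambda>j. if j = i then 1 else if j \<in> ?S then - \<beta> j else 0)"
  have sum\<delta>: "(\<Sum>j<n. g (\<delta> j) j) = g 1 i + (\<Sum>j\<in>?S. g (- \<beta> j) j)"
    if "\<And>j. g 0 j = 0" for g :: "real \<Rightarrow> nat \<Rightarrow> 'a::comm_monoid_add"
  proof -
    have "(\<Sum>j<n. g (\<delta> j) j) = (\<Sum>j\<in>insert i ?S. g (\<delta> j) j)"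
      using i supp_subset[of n l] that by (intro sum.mono_neutral_right) (auto simp: \<delta>_def)
    also have "\<dots> = g (\<delta> i) i + (\<Sum>j\<in>?S. g (\<delta> j) j)" using i by (simp add: sum.insert)
    also have "(\<Sum>j\<in>?S. g (\<delta> j) j) = (\<Sum>j\<in>?S. g (- \<beta> j) j)"
      using i by (intro sum.cong) (auto simp: \<delta>_def)
    finally show ?thesis by (simp add: \<delta>_def)
  qed
  have "rep n v x (l + t *\<^sub>R \<delta>)"
    unfolding rep_def
  proof (intro conjI allI impI)
    show "l + t *\<^sub>R \<delta> \<in> Rd n" using l i by (auto simp: rep_def Rd_def \<delta>_def supp_def)
    have "sum \<delta> {..<n} = 0" using sum\<delta>[of "\<lambda>a _. a"] \<beta> by (simp add: sum_negf)
    then show "sum (l + t *\<^sub>R \<delta>) {..<n} = 1" using l by (simp add: rep_def sum.distrib sum_distrib_left[symmetric])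
    have "(\<Sum>j<n. \<delta> j *\<^sub>R v j) = 0" using sum\<delta>[of "\<lambda>a j. a *\<^sub>R v j"] \<beta> by (simp add: sum_negf)
    moreover have "(\<Sum>j<n. (l + t *\<^sub>R \<delta>) j *\<^sub>R v j) = (\<Sum>j<n. l j *\<^sub>R v j) + t *\<^sub>R (\<Sum>j<n. \<delta> j *\<^sub>R v j)"
      by (simp add: scaleR_add_left sum.distrib scaleR_sum_right)
    ultimately show "(\<Sum>j<n. (l + t *\<^sub>R \<delta>) j *\<^sub>R v j) = x" using l by (simp add: rep_def)
    fix j assume j: "j < n"
    show "0 \<le> (l + t *\<^sub>R \<delta>) j"
    proof (cases "j \<in> ?S")
      case True
      have "t * \<beta> j \<le> t * (1 + \<bar>\<beta> j\<bar>)" using t0 by (intro mult_left_mono) auto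
      also have "\<dots> \<le> l j" using tle[OF True] by (simp add: pos_le_divide_eq)
      finally show ?thesis using True i by (auto simp: \<delta>_def)
    next
      case False
      then show ?thesis using l t0 j by (auto simp: \<delta>_def rep_def)
    qed
  qed
  then have "inner_Rd n c l \<le> inner_Rd n c (l + t *\<^sub>R \<delta>)" by (rule opt)
  also have "\<dots> = inner_Rd n c l + t * (\<Sum>j<n. c j * \<delta> j)"
    by (simp add: inner_Rd_def algebra_simps sum.distrib sum_distrib_left)
  finally have "0 \<le> (\<Sum>j<n. c j * \<delta> j)" using t0 by (simp add: zero_le_mult_iff)
  then show ?thesis using sum\<delta>[of "\<lambda>a j. c j * a"] by (simp add: sum_negf mult.commute)
qed

text \<open>Costs \<open>t ^ i\<close> work for all but finitely many \<open>t\<close>: each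
  forbidden equality is a polynomial equation in \<open>t\<close>, nonzero because
  \<open>i \<notin> S\<close> leaves the coefficient \<open>- 1\<close> at degree
  \<open>i\<close>.\<close>

lemma generic_cost:
  fixes v :: "nat \<Rightarrow> nat \<Rightarrow> real"
  shows "\<exists>c :: nat \<Rightarrow> real. \<forall>S i \<beta>. S \<subseteq> {..<n} \<longrightarrow> aff_indep v S \<longrightarrow> i < n \<longrightarrow> i \<notin> S \<longrightarrow>
    sum \<beta> S = 1 \<longrightarrow> (\<Sum>j\<in>S. \<beta> j *\<^sub>R v j) = v i \<longrightarrow> (\<Sum>j\<in>S. \<beta> j * c j) \<noteq> c i"
proof -
  \<comment> \<open>Affine independence makes the coefficients unique, so one polynomial per pair
    \<open>S\<close>, \<open>i\<close> accounts for every \<open>\<beta>\<close>. This keeps the set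
    of excluded roots finite.\<close>
  define B where "B = (\<lambda>S i. SOME \<beta>. sum \<beta> S = (1::real) \<and> (\<Sum>j\<in>S. \<beta> j *\<^sub>R v j) = v i)"
  define p where "p = (\<lambda>S i. (\<Sum>j\<in>S. monom (B S i j) j) - monom (1::real) i)"
  have nz: "p S i \<noteq> 0" if "S \<subseteq> {..<n}" "i \<notin> S" for S i
  proof -
    have "finite S" using that finite_subset by blast
    have "coeff (p S i) i = - 1" using that \<open>finite S\<close> by (simp add: p_def coeff_sum)
    then show ?thesis by auto
  qed
  define R where "R = (\<Union>S\<in>Pow {..<n}. \<Union>i\<in>{..<n} - S. {t. poly (p S i) t = 0})"
  have "finite R" unfolding R_def
    by (intro finite_UN_I) (use nz in \<open>auto intro!: poly_roots_finite\<close>)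
  then obtain t where t: "t \<notin> R" using ex_new_if_finite[OF infinite_UNIV_char_0, of R] by blast
  show ?thesis
  proof (intro exI[of _ "\<lambda>j. t ^ j"] allI impI notI)
    fix S i and \<beta> :: "nat \<Rightarrow> real"
    assume S: "S \<subseteq> {..<n}" "aff_indep v S" "i < n" "i \<notin> S" and \<beta>: "sum \<beta> S = 1" "(\<Sum>j\<in>S. \<beta> j *\<^sub>R v j) = v i"
      and eq: "(\<Sum>j\<in>S. \<beta> j * t ^ j) = t ^ i"
    have B: "sum (B S i) S = 1 \<and> (\<Sum>j\<in>S. B S i j *\<^sub>R v j) = v i"
      unfolding B_def by (rule someI[of _ \<beta>]) (use \<beta> in blast)
    have "B S i j = \<beta> j" if "j \<in> S" for j
      by (rule aff_indep_unique[OF S(2) _ _ that]) (simp_all add: \<beta> B)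
    then have "poly (p S i) t = (\<Sum>j\<in>S. \<beta> j * t ^ j) - t ^ i"
      by (simp add: p_def poly_sum poly_monom)
    then have "t \<in> R" using eq S by (auto simp: R_def)
    with t show False by blast
  qed
qed

text \<open>Interpolation of \<open>c\<close> in affine coordinates over \<open>S\<close>. Through
  it \<open>y\<close> acts as the dual solution of the linear program.\<close>

lemma affine_interpolation:
  assumes S: "finite S" "card S = Suc d" "\<And>i. i \<in> S \<Longrightarrow> v i \<in> Rd d" "aff_indep v S"
  shows "\<exists>y :: (nat \<Rightarrow> real) \<Rightarrow> real. (\<forall>i\<in>S. y (v i) = c i) \<and>
    (\<forall>(I :: nat set) l w. finite I \<longrightarrow> sum l I = 1 \<longrightarrow> (\<forall>i\<in>I. w i \<in> Rd d) \<longrightarrow> y (\<Sum>i\<in>I. l i *\<^sub>R w i) = (\<Sum>i\<in>I. l i * y (w i)))"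
proof -
  define B where "B = (\<lambda>x. SOME \<beta>. sum \<beta> S = 1 \<and> (\<Sum>i\<in>S. \<beta> i *\<^sub>R v i) = x)"
  have B: "sum (B x) S = 1" "(\<Sum>i\<in>S. B x i *\<^sub>R v i) = x" if "x \<in> Rd d" for x
    using someI_ex[OF affine_coordinates[OF S that]] unfolding B_def by auto
  have uniq: "B x i = \<beta> i" if "x \<in> Rd d" "sum \<beta> S = 1" "(\<Sum>i\<in>S. \<beta> i *\<^sub>R v i) = x" "i \<in> S" for x \<beta> i
    by (rule aff_indep_unique[OF S(4) _ _ that(4)]) (simp_all add: B[OF that(1)] that(2,3))
  define y where "y = (\<lambda>x. \<Sum>j\<in>S. B x j * c j)"
  show ?thesis
  proof (intro exI[of _ y] conjI ballI allI impI)
    fix i assume i: "i \<in> S"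
    have "B (v i) j = (if j = i then 1 else 0)" if "j \<in> S" for j
      using S i that by (intro uniq) (auto simp: if_distrib[of "\<lambda>c. c *\<^sub>R _"] cong: if_cong)
    then have "y (v i) = (\<Sum>j\<in>S. if j = i then c j else 0)"
      unfolding y_def by (intro sum.cong) auto
    then show "y (v i) = c i" using S(1) i by simp
  next
    fix I :: "nat set" and l :: "nat \<Rightarrow> real" and w assume I: "finite I" "sum l I = 1" "\<forall>i\<in>I. w i \<in> Rd d"
    have "B (\<Sum>i\<in>I. l i *\<^sub>R w i) j = (\<Sum>i\<in>I. l i * B (w i) j)" if "j \<in> S" for j
    proof (rule uniq)
      have "(\<Sum>j\<in>S. \<Sum>i\<in>I. l i * B (w i) j) = (\<Sum>i\<in>I. l i * sum (B (w i)) S)"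
        by (subst sum.swap) (simp add: sum_distrib_left)
      then show "(\<Sum>j\<in>S. \<Sum>i\<in>I. l i * B (w i) j) = 1" using I B by simp
      have "(\<Sum>j\<in>S. (\<Sum>i\<in>I. l i * B (w i) j) *\<^sub>R v j) = (\<Sum>i\<in>I. l i *\<^sub>R (\<Sum>j\<in>S. B (w i) j *\<^sub>R v j))"
        unfolding scaleR_sum_left scaleR_sum_right by (subst sum.swap) simp
      then show "(\<Sum>j\<in>S. (\<Sum>i\<in>I. l i * B (w i) j) *\<^sub>R v j) = (\<Sum>i\<in>I. l i *\<^sub>R w i)" using I B by simp
    qed (use I that in auto)
    then have "y (\<Sum>i\<in>I. l i *\<^sub>R w i) = (\<Sum>j\<in>S. \<Sum>i\<in>I. l i * (B (w i) j * c j))"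
      by (simp add: y_def sum_distrib_right mult.assoc)
    also have "\<dots> = (\<Sum>i\<in>I. l i * y (w i))"
      by (subst sum.swap) (simp add: y_def sum_distrib_left)
    finally show "y (\<Sum>i\<in>I. l i *\<^sub>R w i) = (\<Sum>i\<in>I. l i * y (w i))" .
  qed
qed

section \<open>Regular triangulation of a polytope\<close>

lemma ihull_mono: "finite S' \<Longrightarrow> S \<subseteq> S' \<Longrightarrow> ihull v S \<subseteq> ihull v S'"
  using hull_mono[of "v ` S" "v ` S'" convex] finite_subset[of S S']
  by (auto simp: ihull_eq_convex_hull[symmetric])

text \<open>Continuous image of a simplex of coefficients. Coefficients from \<open>n\<close> on are
  confined to \<open>{0}\<close>, so Tychonoff's theorem gives compactness in the sequence
  space.\<close>

lemma compact_ihull: "compact (ihull v {..<n})"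
proof -
  let ?B = "\<Pi>\<^sub>E i\<in>UNIV. if i < n then {0..1::real} else {0}"
  let ?A = "?B \<inter> {l. sum l {..<n} = 1}"
  have "compact ?B"
    unfolding compactin_euclidean_iff[symmetric] euclidean_product_topology[symmetric]
    by (subst compactin_PiE) (auto simp: compactin_euclidean_iff)
  moreover have "closed {l :: nat \<Rightarrow> real. sum l {..<n} = 1}"
    by (intro closed_Collect_eq continuous_intros)
  ultimately have "compact ?A" by (rule compact_Int_closed)
  moreover have "continuous_on ?A (\<lambda>l. \<Sum>i<n. l i *\<^sub>R v i)"
    by (rule continuous_on_coordinatewise_then_product)
      (auto simp: sum_fun_apply intro!: continuous_intros)
  ultimately have "compact ((\<lambda>l. \<Sum>i<n. l i *\<^sub>R v i) ` ?A)" by (rule compact_continuous_image[rotated])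
  also have "(\<lambda>l. \<Sum>i<n. l i *\<^sub>R v i) ` ?A = ihull v {..<n}"
  proof (intro equalityI subsetI)
    fix x assume "x \<in> (\<lambda>l. \<Sum>i<n. l i *\<^sub>R v i) ` ?A"
    then obtain l where l: "x = (\<Sum>i<n. l i *\<^sub>R v i)" "l \<in> ?B" "sum l {..<n} = 1" by auto
    have "0 \<le> l i" if "i < n" for i using l(2) that by (auto simp: PiE_iff split: if_splits)
    with l show "x \<in> ihull v {..<n}" by (intro ihullI) auto
  next
    fix x assume "x \<in> ihull v {..<n}"
    then obtain l where l: "x = (\<Sum>i<n. l i *\<^sub>R v i)" "\<forall>i<n. 0 \<le> l i" "sum l {..<n} = 1"
      by (auto simp: ihull_def)
    have "l i \<le> 1" if "i < n" for i using member_le_sum[of i "{..<n}" l] that l by auto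
    then have "(\<lambda>i. if i < n then l i else 0) \<in> ?A" using l by auto
    then show "x \<in> (\<lambda>l. \<Sum>i<n. l i *\<^sub>R v i) ` ?A"
      by (rule image_eqI[rotated]) (simp add: l)
  qed
  finally show ?thesis .
qed

lemma ihull_borel: "ihull v {..<n} \<in> sets borel"
  using compact_ihull[of v n] by (intro borel_closed compact_imp_closed)

lemma ihull_rep:
  assumes "x \<in> ihull v {..<n}"
  shows "\<exists>l. rep n v x l"
proof -
  obtain l where l: "x = (\<Sum>i<n. l i *\<^sub>R v i)" "\<forall>i<n. 0 \<le> l i" "sum l {..<n} = 1"
    using assms by (auto simp: ihull_def)
  then have "rep n v x (\<lambda>i. if i < n then l i else 0)"
    by (auto simp: rep_def Rd_def)
  then show ?thesis by blast
qed

text \<open>Lift \<open>v i\<close> to height \<open>c i\<close>; then \<open>D\<close> lists the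
  lower facets of the lifted points. Off the null set of points in a hull of at most
  \<open>d\<close> of the \<open>v i\<close>, the support of an optimal representation is a member
  of \<open>D\<close>, and two members containing the same point coincide.\<close>

lemma triangulation:
  assumes v: "\<And>i. i < n \<Longrightarrow> v i \<in> Rd d"
  shows "\<exists>D\<subseteq>Pow {..<n}. (\<forall>S\<in>D. aff_indep v S \<and> card S = Suc d) \<and>
    (AE x in vol_Rd d. (\<Sum>S\<in>D. indicator (ihull v S) x) = (indicator (ihull v {..<n}) x :: ennreal))"
proof -
  obtain c :: "nat \<Rightarrow> real" where generic: "\<And>S i \<beta>. S \<subseteq> {..<n} \<Longrightarrow> aff_indep v S \<Longrightarrow> i < n \<Longrightarrow> i \<notin> S \<Longrightarrow>
    sum \<beta> S = 1 \<Longrightarrow> (\<Sum>j\<in>S. \<beta> j *\<^sub>R v j) = v i \<Longrightarrow> (\<Sum>j\<in>S. \<beta> j * c j) \<noteq> c i"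
    using generic_cost[of n v] by blast
  define aff where "aff = (\<lambda>y :: (nat \<Rightarrow> real) \<Rightarrow> real. \<forall>(I :: nat set) l w. finite I \<longrightarrow> sum l I = 1 \<longrightarrow>
    (\<forall>i\<in>I. w i \<in> Rd d) \<longrightarrow> y (\<Sum>i\<in>I. l i *\<^sub>R w i) = (\<Sum>i\<in>I. l i * y (w i)))"
  have affD: "y (\<Sum>i\<in>I. l i *\<^sub>R w i) = (\<Sum>i\<in>I. l i * y (w i))"
    if "aff y" "finite I" "sum l I = 1" "\<forall>i\<in>I. w i \<in> Rd d" for y and I :: "nat set" and l w
    using that unfolding aff_def by blast
  define D where "D = {S. S \<subseteq> {..<n} \<and> aff_indep v S \<and> card S = Suc d \<and>
    (\<exists>y. aff y \<and> (\<forall>i\<in>S. y (v i) = c i) \<and> (\<forall>i\<in>{..<n} - S. y (v i) < c i))}"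
  have fin: "finite S" if "S \<subseteq> {..<n}" for S using that finite_subset by blast
  have finD: "finite D" by (rule finite_subset[of _ "Pow {..<n}"]) (auto simp: D_def)
  have exists: "\<exists>S\<in>D. x \<in> ihull v S"
    if x: "x \<in> ihull v {..<n}" and good: "\<And>S. S \<subseteq> {..<n} \<Longrightarrow> card S \<le> d \<Longrightarrow> x \<notin> ihull v S" for x
  proof -
    obtain l0 where "rep n v x l0" using ihull_rep[OF x] ..
    then obtain l where l: "rep n v x l" "aff_indep v (supp n l)"
      and opt: "\<And>m. rep n v x m \<Longrightarrow> inner_Rd n c l \<le> inner_Rd n c m"
      using rep_optimal by blast
    let ?S = "supp n l"
    have S: "?S \<subseteq> {..<n}" by (rule supp_subset)
    have vS: "v i \<in> Rd d" if "i \<in> ?S" for i using S that v by auto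
    have "sum l ?S = sum l {..<n}" "(\<Sum>i\<in>?S. l i *\<^sub>R v i) = (\<Sum>i<n. l i *\<^sub>R v i)"
      by (rule sum_supp, simp)+
    then have xS: "x \<in> ihull v ?S"
      using l S by (intro ihullI[of _ l]) (auto simp: rep_def)
    then have "\<not> card ?S \<le> d" using good[OF S] by blast
    moreover have "card ?S \<le> Suc d" by (rule aff_indep_card_le[OF _ vS l(2)]) auto
    ultimately have card: "card ?S = Suc d" by simp
    obtain y where y: "\<forall>i\<in>?S. y (v i) = c i" and "aff y"
      using affine_interpolation[OF finite_supp card vS l(2), of c] unfolding aff_def by blast
    have "y (v i) < c i" if i: "i < n" "i \<notin> ?S" for i
    proof -
      obtain \<beta> where \<beta>: "sum \<beta> ?S = 1" "(\<Sum>j\<in>?S. \<beta> j *\<^sub>R v j) = v i"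
        using affine_coordinates[OF finite_supp card vS l(2) v[OF i(1)]] by blast
      have "y (v i) = (\<Sum>j\<in>?S. \<beta> j * y (v j))"
        using affD[OF \<open>aff y\<close> finite_supp \<beta>(1), of v] vS by (simp add: \<beta>(2))
      also have "\<dots> = (\<Sum>j\<in>?S. \<beta> j * c j)" using y by simp
      finally show ?thesis
        using rep_dual[OF l(1) opt i \<beta>] generic[OF S l(2) i \<beta>] by simp
    qed
    then have "?S \<in> D" using S l(2) card y \<open>aff y\<close> unfolding D_def by blast
    with xS show ?thesis by blast
  qed
  have unique: "S = S'"
    if S: "S \<in> D" "x \<in> ihull v S" and S': "S' \<in> D" "x \<in> ihull v S'"
      and good: "\<And>S. S \<subseteq> {..<n} \<Longrightarrow> card S \<le> d \<Longrightarrow> x \<notin> ihull v S" for S S' x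
  proof (rule ccontr)
    assume "S \<noteq> S'"
    obtain l l' where l: "\<forall>i\<in>S. 0 \<le> l i" "sum l S = 1" "x = (\<Sum>i\<in>S. l i *\<^sub>R v i)"
      and l': "\<forall>i\<in>S'. 0 \<le> l' i" "sum l' S' = 1" "x = (\<Sum>i\<in>S'. l' i *\<^sub>R v i)"
      using S(2) S'(2) by (auto simp: ihull_def)
    have sub: "S \<subseteq> {..<n}" "S' \<subseteq> {..<n}" "card S = Suc d" "card S' = Suc d"
      using S S' by (auto simp: D_def)
    note [simp] = fin[OF sub(1)] fin[OF sub(2)]
    obtain y where y: "aff y" "\<forall>i\<in>S. y (v i) = c i" "\<forall>i\<in>{..<n} - S. y (v i) < c i" using S by (auto simp: D_def)
    obtain y' where y': "aff y'" "\<forall>i\<in>S'. y' (v i) = c i" "\<forall>i\<in>{..<n} - S'. y' (v i) < c i" using S' by (auto simp: D_def)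
    have yle: "y (v i) \<le> c i" "y' (v i) \<le> c i" if "i < n" for i
      using y(2,3) y'(2,3) that by (metis DiffI lessThan_iff less_imp_le order_refl)+
    have vR: "\<forall>i\<in>S. v i \<in> Rd d" "\<forall>i\<in>S'. v i \<in> Rd d" using sub v by auto
    have yx: "y x = (\<Sum>i\<in>S. l i * y (v i))" "y' x = (\<Sum>i\<in>S. l i * y' (v i))"
      using affD[OF y(1) fin[OF sub(1)] l(2) vR(1)] affD[OF y'(1) fin[OF sub(1)] l(2) vR(1)]
      by (simp_all only: l(3))
    have y'x: "y x = (\<Sum>i\<in>S'. l' i * y (v i))" "y' x = (\<Sum>i\<in>S'. l' i * y' (v i))"
      using affD[OF y(1) fin[OF sub(2)] l'(2) vR(2)] affD[OF y'(1) fin[OF sub(2)] l'(2) vR(2)]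
      by (simp_all only: l'(3))
    have "y x = (\<Sum>i\<in>S. l i * c i)" "y' x = (\<Sum>i\<in>S'. l' i * c i)"
      using yx(1) y'x(2) y(2) y'(2) by simp_all
    \<comment> \<open>Since \<open>y'\<close> lies below the heights, \<open>y' x \<le> y x\<close>.
      The reverse difference is a sum of nonnegative terms, so all of them vanish. As
      \<open>y\<close> is strictly below \<open>c\<close> off \<open>S\<close>, only common indices
      carry weight, and a proper common face is excluded by \<open>good\<close>.\<close>
    moreover have "y' x \<le> (\<Sum>i\<in>S. l i * c i)"
      unfolding yx(2) using l(1) yle sub by (intro sum_mono mult_left_mono) auto
    ultimately have "(\<Sum>i\<in>S'. l' i * (c i - y (v i))) \<le> 0"
      using y'x(1) by (simp add: right_diff_distrib sum_subtractf)
    moreover have nn: "\<forall>i\<in>S'. 0 \<le> l' i * (c i - y (v i))" using l'(1) yle sub by auto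
    ultimately have "(\<Sum>i\<in>S'. l' i * (c i - y (v i))) = 0" by (intro antisym sum_nonneg) auto
    then have "\<forall>i\<in>S'. l' i * (c i - y (v i)) = 0" using nn by (simp add: sum_nonneg_eq_0_iff)
    then have zero: "l' i = 0" if "i \<in> S'" "i \<notin> S" for i using that y(3) sub by force
    have "sum l' (S \<inter> S') = sum l' S'" "(\<Sum>i\<in>S \<inter> S'. l' i *\<^sub>R v i) = (\<Sum>i\<in>S'. l' i *\<^sub>R v i)"
      by (rule sum.mono_neutral_left; use zero in auto)+
    then have "x \<in> ihull v (S \<inter> S')" using l' by (intro ihullI[of _ l']) auto
    moreover have "S \<inter> S' \<noteq> S'"
    proof
      assume "S \<inter> S' = S'"
      then have "S' \<subseteq> S" by blast
      then show False using \<open>S \<noteq> S'\<close> sub card_subset_eq[of S S'] by simp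
    qed
    then have "card (S \<inter> S') < card S'" by (intro psubset_card_mono) auto
    ultimately show False using good[of "S \<inter> S'"] sub by auto
  qed
  have AEgood: "AE x in vol_Rd d. \<forall>S\<in>{S. S \<subseteq> {..<n} \<and> card S \<le> d}. x \<notin> ihull v S"
  proof (rule AE_finite_allI)
    show "finite {S. S \<subseteq> {..<n} \<and> card S \<le> d}" by (rule finite_subset[of _ "Pow {..<n}"]) auto
    fix S assume "S \<in> {S. S \<subseteq> {..<n} \<and> card S \<le> d}"
    then show "AE x in vol_Rd d. x \<notin> ihull v S"
      using v by (intro AE_not_in_flat_ihull) (auto intro: fin)
  qed
  have "AE x in vol_Rd d. (\<Sum>S\<in>D. indicator (ihull v S) x) = (indicator (ihull v {..<n}) x :: ennreal)"
    using AEgood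
  proof eventually_elim
    case (elim x)
    then have good: "\<And>S. S \<subseteq> {..<n} \<Longrightarrow> card S \<le> d \<Longrightarrow> x \<notin> ihull v S" by auto
    show ?case
    proof (cases "x \<in> ihull v {..<n}")
      case True
      then obtain S where S: "S \<in> D" "x \<in> ihull v S" using exists good by blast
      have "x \<notin> ihull v T" if "T \<in> D" "T \<noteq> S" for T
        using unique[OF that(1) _ S good] that(2) by blast
      then have "indicator (ihull v T) x = (if T = S then 1 else (0::ennreal))" if "T \<in> D" for T
        using that S(2) by (cases "T = S") simp_all
      then have "(\<Sum>T\<in>D. indicator (ihull v T) x) = (\<Sum>T\<in>D. if T = S then 1 else (0::ennreal))"
        by (rule sum.cong[OF refl])
      then show ?thesis using S(1) finD True by simp
    next
      case False
      then have "x \<notin> ihull v S" if "S \<in> D" for S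
        using ihull_mono[of "{..<n}" S v] that by (auto simp: D_def)
      then show ?thesis using False by simp
    qed
  qed
  then show ?thesis by (intro exI[of _ D]) (auto simp: D_def)
qed

text \<open>Substitution along the affine map from the standard simplex. The Jacobian
  \<open>C\<close> stays unspecified, because it also appears in the volume (take \<open>f\<close>
  constant) and cancels when a moment is compared with it.\<close>

lemma nn_integral_ihull_simplex:
  assumes S: "finite S" "card S = Suc d" "\<And>i. i \<in> S \<Longrightarrow> v i \<in> Rd d" "aff_indep v S"
  shows "\<exists>b e C. b \<in> S \<and> bij_betw e {..<d} (S - {b}) \<and> C > 0 \<and> ihull v S \<in> sets borel \<and>
    (\<forall>f\<in>borel_measurable borel. (\<integral>\<^sup>+x. f x * indicator (ihull v S) x \<partial>vol_Rd d) =
      ennreal C * (\<integral>\<^sup>+x. f ((1 - (\<Sum>j<d. x j)) *\<^sub>R v b + (\<Sum>j<d. x j *\<^sub>R v (e j))) * indicator (std_simplex d) x \<partial>vol_Rd d))"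
proof -
  obtain b e M N where b: "b \<in> S" and e: "bij_betw e {..<d} (S - {b})" and MN: "mutual_inverse d M N"
    and param: "\<forall>x. mv d M x + v b = (1 - (\<Sum>j<d. x j)) *\<^sub>R v b + (\<Sum>j<d. x j *\<^sub>R v (e j))"
    using aff_indep_matrix[OF S] by blast
  define T where "T = (\<lambda>x. mv d M x + v b)"
  have vb: "v b \<in> Rd d" using S b by blast
  have Nin: "mv d N (mv d M x) = x" if "x \<in> Rd d" for x using MN that by (simp add: mutual_inverse_def)
  have T_iff: "T x \<in> ihull v S \<longleftrightarrow> x \<in> std_simplex d" if x: "x \<in> Rd d" for x
  proof
    assume "x \<in> std_simplex d"
    define l where "l = (\<lambda>i. if i = b then 1 - (\<Sum>j<d. x j) else x (inv_into {..<d} e i))"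
    have le: "l (e j) = x j" if "j < d" for j
      using that e by (auto simp: l_def bij_betw_def inv_into_f_f)
    have lb: "l b = 1 - (\<Sum>j<d. x j)" by (simp add: l_def)
    show "T x \<in> ihull v S"
    proof (rule ihullI[of _ l])
      fix i assume i: "i \<in> S"
      show "0 \<le> l i"
      proof (cases "i = b")
        case False
        then have "i \<in> e ` {..<d}" using e i by (auto simp: bij_betw_def)
        then show ?thesis using le \<open>x \<in> std_simplex d\<close> by (auto simp: std_simplex_def)
      qed (use \<open>x \<in> std_simplex d\<close> in \<open>simp add: lb std_simplex_def\<close>)
    qed (use le in \<open>simp_all add: sum_split_bij[OF S(1) b e] lb T_def param\<close>)
  next
    assume "T x \<in> ihull v S"
    then obtain l where l: "\<forall>i\<in>S. 0 \<le> l i" "sum l S = 1" "T x = (\<Sum>i\<in>S. l i *\<^sub>R v i)"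
      by (auto simp: ihull_def)
    define z where "z = (\<lambda>j. if j < d then l (e j) else 0)"
    have z: "z \<in> Rd d" by (simp add: z_def Rd_def)
    have lb: "l b = 1 - (\<Sum>j<d. z j)" using l(2) by (simp add: sum_split_bij[OF S(1) b e] z_def)
    have "T x = T z"
      unfolding l(3) by (simp add: sum_split_bij[OF S(1) b e] lb T_def param) (simp add: z_def)
    then have "mv d M x = mv d M z" by (simp add: T_def)
    then have "x = z" by (metis Nin x z)
    moreover have "0 \<le> z j" if "j < d" for j using l(1) e that by (auto simp: z_def bij_betw_def)
    moreover have "0 \<le> l b" using l(1) b by blast
    ultimately show "x \<in> std_simplex d" using z lb by (simp add: std_simplex_def)
  qed
  have "ihull v S = Rd d \<inter> (\<lambda>x. mv d N (x - v b)) -` std_simplex d"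
  proof (intro equalityI subsetI)
    fix x assume x: "x \<in> ihull v S"
    then have "x \<in> Rd d" using ihull_in_Rd S(3) by blast
    moreover have "T (mv d N (x - v b)) = x"
      using MN Rd_diff[OF \<open>x \<in> Rd d\<close> vb] by (simp add: mutual_inverse_def T_def)
    ultimately show "x \<in> Rd d \<inter> (\<lambda>x. mv d N (x - v b)) -` std_simplex d"
      using T_iff[of "mv d N (x - v b)"] x by simp
  next
    fix x assume x: "x \<in> Rd d \<inter> (\<lambda>x. mv d N (x - v b)) -` std_simplex d"
    moreover have "T (mv d N (x - v b)) = x"
      using MN Rd_diff[OF _ vb, of x] x by (simp add: mutual_inverse_def T_def)
    ultimately show "x \<in> ihull v S" using T_iff[of "mv d N (x - v b)"] by simp
  qed
  also have "\<dots> \<in> sets borel"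
  proof (intro sets.Int Rd_borel measurable_sets_borel)
    show "(\<lambda>x. mv d N (x - v b)) \<in> borel \<rightarrow>\<^sub>M borel" by measurable
  qed (rule std_simplex_borel)
  finally have [measurable]: "ihull v S \<in> sets borel" .
  obtain c where "scales d (mv d M) c" using scales_exists[OF MN] by blast
  then have c: "scales d T c" using scales_comp[OF scales_translation[OF vb]] by (simp add: T_def)
  note [measurable] = scales_measurable[OF c]
  have "(\<integral>\<^sup>+x. f x * indicator (ihull v S) x \<partial>vol_Rd d) =
      ennreal (1 / c) * (\<integral>\<^sup>+x. f (T x) * indicator (std_simplex d) x \<partial>vol_Rd d)"
    if [measurable]: "f \<in> borel_measurable borel" for f
  proof -
    have "(\<integral>\<^sup>+x. f (T x) * indicator (std_simplex d) x \<partial>vol_Rd d) =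
        (\<integral>\<^sup>+x. f (T x) * indicator (ihull v S) (T x) \<partial>vol_Rd d)"
      using AE_vol_Rd[of d] by (intro nn_integral_cong_AE) (auto elim!: eventually_mono simp: T_iff indicator_def)
    also have "\<dots> = ennreal c * (\<integral>\<^sup>+x. f x * indicator (ihull v S) x \<partial>vol_Rd d)"
      by (rule scales_nn[OF c]) measurable
    finally show ?thesis
      using scales_pos[OF c] by (simp add: mult.assoc[symmetric] ennreal_mult[symmetric])
  qed
  then show ?thesis
    using b e scales_pos[OF c] \<open>ihull v S \<in> sets borel\<close> param
    by (intro exI[of _ b] exI[of _ e] exI[of _ "1 / c"]) (simp add: T_def)
qed

section \<open>The second moment of a polytope\<close>

lemma inner_Rd_commute: "inner_Rd d x y = inner_Rd d y x"
  by (simp add: inner_Rd_def mult.commute)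

lemma inner_Rd_add: "inner_Rd d (x + y) z = inner_Rd d x z + inner_Rd d y z"
  and inner_Rd_diff: "inner_Rd d (x - y) z = inner_Rd d x z - inner_Rd d y z"
  and inner_Rd_scaleR: "inner_Rd d (c *\<^sub>R x) z = c * inner_Rd d x z"
  by (simp_all add: inner_Rd_def algebra_simps sum.distrib sum_subtractf sum_distrib_left)

lemma inner_Rd_add_right: "inner_Rd d z (x + y) = inner_Rd d z x + inner_Rd d z y"
  and inner_Rd_diff_right: "inner_Rd d z (x - y) = inner_Rd d z x - inner_Rd d z y"
  and inner_Rd_scaleR_right: "inner_Rd d z (c *\<^sub>R x) = c * inner_Rd d z x"
  by (simp_all add: inner_Rd_commute[of d z] inner_Rd_add inner_Rd_diff inner_Rd_scaleR)

lemma inner_Rd_self_pos: "x \<in> Rd d \<Longrightarrow> x \<noteq> 0 \<Longrightarrow> 0 < inner_Rd d x x"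
proof -
  assume x: "x \<in> Rd d" "x \<noteq> 0"
  then obtain k where "k < d" "x k \<noteq> 0" using Rd_eqI[of x d 0] by auto
  then have "0 < x k * x k" by (simp add: zero_less_mult_iff linorder_neq_iff disj_commute)
  then show ?thesis unfolding inner_Rd_def using \<open>k < d\<close>
    by (intro sum_pos2[of _ k]) auto
qed

lemma inner_Rd_axis: "k < d \<Longrightarrow> inner_Rd d (axis_Rd k) x = x k"
  by (simp add: inner_Rd_def)

lemma mv_inner: "k < d \<Longrightarrow> mv d A x k = inner_Rd d (A k) x"
  by (simp add: mv_apply inner_Rd_def)

lemma measurable_inner_Rd [measurable]:
  fixes f :: "'a \<Rightarrow> nat \<Rightarrow> real"
  assumes "f \<in> M \<rightarrow>\<^sub>M borel"
  shows "(\<lambda>x. inner_Rd d \<phi> (f x)) \<in> borel_measurable M"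
proof -
  note [measurable] = measurable_coordD[OF assms]
  show ?thesis unfolding inner_Rd_def by measurable
qed

lemma parseval:
  fixes g :: "nat \<Rightarrow> real" and z :: "nat \<Rightarrow> nat \<Rightarrow> real"
  assumes orth: "\<And>k l. k < d \<Longrightarrow> l < d \<Longrightarrow> (\<Sum>i<n. z i k * z i l) = (if k = l then 1 else 0)"
  shows "(\<Sum>i<n. (\<Sum>k<d. g k * z i k)\<^sup>2) = (\<Sum>k<d. (g k)\<^sup>2)"
proof -
  have "(\<Sum>i<n. (\<Sum>k<d. g k * z i k)\<^sup>2) = (\<Sum>i<n. \<Sum>k<d. \<Sum>l<d. g k * g l * (z i k * z i l))"
    by (simp add: power2_eq_square sum_product mult_ac)
  also have "\<dots> = (\<Sum>k<d. \<Sum>i<n. \<Sum>l<d. g k * g l * (z i k * z i l))" by (rule sum.swap)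
  also have "\<dots> = (\<Sum>k<d. \<Sum>l<d. \<Sum>i<n. g k * g l * (z i k * z i l))"
    by (intro sum.cong refl sum.swap)
  also have "\<dots> = (\<Sum>k<d. \<Sum>l<d. if k = l then g k * g l else 0)"
    by (intro sum.cong refl) (auto simp: sum_distrib_left[symmetric] orth)
  finally show ?thesis by (simp add: power2_eq_square)
qed

text \<open>The columns of \<open>z\<close> are orthonormal in \<open>n\<close>-space. The left side
  is the squared norm of the projection of \<open>h\<close> onto their span, and the nonnegative sum
  in the proof is the squared distance of \<open>h\<close> from it.\<close>

lemma bessel:
  fixes h :: "nat \<Rightarrow> real" and z :: "nat \<Rightarrow> nat \<Rightarrow> real"
  assumes orth: "\<And>k l. k < d \<Longrightarrow> l < d \<Longrightarrow> (\<Sum>i<n. z i k * z i l) = (if k = l then 1 else 0)"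
  shows "(\<Sum>k<d. (\<Sum>i<n. h i * z i k)\<^sup>2) \<le> (\<Sum>i<n. (h i)\<^sup>2)"
proof -
  define g where "g = (\<lambda>k. \<Sum>i<n. h i * z i k)"
  have "(\<Sum>i<n. h i * (\<Sum>k<d. g k * z i k)) = (\<Sum>i<n. \<Sum>k<d. g k * (h i * z i k))"
    by (simp add: sum_distrib_left mult_ac)
  also have "\<dots> = (\<Sum>k<d. \<Sum>i<n. g k * (h i * z i k))" by (rule sum.swap)
  also have "\<dots> = (\<Sum>k<d. (g k)\<^sup>2)"
    by (simp add: sum_distrib_left[symmetric] g_def power2_eq_square)
  finally have 1: "(\<Sum>i<n. h i * (\<Sum>k<d. g k * z i k)) = (\<Sum>k<d. (g k)\<^sup>2)" .
  have 2: "(\<Sum>i<n. (\<Sum>k<d. g k * z i k)\<^sup>2) = (\<Sum>k<d. (g k)\<^sup>2)"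
    using orth by (rule parseval)
  have "0 \<le> (\<Sum>i<n. (h i - (\<Sum>k<d. g k * z i k))\<^sup>2)" by (simp add: sum_nonneg)
  also have "\<dots> = (\<Sum>i<n. (h i)\<^sup>2) - 2 * (\<Sum>i<n. h i * (\<Sum>k<d. g k * z i k)) + (\<Sum>i<n. (\<Sum>k<d. g k * z i k)\<^sup>2)"
    by (simp add: power2_diff sum.distrib sum_subtractf sum_distrib_left mult_ac)
  finally show ?thesis using 1 2 by (simp add: g_def)
qed

text \<open>On each simplex of the triangulation the bound is relative to its own volume, so
  summation gives the same ratio for the whole polytope.\<close>

lemma second_moment_bound:
  fixes A v :: "nat \<Rightarrow> nat \<Rightarrow> real"
  assumes v: "\<And>i. i < n \<Longrightarrow> v i \<in> Rd d"
    and orth: "\<And>k l. k < d \<Longrightarrow> l < d \<Longrightarrow>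
      (\<Sum>i<n. inner_Rd d (A k) (v i - w) * inner_Rd d (A l) (v i - w)) = (if k = l then 1 else 0)"
  shows "(\<integral>\<^sup>+x. ennreal (\<Sum>k<d. (inner_Rd d (A k) (x - w))\<^sup>2) * indicator (ihull v {..<n}) x \<partial>vol_Rd d)
    \<le> ennreal ((2 * real d + 1) / ((real d + 1) * (real d + 2))) * emeasure (vol_Rd d) (ihull v {..<n})"
proof -
  define f where "f = (\<lambda>x. ennreal (\<Sum>k<d. (inner_Rd d (A k) (x - w))\<^sup>2))"
  have [measurable]: "(\<lambda>x::nat \<Rightarrow> real. x - w) \<in> borel \<rightarrow>\<^sub>M borel" by measurable
  have fm [measurable]: "f \<in> borel_measurable borel" unfolding f_def by measurable
  define r where "r = (2 * real d + 1) / ((real d + 1) * (real d + 2))"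
  define z where "z = (\<lambda>i k. inner_Rd d (A k) (v i - w))"
  have zo: "(\<Sum>i<n. z i k * z i l) = (if k = l then 1 else 0)" if "k < d" "l < d" for k l
    using orth[OF that] by (simp add: z_def)
  have simplex: "(\<integral>\<^sup>+x. f x * indicator (ihull v S) x \<partial>vol_Rd d) \<le> ennreal r * emeasure (vol_Rd d) (ihull v S)"
    and borel: "ihull v S \<in> sets borel"
    if S: "S \<subseteq> {..<n}" "aff_indep v S" "card S = Suc d" for S
  proof -
    have fin: "finite S" using S finite_subset by blast
    have vS: "v i \<in> Rd d" if "i \<in> S" for i using S v that by auto
    obtain b e C where b: "b \<in> S" and e: "bij_betw e {..<d} (S - {b})" and C: "C > 0"
      and [measurable]: "ihull v S \<in> sets borel"
      and int: "\<forall>f\<in>borel_measurable borel. (\<integral>\<^sup>+x. f x * indicator (ihull v S) x \<partial>vol_Rd d) =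
      ennreal C * (\<integral>\<^sup>+x. f ((1 - (\<Sum>j<d. x j)) *\<^sub>R v b + (\<Sum>j<d. x j *\<^sub>R v (e j))) * indicator (std_simplex d) x \<partial>vol_Rd d)"
      using nn_integral_ihull_simplex[OF fin S(3) vS S(2)] by blast
    show "ihull v S \<in> sets borel" by measurable
    have vol: "emeasure (vol_Rd d) (ihull v S) = ennreal (C / fact d)"
      using int[rule_format, of "\<lambda>_. 1"] C by (simp add: emeasure_std_simplex ennreal_mult'[symmetric])
    let ?T = "\<lambda>x. (1 - (\<Sum>j<d. x j)) *\<^sub>R v b + (\<Sum>j<d. x j *\<^sub>R v (e j))"
    let ?g = "\<lambda>k x. (z b k * (1 - (\<Sum>j<d. x j)) + (\<Sum>j<d. z (e j) k * x j))\<^sup>2"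
    have lin: "inner_Rd d (A k) (?T x - w) = z b k * (1 - (\<Sum>j<d. x j)) + (\<Sum>j<d. z (e j) k * x j)" for k x
      by (simp add: z_def inner_Rd_add_right inner_Rd_diff_right inner_Rd_scaleR_right inner_Rd_sum
          algebra_simps sum_subtractf sum_distrib_left sum_distrib_right)
    have "(\<integral>\<^sup>+x. f (?T x) * indicator (std_simplex d) x \<partial>vol_Rd d) =
      (\<integral>\<^sup>+x. (\<Sum>k<d. ennreal (?g k x) * indicator (std_simplex d) x) \<partial>vol_Rd d)"
    proof (rule nn_integral_cong)
      fix x
      have "f (?T x) = (\<Sum>k<d. ennreal (?g k x))"
        unfolding f_def lin by (rule sum_ennreal[symmetric]) simp
      then show "f (?T x) * indicator (std_simplex d) x = (\<Sum>k<d. ennreal (?g k x) * indicator (std_simplex d) x)"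
        by (simp only: sum_distrib_right)
    qed
    also have "\<dots> = (\<Sum>k<d. \<integral>\<^sup>+x. ennreal (?g k x) * indicator (std_simplex d) x \<partial>vol_Rd d)"
      by (rule nn_integral_sum) measurable
    also have "\<dots> = (\<Sum>k<d. ennreal (((z b k + (\<Sum>j<d. z (e j) k))\<^sup>2 + (z b k)\<^sup>2 + (\<Sum>j<d. (z (e j) k)\<^sup>2)) / fact (d + 2)))"
      by (intro sum.cong refl nn_integral_std_simplex_square)
    also have "\<dots> = (\<Sum>k<d. ennreal (((\<Sum>i\<in>S. z i k)\<^sup>2 + (\<Sum>i\<in>S. (z i k)\<^sup>2)) / fact (d + 2)))"
      by (simp add: sum_split_bij[OF fin b e] add.assoc)
    also have "\<dots> = ennreal (((\<Sum>k<d. (\<Sum>i\<in>S. z i k)\<^sup>2) + (\<Sum>k<d. \<Sum>i\<in>S. (z i k)\<^sup>2)) / fact (d + 2))"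
      by (subst sum_ennreal) (auto simp: sum.distrib[symmetric] sum_divide_distrib intro!: sum_nonneg divide_nonneg_nonneg add_nonneg_nonneg)
    also have "\<dots> \<le> ennreal ((2 * real d + 1) / fact (d + 2))"
    proof (intro ennreal_leI divide_right_mono)
      \<comment> \<open>The column sums over \<open>S\<close> are inner products with the indicator
        of \<open>S\<close>, whose squared norm is \<open>card S = d + 1\<close>.\<close>
      have "(\<Sum>i\<in>S. z i k) = (\<Sum>i<n. (if i \<in> S then 1 else 0) * z i k)" for k
        using S(1) by (intro sum.mono_neutral_cong_left) auto
      moreover have "(\<Sum>i<n. (if i \<in> S then 1 else 0 :: real)\<^sup>2) = (\<Sum>i\<in>S. 1)"
        using S(1) by (intro sum.mono_neutral_cong_right) auto
      ultimately have 1: "(\<Sum>k<d. (\<Sum>i\<in>S. z i k)\<^sup>2) \<le> real d + 1"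
        using bessel[where h = "\<lambda>i. if i \<in> S then 1 else 0" and z = z and d = d and n = n, OF zo] S(3) by simp
      \<comment> \<open>Each of the \<open>d\<close> full columns has norm 1, and restriction to
        \<open>S\<close> only drops squares.\<close>
      have "(\<Sum>k<d. \<Sum>i\<in>S. (z i k)\<^sup>2) \<le> (\<Sum>k<d. \<Sum>i<n. (z i k)\<^sup>2)"
        using S(1) by (intro sum_mono sum_mono2) auto
      also have "\<dots> = (\<Sum>k<d. 1)" by (intro sum.cong refl) (use zo in \<open>simp add: power2_eq_square\<close>)
      finally show "(\<Sum>k<d. (\<Sum>i\<in>S. z i k)\<^sup>2) + (\<Sum>k<d. \<Sum>i\<in>S. (z i k)\<^sup>2) \<le> 2 * real d + 1"
        using 1 by simp
    qed simp
    finally have "(\<integral>\<^sup>+x. f x * indicator (ihull v S) x \<partial>vol_Rd d) \<le> ennreal C * ennreal ((2 * real d + 1) / fact (d + 2))"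
      using int[rule_format, OF fm] by (simp add: mult_left_mono)
    also have "\<dots> = ennreal (r * (C / fact d))"
    proof -
      have f2: "fact (d + 2) = (real d + 2) * ((real d + 1) * fact d)" by (simp add: algebra_simps)
      have "C * ((2 * real d + 1) / fact (d + 2)) = r * (C / fact d)"
        unfolding r_def f2 by (simp add: mult_ac)
      then show ?thesis using C by (simp add: ennreal_mult'[symmetric])
    qed
    also have "\<dots> = ennreal r * emeasure (vol_Rd d) (ihull v S)"
      unfolding vol using C by (intro ennreal_mult) (auto simp: r_def)
    finally show "(\<integral>\<^sup>+x. f x * indicator (ihull v S) x \<partial>vol_Rd d) \<le> ennreal r * emeasure (vol_Rd d) (ihull v S)" .
  qed
  obtain D where D0: "D \<subseteq> Pow {..<n}" "\<forall>S\<in>D. aff_indep v S \<and> card S = Suc d"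
    and AE: "AE x in vol_Rd d. (\<Sum>S\<in>D. indicator (ihull v S) x) = (indicator (ihull v {..<n}) x :: ennreal)"
    using triangulation[of n v d, OF v] by blast
  have D: "S \<subseteq> {..<n}" "aff_indep v S" "card S = Suc d" if "S \<in> D" for S
    using D0 that by auto
  have bD: "ihull v S \<in> sets borel" if "S \<in> D" for S by (rule borel[OF D[OF that]])
  have "(\<integral>\<^sup>+x. f x * indicator (ihull v {..<n}) x \<partial>vol_Rd d) = (\<integral>\<^sup>+x. (\<Sum>S\<in>D. f x * indicator (ihull v S) x) \<partial>vol_Rd d)"
    using AE by (intro nn_integral_cong_AE) (auto elim!: eventually_mono simp: sum_distrib_left[symmetric])
  also have "\<dots> = (\<Sum>S\<in>D. \<integral>\<^sup>+x. f x * indicator (ihull v S) x \<partial>vol_Rd d)"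
    by (rule nn_integral_sum) (use bD in measurable)
  also have "\<dots> \<le> (\<Sum>S\<in>D. ennreal r * emeasure (vol_Rd d) (ihull v S))"
    by (intro sum_mono simplex D)
  also have "\<dots> = ennreal r * (\<Sum>S\<in>D. \<integral>\<^sup>+x. indicator (ihull v S) x \<partial>vol_Rd d)"
    using bD by (simp add: sum_distrib_left)
  also have "(\<Sum>S\<in>D. \<integral>\<^sup>+x. indicator (ihull v S) x \<partial>vol_Rd d) = (\<integral>\<^sup>+x. (\<Sum>S\<in>D. indicator (ihull v S) x) \<partial>vol_Rd d)"
    by (rule nn_integral_sum[symmetric]) (use bD in measurable)
  also have "\<dots> = (\<integral>\<^sup>+x. indicator (ihull v {..<n}) x \<partial>vol_Rd d)"
    using AE by (intro nn_integral_cong_AE)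
  also have "\<dots> = emeasure (vol_Rd d) (ihull v {..<n})"
    using ihull_borel[of v n] by simp
  finally show ?thesis by (simp only: f_def r_def)
qed

text \<open>Pivoting: the squared distances of the \<open>z i\<close> to the span of the first \<open>k\<close> chosen vectors sum to \<open>d - k\<close>,
  so the next index can be chosen with squared distance at least \<open>(d - k) / n\<close>.\<close>

lemma greedy_orthonormal:
  assumes z: "\<And>i. i < n \<Longrightarrow> z i \<in> Rd d"
    and orth: "\<And>k l. k < d \<Longrightarrow> l < d \<Longrightarrow> (\<Sum>i<n. z i k * z i l) = (if k = l then 1 else 0)"
  shows "\<exists>q idx. (\<forall>k<d. idx k < n) \<and>
    (\<forall>k<d. \<forall>l<d. inner_Rd d (q k) (q l) = (if k = l then 1 else 0)) \<and>
    (\<forall>k<d. \<forall>l<d. k < l \<longrightarrow> inner_Rd d (q l) (z (idx k)) = 0) \<and>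
    (\<forall>k<d. inner_Rd d (q k) (z (idx k)) > 0 \<and> real (d - k) / real n \<le> (inner_Rd d (q k) (z (idx k)))\<^sup>2)"
proof -
  have expand: "(\<Sum>i<n. (inner_Rd d x (z i))\<^sup>2) = inner_Rd d x x" for x
    using parseval[where d = d and n = n and z = z and g = x, OF orth] by (simp add: inner_Rd_def power2_eq_square)
  have total: "(\<Sum>i<n. inner_Rd d (z i) (z i)) = real d"
  proof -
    have "(\<Sum>i<n. inner_Rd d (z i) (z i)) = (\<Sum>k<d. \<Sum>i<n. z i k * z i k)"
      unfolding inner_Rd_def by (rule sum.swap)
    then show ?thesis by (simp add: orth)
  qed
  \<comment> \<open>The third clause says by duality that \<open>z (idx k)\<close> lies in the span
    of \<open>q 0, ..., q k\<close>. Quantifying over all \<open>y\<close> makes it apply to the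
    vectors \<open>q l\<close> with \<open>l > k\<close> chosen later.\<close>
  define P where "P = (\<lambda>m q idx. (\<forall>k<m. idx k < n) \<and>
    (\<forall>k<m. \<forall>l<m. inner_Rd d (q k) (q l) = (if k = l then 1 else 0)) \<and>
    (\<forall>k<m. \<forall>y. (\<forall>l\<le>k. inner_Rd d y (q l) = 0) \<longrightarrow> inner_Rd d y (z (idx k)) = 0) \<and>
    (\<forall>k<m. inner_Rd d (q k) (z (idx k)) > 0 \<and> real (d - k) / real n \<le> (inner_Rd d (q k) (z (idx k)))\<^sup>2))"
  have "m \<le> d \<Longrightarrow> \<exists>q idx. P m q idx" for m
  proof (induction m)
    case (Suc m)
    then obtain q idx where "P m q idx" by auto
    then have idx: "\<And>k. k < m \<Longrightarrow> idx k < n"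
      and q: "\<And>k l. k < m \<Longrightarrow> l < m \<Longrightarrow> inner_Rd d (q k) (q l) = (if k = l then 1 else 0)"
      and spn: "\<And>k y. k < m \<Longrightarrow> (\<forall>l\<le>k. inner_Rd d y (q l) = 0) \<Longrightarrow> inner_Rd d y (z (idx k)) = 0"
      and big: "\<And>k. k < m \<Longrightarrow> inner_Rd d (q k) (z (idx k)) > 0 \<and> real (d - k) / real n \<le> (inner_Rd d (q k) (z (idx k)))\<^sup>2"
      unfolding P_def by blast+
    define r where "r = (\<lambda>i. z i - (\<Sum>l<m. inner_Rd d (q l) (z i) *\<^sub>R q l))"
    have rq: "inner_Rd d (q l) (r i) = 0" if "l < m" for l i
      using that by (simp add: r_def inner_Rd_diff_right inner_Rd_sum q if_distrib[of "\<lambda>x. _ * x"] cong: if_cong)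
    have zr: "inner_Rd d y (z i) = inner_Rd d y (r i) + (\<Sum>l<m. inner_Rd d (q l) (z i) * inner_Rd d y (q l))" for y i
      by (simp add: r_def inner_Rd_diff_right inner_Rd_sum)
    have rz: "inner_Rd d (r i) (z i) = inner_Rd d (r i) (r i)" for i
      using zr[of "r i" i] rq by (simp add: inner_Rd_commute[of d "r i" "q _"])
    have rr: "inner_Rd d (r i) (r i) = inner_Rd d (z i) (z i) - (\<Sum>l<m. (inner_Rd d (q l) (z i))\<^sup>2)" for i
    proof -
      have "inner_Rd d (z i) (z i) = inner_Rd d (z i) (r i) + (\<Sum>l<m. (inner_Rd d (q l) (z i))\<^sup>2)"
        using zr[of "z i" i] by (simp add: inner_Rd_commute[of d "z i" "q _"] power2_eq_square)
      then show ?thesis using rz[of i] by (simp add: inner_Rd_commute[of d "z i" "r i"])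
    qed
    have "(\<Sum>i<n. inner_Rd d (r i) (r i)) = real d - (\<Sum>i<n. \<Sum>l<m. (inner_Rd d (q l) (z i))\<^sup>2)"
      by (simp add: rr sum_subtractf total)
    also have "(\<Sum>i<n. \<Sum>l<m. (inner_Rd d (q l) (z i))\<^sup>2) = (\<Sum>l<m. \<Sum>i<n. (inner_Rd d (q l) (z i))\<^sup>2)"
      by (rule sum.swap)
    also have "\<dots> = real m" by (simp add: expand q)
    finally have rsum: "(\<Sum>i<n. inner_Rd d (r i) (r i)) = real (d - m)" using Suc.prems by (simp add: of_nat_diff)
    have "\<exists>i<n. real (d - m) / real n \<le> inner_Rd d (r i) (r i)"
    proof (rule ccontr)
      assume c: "\<not> ?thesis"
      have "n \<noteq> 0" using rsum Suc.prems by (cases "n = 0") auto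
      then have "(\<Sum>i<n. inner_Rd d (r i) (r i)) < (\<Sum>i<n. real (d - m) / real n)"
        using c by (intro sum_strict_mono) (auto simp: not_le lessThan_empty_iff)
      then show False using rsum \<open>n \<noteq> 0\<close> by simp
    qed
    then obtain i where i: "i < n" "real (d - m) / real n \<le> inner_Rd d (r i) (r i)" by auto
    define s where "s = sqrt (inner_Rd d (r i) (r i))"
    have "0 < real (d - m) / real n" using Suc.prems i(1) by simp
    then have "0 < inner_Rd d (r i) (r i)" using i(2) by (rule less_le_trans)
    then have s: "s > 0" "s * s = inner_Rd d (r i) (r i)" by (simp_all add: s_def)
    define a where "a = (1 / s) *\<^sub>R r i"
    have az: "inner_Rd d a (z i) = s" using s by (simp add: a_def inner_Rd_scaleR rz s(2)[symmetric])
    have aa: "inner_Rd d a a = 1"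
      using s by (simp add: a_def inner_Rd_scaleR inner_Rd_scaleR_right s(2)[symmetric])
    have qa: "inner_Rd d (q l) a = 0" "inner_Rd d a (q l) = 0" if "l < m" for l
      using rq[OF that] by (simp_all add: a_def inner_Rd_scaleR_right inner_Rd_commute[of d _ "q l"])
    have zi0: "inner_Rd d y (z i) = 0" if y: "inner_Rd d y a = 0" "\<And>l. l < m \<Longrightarrow> inner_Rd d y (q l) = 0" for y
    proof -
      have "inner_Rd d y (r i) = 0" using y(1) s(1) by (simp add: a_def inner_Rd_scaleR_right)
      then show ?thesis using y(2) by (simp add: zr[of y i])
    qed
    have "P (Suc m) (q(m := a)) (idx(m := i))"
      unfolding P_def
    proof (intro conjI allI impI)
      fix k assume k: "k < Suc m"
      show "(idx(m := i)) k < n" using k idx i by (cases "k = m") auto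
      show "inner_Rd d ((q(m := a)) k) (z ((idx(m := i)) k)) > 0"
        "real (d - k) / real n \<le> (inner_Rd d ((q(m := a)) k) (z ((idx(m := i)) k)))\<^sup>2"
        using k big[of k] i s az by (cases "k = m"; simp add: power2_eq_square)+
      show "inner_Rd d y (z ((idx(m := i)) k)) = 0" if y: "\<forall>l\<le>k. inner_Rd d y ((q(m := a)) l) = 0" for y
      proof (cases "k = m")
        case True
        have "inner_Rd d y a = 0" using y True by (metis fun_upd_same order_refl)
        moreover have "inner_Rd d y (q l) = 0" if "l < m" for l
          using y[rule_format, of l] that True by simp
        ultimately show ?thesis using zi0 True by simp
      next
        case False
        then have "\<forall>l\<le>k. inner_Rd d y (q l) = 0" using y k by auto
        then show ?thesis using spn[of k y] False k by simp
      qed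
    next
      fix k l assume "k < Suc m" "l < Suc m"
      then show "inner_Rd d ((q(m := a)) k) ((q(m := a)) l) = (if k = l then 1 else 0)"
        using q[of k l] aa qa by (cases "k = m"; cases "l = m") simp_all
    qed
    then show ?case by blast
  qed (auto simp: P_def)
  from this[of d] obtain q idx where *: "(\<forall>k<d. idx k < n)"
    "(\<forall>k<d. \<forall>l<d. inner_Rd d (q k) (q l) = (if k = l then 1 else 0))"
    "(\<forall>k<d. \<forall>y. (\<forall>l\<le>k. inner_Rd d y (q l) = 0) \<longrightarrow> inner_Rd d y (z (idx k)) = 0)"
    "(\<forall>k<d. inner_Rd d (q k) (z (idx k)) > 0 \<and> real (d - k) / real n \<le> (inner_Rd d (q k) (z (idx k)))\<^sup>2)"
    unfolding P_def by blast
  have "inner_Rd d (q l) (z (idx k)) = 0" if "k < d" "l < d" "k < l" for k l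
    using *(2) *(3)[rule_format, OF that(1), of "q l"] that by simp
  with * show ?thesis by blast
qed

section \<open>The bound in isotropic position\<close>

text \<open>Forward substitution: once the earlier coordinates vanish, row \<open>k\<close> reads
  \<open>A k k * x k = 0\<close>.\<close>

lemma triangular_inverse:
  assumes tri: "\<And>i. i < d \<Longrightarrow> A i \<in> Rd (Suc i)" and pos: "\<And>i. i < d \<Longrightarrow> A i i > 0"
  shows "\<exists>N. mutual_inverse d A N"
proof (rule inj_mv_imp_inverse)
  fix x assume x: "x \<in> Rd d" "mv d A x = 0"
  have "x k = 0" if "k < d" for k using that
  proof (induction k rule: less_induct)
    case (less k)
    have "A k j * x j = (if j = k then A k k * x k else 0)" if "j < d" for j
      using tri[OF less.prems] less.IH[of j] that by (auto simp: Rd_def not_less_eq linorder_neq_iff)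
    then have "(\<Sum>j<d. A k j * x j) = (\<Sum>j<d. if j = k then A k k * x k else 0)"
      by (intro sum.cong refl) blast
    also have "\<dots> = A k k * x k" using less.prems by simp
    finally have "(\<Sum>j<d. A k j * x j) = A k k * x k" .
    moreover have "(\<Sum>j<d. A k j * x j) = 0" using x(2) mv_apply[OF less.prems, of A x] by simp
    ultimately show "x k = 0" using pos[OF less.prems] by simp
  qed
  then show "x = 0" using x(1) by (intro Rd_eqI[of _ d]) auto
qed

lemma scales_lower_triangular:
  assumes tri: "\<And>i. i < d \<Longrightarrow> A i \<in> Rd (Suc i)" and pos: "\<And>i. i < d \<Longrightarrow> A i i > 0"
  shows "scales d (mv d A) (1 / (\<Prod>i<d. A i i))"
proof (rule scales_triangular[of "\<lambda>i. i"])
  fix i j :: nat assume "i < j" "j < d"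
  then show "A i j = 0" using tri[of i] by (auto simp: Rd_def)
qed (use pos in \<open>auto simp: bij_betw_def\<close>)

lemma bij_betw_reverse: "bij_betw (\<lambda>i. d - 1 - i) {..<d} {..<d::nat}"
  by (rule bij_betwI[where g = "\<lambda>i. d - 1 - i"]) auto

lemma scales_upper_triangular:
  assumes tri: "\<And>i j. j < i \<Longrightarrow> i < d \<Longrightarrow> R i j = 0" and pos: "\<And>i. i < d \<Longrightarrow> R i i > 0"
  shows "scales d (mv d R) (1 / (\<Prod>i<d. R i i))"
  by (rule scales_triangular[OF bij_betw_reverse]) (use assms in auto)

text \<open>In the orthonormal frame \<open>q\<close> the vectors \<open>A (u k)\<close> are the
  columns of an upper triangular matrix \<open>R\<close>. It maps the standard simplex, of volume
  \<open>1 / fact d\<close>, into the image of \<open>K - w\<close> under \<open>A\<close> and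
  \<open>q\<close>, whose volume is the product of the \<open>A k k\<close>.\<close>

lemma simplex_volume_bound:
  assumes K: "K \<in> sets borel" "emeasure (vol_Rd d) K = 1" and w: "w \<in> Rd d"
    and sub: "\<And>x. x \<in> std_simplex d \<Longrightarrow> (\<Sum>j<d. x j *\<^sub>R u j) + w \<in> K"
    and u: "\<And>j. j < d \<Longrightarrow> u j \<in> Rd d"
    and tri: "\<And>i. i < d \<Longrightarrow> A i \<in> Rd (Suc i)" "\<And>i. i < d \<Longrightarrow> A i i > 0"
    and q: "\<And>k l. k < d \<Longrightarrow> l < d \<Longrightarrow> inner_Rd d (q k) (q l) = (if k = l then 1 else 0)"
    and upper: "\<And>k l. k < l \<Longrightarrow> l < d \<Longrightarrow> inner_Rd d (q l) (mv d A (u k)) = 0"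
    and pos: "\<And>k. k < d \<Longrightarrow> inner_Rd d (q k) (mv d A (u k)) > 0"
  shows "(\<Prod>k<d. inner_Rd d (q k) (mv d A (u k))) \<le> fact d * (\<Prod>k<d. A k k)"
proof -
  note [measurable] = K(1)
  define a where "a = (\<Prod>k<d. A k k)"
  have a0: "a > 0" unfolding a_def by (intro prod_pos) (use tri in auto)
  define R where "R = (\<lambda>l k. inner_Rd d (q l) (mv d A (u k)))"
  define \<rho> where "\<rho> = (\<Prod>k<d. R k k)"
  have \<rho>0: "\<rho> > 0" unfolding \<rho>_def R_def by (intro prod_pos) (use pos in auto)
  define \<Phi> where "\<Phi> = (\<lambda>x. mv d q (mv d A x))"
  have sq: "scales d (mv d q) (1 / 1 ^ d)" by (rule orthogonal_scales) (use q in auto)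
  have s\<Phi>: "scales d \<Phi> (1 / a)"
    using scales_comp[OF sq scales_lower_triangular[OF tri]] by (simp add: \<Phi>_def a_def)
  have sR: "scales d (mv d R) (1 / \<rho>)"
    unfolding \<rho>_def by (rule scales_upper_triangular) (use upper pos in \<open>auto simp: R_def\<close>)
  obtain N where N: "mutual_inverse d A N" using triangular_inverse[OF tri] by blast
  have "mutual_inverse d q (\<lambda>i j. tr q i j / 1\<^sup>2)" by (rule orthogonal_inverse) (use q in auto)
  then obtain Q' where Q': "mutual_inverse d q Q'" by blast
  define \<Psi> where "\<Psi> = (\<lambda>x. mv d N (mv d Q' x))"
  have \<Psi>: "\<Psi> (\<Phi> x) = x" if "x \<in> Rd d" for x
    using N Q' that by (simp add: mutual_inverse_def \<Psi>_def \<Phi>_def)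
  have R\<Phi>: "mv d R x = \<Phi> (\<Sum>j<d. x j *\<^sub>R u j)" for x
  proof (rule Rd_eqI[of _ d])
    fix i assume i: "i < d"
    have "mv d R x i = (\<Sum>k<d. inner_Rd d (q i) (mv d A (u k)) * x k)"
      by (simp add: mv_apply[OF i] R_def)
    also have "\<dots> = \<Phi> (\<Sum>j<d. x j *\<^sub>R u j) i"
      by (simp add: \<Phi>_def mv_sum mv_scaleR sum_fun_apply mv_inner[OF i] mult.commute)
    finally show "mv d R x i = \<Phi> (\<Sum>j<d. x j *\<^sub>R u j) i" .
  qed (auto simp: \<Phi>_def)
  \<comment> \<open>On \<open>Rd d\<close> this is the indicator of the image of
    \<open>K - w\<close> under \<open>\<Phi>\<close>, written through the inverse map so that it is
    visibly measurable.\<close>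
  define h where "h = (\<lambda>y. indicator K (\<Psi> y + w) :: ennreal)"
  have [measurable]: "h \<in> borel_measurable borel" unfolding h_def \<Psi>_def by measurable
  have "(\<integral>\<^sup>+x. h (\<Phi> x) \<partial>vol_Rd d) = (\<integral>\<^sup>+x. indicator K (x + w) \<partial>vol_Rd d)"
    using AE_vol_Rd[of d] by (intro nn_integral_cong_AE) (auto elim!: eventually_mono simp: h_def \<Psi>)
  also have "\<dots> = 1" by (subst vol_Rd_translation[OF w]) (use K in auto)
  finally have "1 = ennreal (1 / a) * (\<integral>\<^sup>+x. h x \<partial>vol_Rd d)"
    using scales_nn[OF s\<Phi>, of h] by simp
  then have "ennreal a * 1 = ennreal a * (ennreal (1 / a) * (\<integral>\<^sup>+x. h x \<partial>vol_Rd d))" by simp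
  then have int_h: "(\<integral>\<^sup>+x. h x \<partial>vol_Rd d) = ennreal a"
    using a0 by (simp add: mult.assoc[symmetric] ennreal_mult[symmetric])
  have "ennreal (1 / fact d) = (\<integral>\<^sup>+x. indicator (std_simplex d) x \<partial>vol_Rd d)"
    by (simp add: emeasure_std_simplex)
  also have "\<dots> \<le> (\<integral>\<^sup>+x. h (mv d R x) \<partial>vol_Rd d)"
  proof (rule nn_integral_mono)
    fix x
    have "(\<Sum>j<d. x j *\<^sub>R u j) \<in> Rd d" by (intro Rd_sum Rd_scaleR u) simp
    then show "indicator (std_simplex d) x \<le> h (mv d R x)"
      using sub[of x] by (auto simp: h_def R\<Phi> \<Psi> indicator_def)
  qed
  also have "\<dots> = ennreal (1 / \<rho>) * ennreal a" using scales_nn[OF sR, of h] int_h by simp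
  also have "\<dots> = ennreal (a / \<rho>)" using a0 \<rho>0 by (simp add: ennreal_mult[symmetric])
  finally have "1 / fact d \<le> a / \<rho>" using a0 \<rho>0 by (simp add: ennreal_le_iff)
  then show ?thesis using \<rho>0 by (simp add: field_simps \<rho>_def a_def R_def)
qed

section \<open>Integrals over compact sets and isotropic moments\<close>

lemma emeasure_compact_finite:
  assumes "compact K"
  shows "emeasure (vol_Rd d) K < \<infinity>"
proof -
  have "\<exists>B. \<forall>x\<in>K. \<bar>x i\<bar> \<le> B" for i
    using compact_imp_bounded[OF compact_continuous_image[OF continuous_coord assms, of i]]
    by (auto simp: bounded_iff)
  then obtain B where B: "\<And>i x. x \<in> K \<Longrightarrow> \<bar>x i\<bar> \<le> B i" by metis
  have "emeasure (vol_Rd d) K \<le> emeasure (vol_Rd d) {x. \<forall>i<d. - \<bar>B i\<bar> \<le> x i \<and> x i \<le> \<bar>B i\<bar>}"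
  proof (rule emeasure_mono)
    show "K \<subseteq> {x. \<forall>i<d. - \<bar>B i\<bar> \<le> x i \<and> x i \<le> \<bar>B i\<bar>}"
    proof (intro subsetI CollectI allI impI)
      fix x i assume "x \<in> K"
      then have "\<bar>x i\<bar> \<le> \<bar>B i\<bar>" using B by (metis abs_ge_self order_trans)
      then show "- \<bar>B i\<bar> \<le> x i \<and> x i \<le> \<bar>B i\<bar>" by (simp only: abs_le_iff minus_le_iff)
    qed
  qed simp
  also have "\<dots> < \<infinity>" by (subst emeasure_vol_cbox) auto
  finally show ?thesis .
qed

lemma compact_borel: "compact K \<Longrightarrow> K \<in> sets borel" for K :: "(nat \<Rightarrow> real) set"
  by (intro borel_closed compact_imp_closed)

lemma set_integrable_compact:
  fixes f :: "(nat \<Rightarrow> real) \<Rightarrow> real"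
  assumes K: "compact K" and f: "continuous_on UNIV f"
  shows "set_integrable (vol_Rd d) K f"
proof -
  obtain B where B: "\<forall>x\<in>K. norm (f x) \<le> B"
    using compact_imp_bounded[OF compact_continuous_image[OF continuous_on_subset[OF f] K]] by (auto simp: bounded_iff)
  have "f \<in> borel_measurable borel" using f by (rule borel_measurable_continuous_onI)
  then show ?thesis unfolding set_integrable_def
    by (intro integrableI_bounded_set_indicator[where B = B])
      (use B K emeasure_compact_finite[OF K] compact_borel[OF K] in auto)
qed

lemma continuous_inner_Rd [continuous_intros]: "continuous_on S (\<lambda>x. inner_Rd d \<phi> x)"
  unfolding inner_Rd_def by (intro continuous_intros)

lemma set_integral_inner:
  assumes "compact K" "\<And>i. i < d \<Longrightarrow> (LINT x:K|vol_Rd d. x i) = 0"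
  shows "(LINT x:K|vol_Rd d. inner_Rd d \<phi> x) = 0"
proof -
  have "(LINT x:K|vol_Rd d. inner_Rd d \<phi> x) = (\<Sum>i<d. \<phi> i * (LINT x:K|vol_Rd d. x i))"
  proof -
    have int: "integrable (vol_Rd d) (\<lambda>x. indicator K x *\<^sub>R (\<phi> i * x i))" for i
    proof -
      have "continuous_on UNIV (\<lambda>x. \<phi> i * x i)" by (intro continuous_intros)
      from set_integrable_compact[OF assms(1) this] show ?thesis by (simp add: set_integrable_def)
    qed
    show ?thesis
      unfolding set_lebesgue_integral_def inner_Rd_def scaleR_sum_right
      by (subst Bochner_Integration.integral_sum[OF int]) (simp add: mult.left_commute)
  qed
  then show ?thesis using assms(2) by simp
qed

lemma isotropic_inner_square:
  assumes "isotropic_with d K L" "\<phi> \<in> Rd d"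
  shows "(LINT x:K|vol_Rd d. (inner_Rd d \<phi> x)\<^sup>2) = L\<^sup>2 * inner_Rd d \<phi> \<phi>"
proof (cases "\<phi> = 0")
  case True
  then show ?thesis by (simp add: inner_Rd_def)
next
  case False
  define s where "s = sqrt (inner_Rd d \<phi> \<phi>)"
  have s: "s > 0" "s\<^sup>2 = inner_Rd d \<phi> \<phi>" using inner_Rd_self_pos[OF assms(2) False] by (auto simp: s_def)
  define \<theta> where "\<theta> = (1 / s) *\<^sub>R \<phi>"
  have "inner_Rd d \<theta> \<theta> = 1"
    using s by (simp add: \<theta>_def inner_Rd_scaleR inner_Rd_scaleR_right s(2)[symmetric] power2_eq_square)
  then have "\<theta> \<in> sphere_Rd d" using assms(2) by (auto simp: sphere_Rd_def \<theta>_def)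
  then have "(LINT x:K|vol_Rd d. (inner_Rd d x \<theta>)\<^sup>2) = L\<^sup>2" using assms(1) by (auto simp: isotropic_with_def)
  moreover have "inner_Rd d \<phi> x = s * inner_Rd d x \<theta>" for x
    using s(1) by (simp add: \<theta>_def inner_Rd_scaleR_right inner_Rd_commute[of d x])
  then have "(inner_Rd d \<phi> x)\<^sup>2 = s\<^sup>2 * (inner_Rd d x \<theta>)\<^sup>2" for x by (simp only: power_mult_distrib)
  then have "(LINT x:K|vol_Rd d. (inner_Rd d \<phi> x)\<^sup>2) = s\<^sup>2 * (LINT x:K|vol_Rd d. (inner_Rd d x \<theta>)\<^sup>2)"
    by (simp only: set_integral_mult_right)
  ultimately show ?thesis by (simp only: s(2) mult.commute)
qed

text \<open>Parallel axis identity: the cross term vanishes because the barycenter is the origin,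
  and the constant term is multiplied by the volume 1.\<close>

lemma isotropic_second_moment:
  assumes iso: "isotropic_with d K L" and \<phi>: "\<phi> \<in> Rd d"
  shows "(LINT x:K|vol_Rd d. (inner_Rd d \<phi> (x - w))\<^sup>2) = L\<^sup>2 * inner_Rd d \<phi> \<phi> + (inner_Rd d \<phi> w)\<^sup>2"
proof -
  have K: "compact K" "emeasure (vol_Rd d) K = 1" "\<And>i. i < d \<Longrightarrow> (LINT x:K|vol_Rd d. x i) = 0"
    using iso by (auto simp: isotropic_with_def convex_body_def)
  define c where "c = inner_Rd d \<phi> w"
  have ints: "set_integrable (vol_Rd d) K (\<lambda>x. (inner_Rd d \<phi> x)\<^sup>2)" "set_integrable (vol_Rd d) K (\<lambda>x. (- 2 * c) * inner_Rd d \<phi> x)"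
    "set_integrable (vol_Rd d) K (\<lambda>x. c\<^sup>2)"
    by (intro set_integrable_compact[OF K(1)] continuous_intros)+
  have "(inner_Rd d \<phi> (x - w))\<^sup>2 = (inner_Rd d \<phi> x)\<^sup>2 + (- 2 * c) * inner_Rd d \<phi> x + c\<^sup>2" for x
    by (simp add: inner_Rd_diff_right c_def power2_diff)
  then have "(LINT x:K|vol_Rd d. (inner_Rd d \<phi> (x - w))\<^sup>2) =
    (LINT x:K|vol_Rd d. (inner_Rd d \<phi> x)\<^sup>2) + (LINT x:K|vol_Rd d. (- 2 * c) * inner_Rd d \<phi> x) + (LINT x:K|vol_Rd d. c\<^sup>2)"
    using set_integral_add[OF set_integral_add(1)[OF ints(1,2)] ints(3)] set_integral_add(2)[OF ints(1,2)] by simp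
  also have "(LINT x:K|vol_Rd d. (- 2 * c) * inner_Rd d \<phi> x) = 0"
    using set_integral_inner[OF K(1,3)] by (simp only: set_integral_mult_right mult_zero_right)
  also have "(LINT x:K|vol_Rd d. c\<^sup>2) = c\<^sup>2"
    using K(2) compact_borel[OF K(1)] by (simp add: set_lebesgue_integral_def measure_def)
  finally show ?thesis by (simp only: isotropic_inner_square[OF assms] c_def add_0_right)
qed

lemma simplex_combination_in_ihull:
  assumes x: "x \<in> std_simplex d" and b: "b < n" and idx: "\<And>j. j < d \<Longrightarrow> idx j < n"
  shows "(1 - (\<Sum>j<d. x j)) *\<^sub>R v b + (\<Sum>j<d. x j *\<^sub>R v (idx j)) \<in> ihull v {..<n}"
proof -
  let ?c = "\<lambda>j. if j < d then x j else 1 - (\<Sum>j<d. x j)"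
  let ?y = "\<lambda>j. if j < d then v (idx j) else v b"
  have "(\<Sum>j<Suc d. ?c j *\<^sub>R ?y j) \<in> convex hull (v ` {..<n})"
    using x idx b by (intro convex_sum convex_convex_hull)
      (auto simp: std_simplex_def intro!: hull_inc)
  also have "(\<Sum>j<Suc d. ?c j *\<^sub>R ?y j) = (1 - (\<Sum>j<d. x j)) *\<^sub>R v b + (\<Sum>j<d. x j *\<^sub>R v (idx j))"
    by (simp add: add.commute)
  finally show ?thesis unfolding ihull_eq_convex_hull[OF finite_lessThan] .
qed

lemma isotropic_polytope_bound:
  assumes iso: "isotropic_with d (ihull v {..<n}) L" and v: "\<And>i. i < n \<Longrightarrow> v i \<in> Rd d" and d: "d > 0"
  shows "L\<^sup>2 \<le> 2 * (real n / real d)"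
proof -
  let ?K = "ihull v {..<n}"
  have K: "compact ?K" "emeasure (vol_Rd d) ?K = 1" using iso by (auto simp: isotropic_with_def convex_body_def)
  have Kb: "?K \<in> sets borel" by (rule compact_borel[OF K(1)])
  have n: "n > 0"
  proof (rule ccontr)
    assume "\<not> n > 0"
    then have "?K = {}" by (simp add: ihull_def)
    then show False using K(2) by simp
  qed
  define w where "w = v 0"
  have w: "w \<in> Rd d" using v n by (simp add: w_def)
  \<comment> \<open>The scatter form of the points about \<open>w\<close>. If it vanished at a
    nonzero \<open>\<phi>\<close>, all points and hence the hull would lie in a hyperplane,
    contradicting volume 1.\<close>
  define b where "b = (\<lambda>\<phi> \<psi>. \<Sum>i<n. inner_Rd d \<phi> (v i - w) * inner_Rd d \<psi> (v i - w))"
  have "\<exists>A. (\<forall>i<d. A i \<in> Rd (Suc i) \<and> A i i > 0) \<and>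
    (\<forall>i<d. \<forall>j<d. b (A i) (A j) = (if i = j then 1 else 0))"
  proof (rule gram_schmidt)
    show "linear (\<lambda>x. b x y)" for y
      by (rule linearI) (auto simp: b_def inner_Rd_add inner_Rd_scaleR algebra_simps sum.distrib sum_distrib_left)
    show "b x y = b y x" for x y by (simp add: b_def mult.commute)
    fix \<phi> assume \<phi>: "\<phi> \<in> Rd d" "\<phi> \<noteq> 0"
    show "b \<phi> \<phi> > 0"
    proof (rule ccontr)
      assume "\<not> b \<phi> \<phi> > 0"
      moreover have "b \<phi> \<phi> \<ge> 0" by (simp add: b_def sum_nonneg)
      ultimately have "b \<phi> \<phi> = 0" by simp
      then have "\<forall>i\<in>{..<n}. inner_Rd d \<phi> (v i - w) * inner_Rd d \<phi> (v i - w) = 0"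
        unfolding b_def by (subst (asm) sum_nonneg_eq_0_iff) auto
      then have "inner_Rd d \<phi> (v i) = inner_Rd d \<phi> w" if "i < n" for i
        using that by (simp add: inner_Rd_diff_right)
      then have flat: "inner_Rd d \<phi> x = inner_Rd d \<phi> w" if "x \<in> ?K" for x
        using that by (auto simp: ihull_def inner_Rd_sum sum_distrib_right[symmetric])
      have "AE x in vol_Rd d. x \<notin> ?K"
        using AE_hyperplane[OF \<phi>, of "inner_Rd d \<phi> w"] flat by (auto elim!: eventually_mono)
      then have "emeasure (vol_Rd d) {x \<in> space (vol_Rd d). x \<in> ?K} = 0" by (rule emeasure_eq_0_AE)
      then show False using K(2) by simp
    qed
  qed
  then obtain A where tri: "\<And>i. i < d \<Longrightarrow> A i \<in> Rd (Suc i)" "\<And>i. i < d \<Longrightarrow> A i i > 0"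
    and orth: "\<And>k l. k < d \<Longrightarrow> l < d \<Longrightarrow> b (A k) (A l) = (if k = l then 1 else 0)" by blast
  have AR: "A k \<in> Rd d" if "k < d" for k using tri(1)[OF that] that by (auto simp: Rd_def)
  define z where "z = (\<lambda>i. mv d A (v i - w))"
  have zin: "z i \<in> Rd d" for i by (simp add: z_def)
  have zorth: "(\<Sum>i<n. z i k * z i l) = (if k = l then 1 else 0)" if "k < d" "l < d" for k l
    using orth[OF that] that by (simp add: z_def mv_inner b_def)
  obtain q idx where idx: "\<forall>k<d. idx k < n"
    and q: "\<forall>k<d. \<forall>l<d. inner_Rd d (q k) (q l) = (if k = l then 1 else 0)"
    and upper: "\<forall>k<d. \<forall>l<d. k < l \<longrightarrow> inner_Rd d (q l) (z (idx k)) = 0"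
    and big: "\<forall>k<d. inner_Rd d (q k) (z (idx k)) > 0 \<and> real (d - k) / real n \<le> (inner_Rd d (q k) (z (idx k)))\<^sup>2"
    using greedy_orthonormal[of n z d, OF zin zorth] by blast
  define a where "a = (\<Prod>k<d. A k k)"
  have a0: "a > 0" unfolding a_def by (intro prod_pos) (use tri in auto)
  define \<rho> where "\<rho> = (\<Prod>k<d. inner_Rd d (q k) (z (idx k)))"
  have "\<rho> \<le> fact d * a"
    unfolding \<rho>_def a_def z_def
  proof (rule simplex_volume_bound[OF Kb K(2) w _ _ tri])
    fix x assume x: "x \<in> std_simplex d"
    have "(\<Sum>j<d. x j *\<^sub>R (v (idx j) - w)) + w = (1 - (\<Sum>j<d. x j)) *\<^sub>R v 0 + (\<Sum>j<d. x j *\<^sub>R v (idx j))"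
      by (simp add: w_def scaleR_diff_right sum_subtractf scaleR_diff_left scaleR_sum_left)
    also have "\<dots> \<in> ?K" using idx n by (intro simplex_combination_in_ihull[OF x]) auto
    finally show "(\<Sum>j<d. x j *\<^sub>R (v (idx j) - w)) + w \<in> ?K" .
  next
    show "v (idx j) - w \<in> Rd d" if "j < d" for j using idx v w that by auto
  qed (use q upper big in \<open>auto simp: z_def\<close>)
  moreover have "\<rho> > 0" unfolding \<rho>_def by (intro prod_pos) (use big in auto)
  ultimately have "\<rho>\<^sup>2 \<le> (fact d * a)\<^sup>2" by (intro power_mono) auto
  moreover have "fact d / real n ^ d \<le> \<rho>\<^sup>2"
  proof -
    have "fact d / real n ^ d = (\<Prod>k<d. real (d - k) / real n)"
      by (simp add: fact_prod_rev prod_dividef atLeast0LessThan)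
    also have "\<dots> \<le> (\<Prod>k<d. (inner_Rd d (q k) (z (idx k)))\<^sup>2)"
      using big by (intro prod_mono) auto
    also have "\<dots> = \<rho>\<^sup>2" by (simp add: \<rho>_def prod_power_distrib)
    finally show ?thesis .
  qed
  ultimately have "fact d / real n ^ d \<le> (fact d)\<^sup>2 * a\<^sup>2" by (simp add: power_mult_distrib)
  then have "fact d * (1 / real n ^ d) \<le> fact d * (fact d * a\<^sup>2)" by (simp add: power2_eq_square mult.assoc)
  then have "1 / real n ^ d \<le> fact d * a\<^sup>2" by (simp only: mult_le_cancel_left_pos[OF fact_gt_zero])
  \<comment> \<open>Replacing \<open>fact d\<close> by \<open>d ^ d\<close> gives an explicit root
    of order \<open>d\<close>; the loss in that root is at most a constant factor.\<close>
  also have "\<dots> \<le> real d ^ d * a\<^sup>2"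
    using fact_le_power[where n = d and 'a = real] by (intro mult_right_mono) auto
  finally have a2: "(1 / (real d * real n)) ^ d \<le> a\<^sup>2"
    using d n by (simp add: power_divide power_mult_distrib field_simps)
  have "1 / (real d * real n) = ((1 / (real d * real n)) ^ d) powr (1 / d)"
    using d n by (simp add: powr_realpow[symmetric] powr_powr)
  also have "\<dots> \<le> (a\<^sup>2) powr (1 / d)" using a2 by (intro powr_mono2) auto
  also have "a\<^sup>2 = (\<Prod>k<d. (A k k)\<^sup>2)" by (simp add: a_def prod_power_distrib)
  also have "(\<Prod>k<d. (A k k)\<^sup>2) powr (1 / d) \<le> (\<Sum>k<d. (A k k)\<^sup>2 / d)"
    using arith_geom_mean[of "{..<d}" "\<lambda>k. (A k k)\<^sup>2"] d by auto
  also have "\<dots> = (\<Sum>k<d. (A k k)\<^sup>2) / d" by (simp add: sum_divide_distrib)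
  finally have hs: "1 / real n \<le> (\<Sum>k<d. (A k k)\<^sup>2)"
    using d n by (simp add: field_simps)
  define f where "f = (\<lambda>x. \<Sum>k<d. (inner_Rd d (A k) (x - w))\<^sup>2)"
  have fi: "set_integrable (vol_Rd d) ?K (\<lambda>x. (inner_Rd d (A k) (x - w))\<^sup>2)" for k
    by (rule set_integrable_compact[OF K(1)]) (simp add: inner_Rd_diff_right continuous_intros)
  have ffi: "set_integrable (vol_Rd d) ?K f"
    using fi unfolding f_def set_integrable_def scaleR_sum_right by (intro Bochner_Integration.integrable_sum) auto
  have "(LINT x:?K|vol_Rd d. f x) = (\<Sum>k<d. LINT x:?K|vol_Rd d. (inner_Rd d (A k) (x - w))\<^sup>2)"
    using fi unfolding f_def set_lebesgue_integral_def set_integrable_def scaleR_sum_right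
    by (intro Bochner_Integration.integral_sum) auto
  also have "\<dots> \<ge> (\<Sum>k<d. L\<^sup>2 * (A k k)\<^sup>2)"
  proof (rule sum_mono)
    fix k assume k: "k \<in> {..<d}"
    \<comment> \<open>Only the diagonal entry of row \<open>k\<close> is kept, since AM-GM controls
      nothing else; the shift term in \<open>w\<close> is dropped as nonnegative.\<close>
    have "A k k * A k k \<le> inner_Rd d (A k) (A k)"
      unfolding inner_Rd_def using k by (intro member_le_sum[of k "{..<d}" "\<lambda>i. A k i * A k i"]) auto
    then have "L\<^sup>2 * (A k k)\<^sup>2 \<le> L\<^sup>2 * inner_Rd d (A k) (A k)"
      by (intro mult_left_mono) (auto simp: power2_eq_square)
    then have "L\<^sup>2 * (A k k)\<^sup>2 \<le> L\<^sup>2 * inner_Rd d (A k) (A k) + (inner_Rd d (A k) w)\<^sup>2"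
      by (rule order_trans) simp
    also have "\<dots> = (LINT x:?K|vol_Rd d. (inner_Rd d (A k) (x - w))\<^sup>2)"
      using k by (intro isotropic_second_moment[OF iso AR, symmetric]) simp
    finally show "L\<^sup>2 * (A k k)\<^sup>2 \<le> (LINT x:?K|vol_Rd d. (inner_Rd d (A k) (x - w))\<^sup>2)" .
  qed
  finally have low: "L\<^sup>2 * (1 / real n) \<le> (LINT x:?K|vol_Rd d. f x)"
    using mult_left_mono[OF hs, of "L\<^sup>2"] by (simp add: sum_distrib_left)
  have f0: "0 \<le> f x" for x by (simp add: f_def sum_nonneg)
  have "ennreal (LINT x:?K|vol_Rd d. f x) = (\<integral>\<^sup>+x. ennreal (indicator ?K x *\<^sub>R f x) \<partial>vol_Rd d)"
    unfolding set_lebesgue_integral_def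
    by (rule nn_integral_eq_integral[symmetric]) (use ffi f0 in \<open>auto simp: set_integrable_def\<close>)
  also have "\<dots> = (\<integral>\<^sup>+x. ennreal (f x) * indicator ?K x \<partial>vol_Rd d)"
    by (intro nn_integral_cong) (auto simp: indicator_def)
  also have "\<dots> \<le> ennreal ((2 * real d + 1) / ((real d + 1) * (real d + 2)))"
    using second_moment_bound[of n v d A w, OF v orth[unfolded b_def]] K(2) by (simp add: f_def)
  finally have "(LINT x:?K|vol_Rd d. f x) \<le> (2 * real d + 1) / ((real d + 1) * (real d + 2))"
    by (subst (asm) ennreal_le_iff) auto
  also have "\<dots> \<le> 2 * (real d + 1) / ((real d + 1) * (real d + 2))" by (intro divide_right_mono) auto
  also have "\<dots> = 2 / (real d + 2)" by (simp add: divide_simps)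
  also have "\<dots> \<le> 2 / real d" using d by (intro divide_left_mono) auto
  finally have "L\<^sup>2 * (1 / real n) \<le> 2 / real d" using low by (rule order_trans[rotated])
  then show ?thesis using n d by (simp add: field_simps)
qed

section \<open>Existence and uniqueness of the isotropic position\<close>

lemma mutual_inverseD:
  assumes "mutual_inverse d M N" "x \<in> Rd d"
  shows "mv d M (mv d N x) = x" "mv d N (mv d M x) = x"
  using assms by (auto simp: mutual_inverse_def)

lemma mutual_inverse_comp:
  assumes M: "mutual_inverse d M M'" and N: "mutual_inverse d N N'"
  shows "\<exists>P P'. mutual_inverse d P P' \<and> (\<forall>x\<in>Rd d. mv d P x = mv d M (mv d N x))"
proof -
  have lin: "\<exists>P. \<forall>x\<in>Rd d. mv d P x = mv d A (mv d B x)" for A B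
    using linear_eq_mv[OF linear_compose[OF linear_mv[of d B] linear_mv[of d A]], of d] by fastforce
  obtain P where P: "\<And>x. x \<in> Rd d \<Longrightarrow> mv d P x = mv d M (mv d N x)" using lin[of M N] by blast
  obtain P' where P': "\<And>x. x \<in> Rd d \<Longrightarrow> mv d P' x = mv d N' (mv d M' x)" using lin[of N' M'] by blast
  have "mutual_inverse d P P'"
    unfolding mutual_inverse_def
    by (simp add: P P' mutual_inverseD[OF M] mutual_inverseD[OF N])
  with P show ?thesis by blast
qed

lemma invertible_affine_matrix:
  assumes "invertible_affine d T"
  shows "\<exists>M N b. mutual_inverse d M N \<and> b \<in> Rd d \<and> (\<forall>x\<in>Rd d. T x = mv d M x + b)"
proof -
  obtain A b where A: "linear A" "bij_betw A (Rd d) (Rd d)" and b: "b \<in> Rd d" "T = (\<lambda>x. A x + b)"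
    using assms by (auto simp: invertible_affine_def)
  have AR: "A x \<in> Rd d" if "x \<in> Rd d" for x using A(2) that by (auto simp: bij_betw_def)
  define M where "M = (\<lambda>i j. A (axis_Rd j) i)"
  have M: "A x = mv d M x" if "x \<in> Rd d" for x
    unfolding M_def by (rule linear_eq_mv[OF A(1) AR that])
  have "\<exists>N. mutual_inverse d M N"
  proof (rule inj_mv_imp_inverse)
    fix x assume x: "x \<in> Rd d" "mv d M x = 0"
    then have "A x = A 0" using M linear_0[OF A(1)] by simp
    then show "x = 0" using A(2) x(1) by (auto simp: bij_betw_def inj_on_def)
  qed
  with b M show ?thesis by auto
qed

lemma invertible_affineI:
  assumes "mutual_inverse d M N" "b \<in> Rd d"
  shows "invertible_affine d (\<lambda>x. mv d M x + b)"
proof -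
  have "bij_betw (mv d M) (Rd d) (Rd d)"
    by (rule bij_betwI[where g = "mv d N"]) (auto simp: mutual_inverseD[OF assms(1)])
  then show ?thesis using linear_mv assms(2) unfolding invertible_affine_def by blast
qed

lemma image_ihull:
  assumes T: "\<And>x. x \<in> Rd d \<Longrightarrow> T x = mv d M x + b" and v: "\<And>i. i < n \<Longrightarrow> v i \<in> Rd d"
  shows "T ` ihull v {..<n} = ihull (\<lambda>i. T (v i)) {..<n}"
proof -
  have eq: "T (\<Sum>i<n. l i *\<^sub>R v i) = (\<Sum>i<n. l i *\<^sub>R T (v i))" if "sum l {..<n} = 1" for l
  proof -
    have "(\<Sum>i<n. l i *\<^sub>R v i) \<in> Rd d" using v by (intro Rd_sum Rd_scaleR) auto
    then have "T (\<Sum>i<n. l i *\<^sub>R v i) = (\<Sum>i<n. l i *\<^sub>R mv d M (v i)) + (\<Sum>i<n. l i *\<^sub>R b)"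
      using that by (simp add: T mv_sum mv_scaleR scaleR_sum_left[symmetric])
    also have "\<dots> = (\<Sum>i<n. l i *\<^sub>R T (v i))"
      using v by (simp add: T scaleR_add_right sum.distrib)
    finally show ?thesis .
  qed
  show ?thesis
  proof (intro equalityI subsetI)
    fix y assume "y \<in> T ` ihull v {..<n}"
    then obtain l where l: "\<forall>i\<in>{..<n}. 0 \<le> l i" "sum l {..<n} = 1" "y = T (\<Sum>i<n. l i *\<^sub>R v i)"
      by (auto simp: ihull_def)
    then show "y \<in> ihull (\<lambda>i. T (v i)) {..<n}"
      using eq[OF l(2)] by (intro ihullI[of _ l]) auto
  next
    fix y assume "y \<in> ihull (\<lambda>i. T (v i)) {..<n}"
    then obtain l where l: "\<forall>i\<in>{..<n}. 0 \<le> l i" "sum l {..<n} = 1" "y = (\<Sum>i<n. l i *\<^sub>R T (v i))"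
      by (auto simp: ihull_def)
    show "y \<in> T ` ihull v {..<n}"
    proof (rule image_eqI)
      show "y = T (\<Sum>i<n. l i *\<^sub>R v i)" using eq[OF l(2)] l(3) by simp
      show "(\<Sum>i<n. l i *\<^sub>R v i) \<in> ihull v {..<n}" using l by (intro ihullI[of _ l]) auto
    qed
  qed
qed

text \<open>An affinely invariant certificate of full dimension; it yields both positive volume and
  an interior point relative to \<open>Rd d\<close>.\<close>

definition contains_simplex :: "nat \<Rightarrow> (nat \<Rightarrow> real) set \<Rightarrow> bool"
  where "contains_simplex d K \<longleftrightarrow>
    (\<exists>M N b. mutual_inverse d M N \<and> b \<in> Rd d \<and> (\<forall>x\<in>std_simplex d. mv d M x + b \<in> K))"

lemma contains_simplex_affine:
  assumes K: "contains_simplex d K" and M: "mutual_inverse d M N" and b: "b \<in> Rd d"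
    and T: "\<And>x. x \<in> Rd d \<Longrightarrow> T x = mv d M x + b"
  shows "contains_simplex d (T ` K)"
proof -
  obtain M' N' b' where M': "mutual_inverse d M' N'" "b' \<in> Rd d" "\<And>x. x \<in> std_simplex d \<Longrightarrow> mv d M' x + b' \<in> K"
    using K by (auto simp: contains_simplex_def)
  obtain P P' where P: "mutual_inverse d P P'" "\<And>x. x \<in> Rd d \<Longrightarrow> mv d P x = mv d M (mv d M' x)"
    using mutual_inverse_comp[OF M M'(1)] by blast
  have "mv d P x + T b' \<in> T ` K" if x: "x \<in> std_simplex d" for x
  proof (rule image_eqI[OF _ M'(3)[OF x]])
    have "x \<in> Rd d" using x by (simp add: std_simplex_def)
    moreover have "mv d M' x + b' \<in> Rd d" using M'(2) by auto
    ultimately show "mv d P x + T b' = T (mv d M' x + b')"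
      using M'(2) by (simp add: T P(2) mv_add add.assoc)
  qed
  moreover have "T b' \<in> Rd d" using T[OF M'(2)] b by auto
  ultimately show ?thesis using P(1) unfolding contains_simplex_def by blast
qed

lemma contains_simplex_emeasure:
  assumes "contains_simplex d K" "K \<in> sets borel"
  shows "emeasure (vol_Rd d) K > 0"
proof -
  obtain M N b where M: "mutual_inverse d M N" "b \<in> Rd d" "\<forall>x\<in>std_simplex d. mv d M x + b \<in> K"
    using assms(1) by (auto simp: contains_simplex_def)
  obtain c where "scales d (mv d M) c" using scales_exists[OF M(1)] by blast
  then have c: "scales d (\<lambda>x. mv d M x + b) c" using scales_comp[OF scales_translation[OF M(2)]] by simp
  have "0 < emeasure (vol_Rd d) (std_simplex d)" by (simp add: emeasure_std_simplex)
  also have "\<dots> \<le> emeasure (vol_Rd d) ((\<lambda>x. mv d M x + b) -` K)"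
    using M(3) measurable_sets_borel[OF scales_measurable[OF c] assms(2)] by (intro emeasure_mono) auto
  finally show ?thesis unfolding scales_emeasure[OF c assms(2)] by (simp add: ennreal_zero_less_mult_iff)
qed

lemma contains_simplex_interior:
  assumes "contains_simplex d K"
  shows "top_of_set (Rd d) interior_of K \<noteq> {}"
proof -
  obtain M N b where M: "mutual_inverse d M N" "b \<in> Rd d" "\<forall>x\<in>std_simplex d. mv d M x + b \<in> K"
    using assms by (auto simp: contains_simplex_def)
  \<comment> \<open>The standard coordinates of \<open>x\<close>, that is, \<open>N (x - b)\<close>.
    In them the strict simplex inequalities describe an open set.\<close>
  define G where "G = (\<lambda>x i. mv d N x i - mv d N b i)"
  define O' where "O' = {x. (\<forall>i\<in>{..<d}. 0 < G x i) \<and> (\<Sum>i<d. G x i) < 1}"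
  have cG: "continuous_on UNIV (\<lambda>x. G x i)" for i
    unfolding G_def
    by (intro continuous_intros continuous_on_product_then_coordinatewise[OF continuous_mv])
  have "open ((\<Inter>i\<in>{..<d}. {x. 0 < G x i}) \<inter> {x. (\<Sum>i<d. G x i) < 1})"
    by (intro open_Int open_INT ballI open_Collect_less continuous_intros cG) auto
  also have "(\<Inter>i\<in>{..<d}. {x. 0 < G x i}) \<inter> {x. (\<Sum>i<d. G x i) < 1} = O'"
    by (auto simp: O'_def)
  finally have op: "openin (top_of_set (Rd d)) (Rd d \<inter> O')" by (rule openin_open_Int)
  have sub: "Rd d \<inter> O' \<subseteq> K"
  proof
    fix x assume x: "x \<in> Rd d \<inter> O'"
    define y where "y = mv d N (x - b)"
    have yG: "y i = G x i" for i by (simp add: y_def G_def mv_diff)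
    have "y \<in> Rd d" by (simp add: y_def)
    then have "y \<in> std_simplex d" using x by (auto simp: std_simplex_def yG O'_def intro: less_imp_le)
    then have "mv d M y + b \<in> K" using M(3) by blast
    moreover have "mv d M y = x - b"
      unfolding y_def using x M(2) by (intro mutual_inverseD(1)[OF M(1)] Rd_diff) auto
    ultimately show "x \<in> K" by simp
  qed
  \<comment> \<open>The barycenter of the standard simplex, where all its inequalities are
    strict.\<close>
  define p where "p = (\<lambda>i. if i < d then 1 / (real d + 1) else 0)"
  have p: "p \<in> Rd d" by (simp add: p_def Rd_def)
  have "mv d M p + b \<in> Rd d \<inter> O'"
  proof -
    have "G (mv d M p + b) i = p i" for i
      by (simp add: G_def mv_add mutual_inverseD(2)[OF M(1) p])
    moreover have "(\<Sum>i<d. p i) < 1" by (simp add: p_def field_simps)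
    ultimately show ?thesis using M(2) by (auto simp: O'_def p_def)
  qed
  then show ?thesis using interior_of_maximal[OF sub op] by blast
qed

text \<open>The differences \<open>v i - v 0\<close> span the same space as all differences of
  points of the hull, so a basis of \<open>d\<close> vectors can be chosen among them; with
  \<open>v 0\<close> as apex it spans a simplex inside the hull.\<close>

lemma affine_dim_contains_simplex:
  assumes v: "\<And>i. i < n \<Longrightarrow> v i \<in> Rd d" and n: "n > 0" and dim: "affine_dim (ihull v {..<n}) = d"
  shows "contains_simplex d (ihull v {..<n})"
proof -
  let ?D = "(\<lambda>i. v i - v 0) ` {..<n}"
  let ?E = "{x - y | x y. x \<in> ihull v {..<n} \<and> y \<in> ihull v {..<n}}"
  have hull: "v i \<in> ihull v {..<n}" if "i < n" for i
    using that by (auto simp: ihull_eq_convex_hull[symmetric] intro: hull_inc)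
  have DE: "?D \<subseteq> ?E" using hull n by auto
  have ED: "?E \<subseteq> span ?D"
  proof clarify
    fix x y assume "x \<in> ihull v {..<n}" "y \<in> ihull v {..<n}"
    then obtain l m where l: "sum l {..<n} = 1" "x = (\<Sum>i<n. l i *\<^sub>R v i)" and m: "sum m {..<n} = 1" "y = (\<Sum>i<n. m i *\<^sub>R v i)"
      by (auto simp: ihull_def)
    have "x - y = (\<Sum>i<n. (l i - m i) *\<^sub>R (v i - v 0))"
    proof -
      have "(\<Sum>i<n. (l i - m i) *\<^sub>R (v i - v 0)) = (\<Sum>i<n. (l i - m i) *\<^sub>R v i) - (\<Sum>i<n. l i - m i) *\<^sub>R v 0"
        unfolding scaleR_sum_left by (simp only: scaleR_diff_right sum_subtractf)
      also have "(\<Sum>i<n. l i - m i) = 0" using l m by (simp add: sum_subtractf)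
      also have "(\<Sum>i<n. (l i - m i) *\<^sub>R v i) = x - y" by (simp only: scaleR_diff_left sum_subtractf l(2) m(2))
      finally show ?thesis by (metis scaleR_zero_left diff_zero)
    qed
    also have "\<dots> \<in> span ?D" by (intro span_sum span_scale span_base) auto
    finally show "x - y \<in> span ?D" .
  qed
  have span: "span ?D = span ?E"
    by (rule subset_antisym[OF span_mono[OF DE] span_minimal[OF ED subspace_span]])
  have "dim ?D = dim (span ?D)" by (rule dim_span[symmetric])
  also have "\<dots> = dim ?E" unfolding span by (rule dim_span)
  also have "\<dots> = d" using dim unfolding affine_dim_def .
  finally have dimD: "dim ?D = d" .
  obtain B where B: "B \<subseteq> ?D" "independent B" and "card B = dim ?D" by (rule basis_exists)
  then have "card B = d" using dimD by simp
  have finB: "finite B" using B(1) finite_subset by blast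
  obtain e where e: "bij_betw e {..<d} B"
    using ex_bij_betw_nat_finite[OF finB] \<open>card B = d\<close> by (auto simp: atLeast0LessThan)
  have "\<forall>j\<in>{..<d}. \<exists>i<n. e j = v i - v 0" using e B(1) by (auto simp: bij_betw_def)
  then obtain idx where idx: "\<And>j. j < d \<Longrightarrow> idx j < n" "\<And>j. j < d \<Longrightarrow> e j = v (idx j) - v 0" by (metis lessThan_iff)
  have eR: "e j \<in> Rd d" if "j < d" for j using idx[OF that] v n by auto
  define M where "M = (\<lambda>i j. e j i)"
  have M: "mv d M x = (\<Sum>j<d. x j *\<^sub>R e j)" for x
    using eR by (intro Rd_eqI[of _ d]) (auto simp: mv_apply M_def sum_fun_apply mult.commute intro!: Rd_sum Rd_scaleR)
  have "\<exists>N. mutual_inverse d M N"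
  proof (rule inj_mv_imp_inverse)
    fix x assume x: "x \<in> Rd d" "mv d M x = 0"
    have inv: "inv_into {..<d} e (e j) = j" if "j < d" for j using e that by (auto simp: bij_betw_def inv_into_f_f)
    have "(\<Sum>w\<in>B. x (inv_into {..<d} e w) *\<^sub>R w) = (\<Sum>j<d. x j *\<^sub>R e j)"
      by (subst sum.reindex_bij_betw[OF e, symmetric]) (simp add: inv)
    also have "\<dots> = 0" using x M by simp
    finally have z: "(\<Sum>w\<in>B. x (inv_into {..<d} e w) *\<^sub>R w) = 0" .
    have "x (inv_into {..<d} e w) = 0" if "w \<in> B" for w
      using B(2) finB z that by (rule independentD[OF _ _ order_refl, where u = "\<lambda>w. x (inv_into {..<d} e w)"])
    then have "x j = 0" if "j < d" for j using e inv[OF that] that by (metis bij_betw_apply lessThan_iff)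
    then show "x = 0" using x(1) by (intro Rd_eqI[of _ d]) auto
  qed
  then obtain N where N: "mutual_inverse d M N" by blast
  have "mv d M x + v 0 \<in> ihull v {..<n}" if x: "x \<in> std_simplex d" for x
  proof -
    have "mv d M x + v 0 = (1 - (\<Sum>j<d. x j)) *\<^sub>R v 0 + (\<Sum>j<d. x j *\<^sub>R v (idx j))"
      by (simp add: M idx scaleR_diff_right sum_subtractf scaleR_diff_left scaleR_sum_left)
    also have "\<dots> \<in> ihull v {..<n}" using idx n by (intro simplex_combination_in_ihull[OF x]) auto
    finally show ?thesis .
  qed
  then show ?thesis using N v[OF n] unfolding contains_simplex_def by blast
qed

section \<open>Change of variables under affine maps\<close>

lemma integral_scales:
  fixes f :: "(nat \<Rightarrow> real) \<Rightarrow> real"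
  assumes T: "scales d T c" and f [measurable]: "f \<in> borel_measurable borel"
  shows "(LINT x|vol_Rd d. f (T x)) = c * (LINT x|vol_Rd d. f x)"
proof -
  note [measurable] = scales_measurable[OF T]
  have "distr (vol_Rd d) borel T = density (vol_Rd d) (\<lambda>_. ennreal c)"
  proof (rule measure_eqI)
    fix A assume "A \<in> sets (distr (vol_Rd d) borel T)"
    then have A: "A \<in> sets borel" by simp
    then show "emeasure (distr (vol_Rd d) borel T) A = emeasure (density (vol_Rd d) (\<lambda>_. ennreal c)) A"
      using scales_emeasure[OF T A] by (simp add: emeasure_distr emeasure_density_const)
  qed simp
  then have "(LINT x|distr (vol_Rd d) borel T. f x) = (LINT x|density (vol_Rd d) (\<lambda>_. ennreal c). f x)" by simp
  then show ?thesis
    using scales_pos[OF T] by (simp add: integral_distr integral_density)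
qed

lemma affine_image_integral:
  fixes f :: "(nat \<Rightarrow> real) \<Rightarrow> real"
  assumes M: "mutual_inverse d M N" and b: "b \<in> Rd d" and c: "scales d (mv d M) c"
    and T: "\<And>x. x \<in> Rd d \<Longrightarrow> T x = mv d M x + b"
    and K: "K \<subseteq> Rd d" "K \<in> sets borel" "T ` K \<in> sets borel"
  shows "emeasure (vol_Rd d) K = ennreal c * emeasure (vol_Rd d) (T ` K)"
    and "f \<in> borel_measurable borel \<Longrightarrow> (LINT x:K|vol_Rd d. f (T x)) = c * (LINT x:T ` K|vol_Rd d. f x)"
proof -
  \<comment> \<open>\<open>T\<close> is constrained on \<open>Rd d\<close> only, so measurability
    comes from \<open>T'\<close>, which agrees with it almost everywhere.\<close>
  define T' where "T' = (\<lambda>x. mv d M x + b)"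
  have c': "scales d T' c" using scales_comp[OF scales_translation[OF b] c] by (simp add: T'_def)
  have iff: "T' x \<in> T ` K \<longleftrightarrow> x \<in> K" if x: "x \<in> Rd d" for x
  proof
    assume "T' x \<in> T ` K"
    then obtain y where y: "y \<in> K" "T' x = T y" by auto
    then have "mv d M x = mv d M y" using T[of y] K(1) by (auto simp: T'_def)
    then have "x = y" using mutual_inverseD(2)[OF M x] mutual_inverseD(2)[OF M, of y] y(1) K(1) by (metis subsetD)
    then show "x \<in> K" using y(1) by simp
  next
    assume "x \<in> K"
    then show "T' x \<in> T ` K" using T[OF x] by (metis T'_def image_eqI)
  qed
  have TT': "T' x = T x" if "x \<in> Rd d" for x using T[OF that] by (simp add: T'_def)
  have "emeasure (vol_Rd d) K = emeasure (vol_Rd d) (T' -` (T ` K))"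
  proof (rule emeasure_eq_AE)
    show "AE x in vol_Rd d. (x \<in> K) = (x \<in> T' -` (T ` K))"
      using AE_vol_Rd[of d] by eventually_elim (simp only: vimage_eq iff)
  qed (use K measurable_sets_borel[OF scales_measurable[OF c'] K(3)] in auto)
  also have "\<dots> = ennreal c * emeasure (vol_Rd d) (T ` K)" by (rule scales_emeasure[OF c' K(3)])
  finally show "emeasure (vol_Rd d) K = ennreal c * emeasure (vol_Rd d) (T ` K)" .
  assume f [measurable]: "f \<in> borel_measurable borel"
  note [measurable] = K(3)
  note [measurable] = K(2) scales_measurable[OF c']
  have "(LINT x:K|vol_Rd d. f (T x)) = (LINT x|vol_Rd d. indicator K x *\<^sub>R f (T' x))"
    unfolding set_lebesgue_integral_def
    using TT' K(1) by (intro Bochner_Integration.integral_cong) (auto simp: indicator_def)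
  also have "\<dots> = (LINT x|vol_Rd d. indicator (T ` K) (T' x) *\<^sub>R f (T' x))"
  proof (rule integral_cong_AE)
    show "AE x in vol_Rd d. indicator K x *\<^sub>R f (T' x) = indicator (T ` K) (T' x) *\<^sub>R f (T' x)"
      using AE_vol_Rd[of d] by eventually_elim (simp only: iff indicator_def)
  qed measurable
  also have "\<dots> = c * (LINT x:T ` K|vol_Rd d. f x)"
    unfolding set_lebesgue_integral_def by (rule integral_scales[OF c']) measurable
  finally show "(LINT x:K|vol_Rd d. f (T x)) = c * (LINT x:T ` K|vol_Rd d. f x)" .
qed

text \<open>Equal volumes force the factor 1, equal barycenters force \<open>b = 0\<close>, and
  comparison of second moments makes the transpose of \<open>M\<close> multiply norms by
  \<open>r = L2 / L1\<close>. A similarity with ratio \<open>r\<close> has factor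
  \<open>1 / r ^ d\<close>, so \<open>r = 1\<close>.\<close>

lemma isotropic_constant_affine_unique:
  assumes d: "d > 0" and iso1: "isotropic_with d K L1" and iso2: "isotropic_with d (S ` K) L2"
    and M: "mutual_inverse d M N" and b: "b \<in> Rd d" and S: "\<And>x. x \<in> Rd d \<Longrightarrow> S x = mv d M x + b"
  shows "L1 = L2"
proof -
  have K: "K \<subseteq> Rd d" "compact K" "emeasure (vol_Rd d) K = 1" "L1 > 0" and L2: "L2 > 0"
    and mean1: "\<And>i. i < d \<Longrightarrow> (LINT x:K|vol_Rd d. x i) = 0"
    and SK: "compact (S ` K)" "emeasure (vol_Rd d) (S ` K) = 1"
    and mean2: "\<And>i. i < d \<Longrightarrow> (LINT x:S ` K|vol_Rd d. x i) = 0"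
    using iso1 iso2 by (auto simp: isotropic_with_def convex_body_def)
  obtain c where c: "scales d (mv d M) c" using scales_exists[OF M] by blast
  note change = affine_image_integral[OF M b c S K(1) compact_borel[OF K(2)] compact_borel[OF SK(1)]]
  have "ennreal c = 1" using change(1) K(3) SK(2) by simp
  then have c1: "c = 1" using scales_pos[OF c] by (simp add: ennreal_eq_1)
  have const: "(LINT x:K|vol_Rd d. r) = r" for r :: real
    using K(3) compact_borel[OF K(2)] by (simp add: set_lebesgue_integral_def measure_def)
  have b0: "b = 0"
  proof (rule Rd_eqI[OF b])
    fix i assume i: "i < d"
    have "0 = (LINT x:K|vol_Rd d. S x i)"
      using change(2)[of "\<lambda>x. x i"] mean2[OF i] c1 by simp
    also have "\<dots> = (LINT x:K|vol_Rd d. inner_Rd d (M i) x + b i)"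
      using K(1) i compact_borel[OF K(2)] by (intro set_lebesgue_integral_cong) (auto simp: S mv_inner)
    also have "\<dots> = (LINT x:K|vol_Rd d. inner_Rd d (M i) x) + (LINT x:K|vol_Rd d. b i)"
      by (rule set_integral_add(2); intro set_integrable_compact[OF K(2)] continuous_intros)
    also have "\<dots> = b i" using set_integral_inner[OF K(2) mean1] const by simp
    finally show "b i = 0 i" by simp
  qed simp
  define r where "r = L2 / L1"
  have r: "r > 0" using K(4) L2 by (simp add: r_def)
  have norm: "inner_Rd d (mv d (tr M) \<phi>) (mv d (tr M) \<phi>) = r\<^sup>2 * inner_Rd d \<phi> \<phi>" if \<phi>: "\<phi> \<in> Rd d" for \<phi>
  proof -
    have "L2\<^sup>2 * inner_Rd d \<phi> \<phi> = (LINT x:S ` K|vol_Rd d. (inner_Rd d \<phi> x)\<^sup>2)"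
      by (rule isotropic_inner_square[OF iso2 \<phi>, symmetric])
    also have "\<dots> = (LINT x:K|vol_Rd d. (inner_Rd d \<phi> (S x))\<^sup>2)"
      using change(2)[of "\<lambda>x. (inner_Rd d \<phi> x)\<^sup>2"] c1 by simp
    also have "\<dots> = (LINT x:K|vol_Rd d. (inner_Rd d (mv d (tr M) \<phi>) x)\<^sup>2)"
    proof -
      have "inner_Rd d \<phi> (S x) = inner_Rd d (mv d (tr M) \<phi>) x" if "x \<in> K" for x
      proof -
        have "S x = mv d M x" using S[of x] that K(1) b0 by auto
        then show ?thesis by (metis inner_Rd_commute inner_mv)
      qed
      then show ?thesis using compact_borel[OF K(2)] by (intro set_lebesgue_integral_cong) auto
    qed
    also have "\<dots> = L1\<^sup>2 * inner_Rd d (mv d (tr M) \<phi>) (mv d (tr M) \<phi>)"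
      by (rule isotropic_inner_square[OF iso1]) simp
    finally show ?thesis using K(4) by (simp add: r_def power_divide field_simps)
  qed
  \<comment> \<open>Polarization: the norm identity for the sum of two vectors gives the identity
    for inner products, hence orthogonality of the rows of \<open>M\<close>.\<close>
  have polar: "inner_Rd d (mv d (tr M) \<phi>) (mv d (tr M) \<psi>) = r\<^sup>2 * inner_Rd d \<phi> \<psi>" if "\<phi> \<in> Rd d" "\<psi> \<in> Rd d" for \<phi> \<psi>
    using norm[OF Rd_add[OF that]] norm[OF that(1)] norm[OF that(2)]
    by (simp add: mv_add inner_Rd_add inner_Rd_add_right inner_Rd_commute[of d "mv d (tr M) \<psi>" "mv d (tr M) \<phi>"]
        inner_Rd_commute[of d \<psi> \<phi>] algebra_simps)
  have "inner_Rd d (M i) (M j) = (if i = j then r\<^sup>2 else 0)" if "i < d" "j < d" for i j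
  proof -
    have "inner_Rd d (M i) (M j) = inner_Rd d (mv d (tr M) (axis_Rd i)) (mv d (tr M) (axis_Rd j))"
      using that by (simp add: inner_Rd_def mv_axis tr_def)
    also have "\<dots> = r\<^sup>2 * inner_Rd d (axis_Rd i) (axis_Rd j)" by (rule polar) (use that in auto)
    also have "\<dots> = (if i = j then r\<^sup>2 else 0)" using that by (simp add: inner_Rd_axis axis_Rd_apply)
    finally show ?thesis .
  qed
  then have "scales d (mv d M) (1 / r ^ d)" by (rule orthogonal_scales[OF r])
  then have "1 / r ^ d = 1" using scales_unique c c1 by blast
  then have "r ^ d = 1 ^ d" using r by simp
  then have "r = 1" using r d by (subst (asm) power_eq_iff_eq_base) auto
  then show ?thesis using K(4) by (simp add: r_def)
qed

text \<open>Move the barycenter \<open>g\<close> to the origin, orthonormalize the covariance form,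
  and dilate to volume 1. The triangular output of Gram-Schmidt makes the required dilation
  explicit.\<close>

lemma isotropic_position_exists:
  assumes v: "\<And>i. i < n \<Longrightarrow> v i \<in> Rd d" and simplex: "contains_simplex d (ihull v {..<n})" and d: "d > 0"
  shows "\<exists>T L. invertible_affine d T \<and> isotropic_with d (T ` ihull v {..<n}) L"
proof -
  let ?K = "ihull v {..<n}"
  have KR: "?K \<subseteq> Rd d" using v by (intro ihull_in_Rd) auto
  have K: "compact ?K" by (rule compact_ihull)
  note Kb = compact_borel[OF K]
  define V where "V = measure (vol_Rd d) ?K"
  have eV: "emeasure (vol_Rd d) ?K = ennreal V"
    unfolding V_def using emeasure_compact_finite[OF K, of d] by (intro emeasure_eq_ennreal_measure) simp
  have V: "V > 0" using contains_simplex_emeasure[OF simplex Kb] eV by simp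
  have const: "(LINT x:?K|vol_Rd d. r) = V * r" for r :: real
    using Kb by (simp add: set_lebesgue_integral_def V_def)
  note int = set_integrable_compact[OF K]
  define g where "g = (\<lambda>i. if i < d then (LINT x:?K|vol_Rd d. x i) / V else 0)"
  have g: "g \<in> Rd d" by (simp add: g_def Rd_def)
  have mean: "(LINT x:?K|vol_Rd d. inner_Rd d \<phi> (x - g)) = 0" for \<phi>
  proof -
    have "(LINT x:?K|vol_Rd d. inner_Rd d \<phi> (x - g)) = (LINT x:?K|vol_Rd d. (\<Sum>i<d. \<phi> i * (x i - g i)))"
      by (simp add: inner_Rd_def)
    also have "\<dots> = (\<Sum>i<d. LINT x:?K|vol_Rd d. \<phi> i * (x i - g i))"
    proof -
      have "integrable (vol_Rd d) (\<lambda>x. indicator ?K x *\<^sub>R (\<phi> i * (x i - g i)))" for i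
      proof -
        have "continuous_on UNIV (\<lambda>x. \<phi> i * (x i - g i))" by (intro continuous_intros)
        from int[OF this] show ?thesis by (simp add: set_integrable_def)
      qed
      then show ?thesis unfolding set_lebesgue_integral_def scaleR_sum_right
        by (intro Bochner_Integration.integral_sum) auto
    qed
    also have "\<dots> = 0"
    proof (intro sum.neutral ballI)
      fix i assume i: "i \<in> {..<d}"
      have "(LINT x:?K|vol_Rd d. x i - g i) = (LINT x:?K|vol_Rd d. x i) - (LINT x:?K|vol_Rd d. g i)"
        by (rule set_integral_diff(2); intro int continuous_intros)
      also have "\<dots> = 0" using i V by (simp add: const g_def)
      finally show "(LINT x:?K|vol_Rd d. \<phi> i * (x i - g i)) = 0" by (simp only: set_integral_mult_right mult_zero_right)
    qed
    finally show ?thesis .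
  qed
  have cont: "continuous_on UNIV (\<lambda>x. inner_Rd d \<phi> (x - g))" for \<phi>
    unfolding inner_Rd_diff_right by (intro continuous_intros)
  define B where "B = (\<lambda>\<phi> \<psi>. LINT x:?K|vol_Rd d. inner_Rd d \<phi> (x - g) * inner_Rd d \<psi> (x - g))"
  have Bint: "set_integrable (vol_Rd d) ?K (\<lambda>x. inner_Rd d \<phi> (x - g) * inner_Rd d \<psi> (x - g))" for \<phi> \<psi>
    by (intro int continuous_intros cont)
  have Blin: "linear (\<lambda>x. B x y)" for y
  proof (rule linearI)
    show "B (\<phi> + \<psi>) y = B \<phi> y + B \<psi> y" for \<phi> \<psi>
      unfolding B_def inner_Rd_add distrib_right by (rule set_integral_add(2)[OF Bint Bint])
    show "B (r *\<^sub>R \<phi>) y = r *\<^sub>R B \<phi> y" for r \<phi>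
      unfolding B_def inner_Rd_scaleR mult.assoc set_integral_mult_right real_scaleR_def ..
  qed
  have Bsym: "B x y = B y x" for x y by (simp add: B_def mult.commute)
  have Bpos: "B \<phi> \<phi> > 0" if \<phi>: "\<phi> \<in> Rd d" "\<phi> \<noteq> 0" for \<phi>
  proof (rule ccontr)
    let ?f = "\<lambda>x. indicator ?K x *\<^sub>R (inner_Rd d \<phi> (x - g) * inner_Rd d \<phi> (x - g))"
    assume "\<not> B \<phi> \<phi> > 0"
    moreover have "B \<phi> \<phi> \<ge> 0"
      unfolding B_def set_lebesgue_integral_def by (intro integral_nonneg_AE) auto
    ultimately have "B \<phi> \<phi> = 0" by linarith
    then have "(LINT x|vol_Rd d. ?f x) = 0" by (simp only: B_def set_lebesgue_integral_def)
    then have "AE x in vol_Rd d. ?f x = 0"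
      using Bint[of \<phi> \<phi>] unfolding set_integrable_def by (subst (asm) integral_nonneg_eq_0_iff_AE) auto
    then have "AE x in vol_Rd d. x \<notin> ?K"
      using AE_hyperplane[OF \<phi>, of "inner_Rd d \<phi> g"]
      by eventually_elim (auto simp: inner_Rd_diff_right)
    then have "emeasure (vol_Rd d) {x \<in> space (vol_Rd d). x \<in> ?K} = 0" by (rule emeasure_eq_0_AE)
    then show False using eV V by simp
  qed
  obtain A where tri: "\<And>i. i < d \<Longrightarrow> A i \<in> Rd (Suc i)" "\<And>i. i < d \<Longrightarrow> A i i > 0"
    and orth: "\<And>i j. i < d \<Longrightarrow> j < d \<Longrightarrow> B (A i) (A j) = (if i = j then 1 else 0)"
    using gram_schmidt[of B d, OF Blin Bsym Bpos] by blast
  define a where "a = (\<Prod>i<d. A i i)"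
  have a: "a > 0" unfolding a_def by (intro prod_pos) (use tri in auto)
  \<comment> \<open>Chosen so that the diagonal of \<open>s A\<close> has product
    \<open>1 / V\<close>, which brings the volume from \<open>V\<close> to 1.\<close>
  define s where "s = root d (1 / (V * a))"
  have s: "s > 0" "s ^ d = 1 / (V * a)" using V a d by (auto simp: s_def)
  define M where "M = (\<lambda>i. s *\<^sub>R A i)"
  have Mtri: "M i \<in> Rd (Suc i)" "M i i > 0" if "i < d" for i using tri[OF that] s by (auto simp: M_def)
  obtain N where N: "mutual_inverse d M N" using triangular_inverse[OF Mtri] by blast
  have "(\<Prod>i<d. M i i) = 1 / V" using s a by (simp add: M_def prod.distrib a_def[symmetric])
  then have c: "scales d (mv d M) V" using scales_lower_triangular[of d M, OF Mtri] by simp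
  define b where "b = - mv d M g"
  have b: "b \<in> Rd d" by (auto simp: b_def)
  define T where "T = (\<lambda>x. mv d M x + b)"
  have Tinner: "T x k = s * inner_Rd d (A k) (x - g)" if "k < d" for x k
    using that by (simp add: T_def b_def mv_inner M_def inner_Rd_scaleR inner_Rd_diff_right algebra_simps)
  have TK: "T ` ?K = ihull (\<lambda>i. T (v i)) {..<n}"
    by (rule image_ihull[OF _ v]) (auto simp: T_def)
  have TKc: "compact (T ` ?K)" unfolding TK by (rule compact_ihull)
  have Teq: "T x = mv d M x + b" for x by (simp add: T_def)
  note change = affine_image_integral[OF N b c Teq KR Kb compact_borel[OF TKc]]
  \<comment> \<open>\<open>B\<close> is not divided by the volume: a unit direction has moment
    \<open>s\<^sup>2\<close> over the original body, and the change of variables divides it by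
    \<open>V\<close>.\<close>
  define L where "L = s / sqrt V"
  have "isotropic_with d (T ` ?K) L"
    unfolding isotropic_with_def convex_body_def
  proof (intro conjI allI impI ballI)
    show "T ` ?K \<subseteq> Rd d" using b by (auto simp: T_def)
    show "compact (T ` ?K)" by (rule TKc)
    show "convex (T ` ?K)" unfolding TK by (simp add: ihull_eq_convex_hull[symmetric] convex_convex_hull)
    show "top_of_set (Rd d) interior_of (T ` ?K) \<noteq> {}"
      by (rule contains_simplex_interior[OF contains_simplex_affine[OF simplex N b Teq]])
    have "ennreal (1 / V) * ennreal V = ennreal (1 / V) * (ennreal V * emeasure (vol_Rd d) (T ` ?K))"
      using change(1) eV by simp
    then show "emeasure (vol_Rd d) (T ` ?K) = 1"
      using V by (simp add: mult.assoc[symmetric] ennreal_mult[symmetric])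
    show "L > 0" using s V by (simp add: L_def)
  next
    fix i assume i: "i < d"
    have "V * (LINT x:T ` ?K|vol_Rd d. x i) = (LINT x:?K|vol_Rd d. T x i)"
      by (rule change(2)[symmetric]) simp
    also have "\<dots> = 0" unfolding Tinner[OF i] set_integral_mult_right mean by simp
    finally show "(LINT x:T ` ?K|vol_Rd d. x i) = 0" using V by simp
  next
    fix \<theta> assume "\<theta> \<in> sphere_Rd d"
    then have \<theta>: "\<theta> \<in> Rd d" "inner_Rd d \<theta> \<theta> = 1" by (auto simp: sphere_Rd_def)
    \<comment> \<open>The transpose of \<open>A\<close> applied to \<open>\<theta>\<close>. The rows
      of \<open>A\<close> are orthonormal for \<open>B\<close>, so \<open>B \<psi> \<psi>\<close> is
      the squared Euclidean norm of \<open>\<theta>\<close>.\<close>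
    define \<psi> where "\<psi> = (\<Sum>k<d. \<theta> k *\<^sub>R A k)"
    have T\<psi>: "inner_Rd d (T x) \<theta> = s * inner_Rd d \<psi> (x - g)" for x
    proof -
      have "inner_Rd d (T x) \<theta> = (\<Sum>k<d. s * (\<theta> k * inner_Rd d (A k) (x - g)))"
        by (simp add: inner_Rd_def[of d "T x"] Tinner mult_ac)
      also have "\<dots> = s * inner_Rd d (x - g) \<psi>"
        by (simp add: \<psi>_def inner_Rd_sum sum_distrib_left inner_Rd_commute[of d "x - g"])
      finally show ?thesis by (simp add: inner_Rd_commute[of d "x - g"])
    qed
    have B\<psi>: "B \<psi> y = (\<Sum>k<d. \<theta> k * B (A k) y)" for y
      unfolding \<psi>_def linear_sum[OF Blin] by (simp only: linear_cmul[OF Blin] real_scaleR_def)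
    have "B (A k) \<psi> = \<theta> k" if "k < d" for k
      using that by (simp add: Bsym[of "A k" \<psi>] B\<psi> orth if_distrib[of "\<lambda>x. _ * x"] cong: if_cong)
    then have "B \<psi> \<psi> = 1" using \<theta>(2) by (simp add: B\<psi> inner_Rd_def)
    have "V * (LINT x:T ` ?K|vol_Rd d. (inner_Rd d x \<theta>)\<^sup>2) = (LINT x:?K|vol_Rd d. (inner_Rd d (T x) \<theta>)\<^sup>2)"
      by (rule change(2)[symmetric]) (simp add: inner_Rd_commute[of d _ \<theta>])
    also have "\<dots> = (LINT x:?K|vol_Rd d. s\<^sup>2 * (inner_Rd d \<psi> (x - g) * inner_Rd d \<psi> (x - g)))"
      unfolding T\<psi> by (simp add: power2_eq_square mult_ac)
    also have "\<dots> = s\<^sup>2 * B \<psi> \<psi>" unfolding B_def by (rule set_integral_mult_right)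
    finally show "(LINT x:T ` ?K|vol_Rd d. (inner_Rd d x \<theta>)\<^sup>2) = L\<^sup>2"
      using V \<open>B \<psi> \<psi> = 1\<close> by (simp add: L_def power_divide field_simps)
  qed
  moreover have "invertible_affine d T" unfolding T_def by (rule invertible_affineI[OF N b])
  ultimately show ?thesis by blast
qed

text \<open>A generating set of least cardinality consists of extreme points, since a point in the
  hull of the others could be removed. The inequality \<open>m \<le> n\<close> is enough because the
  final bound increases with the number of points.\<close>

lemma polytope_ihull_extreme:
  fixes K :: "(nat \<Rightarrow> real) set"
  assumes "polytope K" and n: "card {v. v extreme_point_of K} = n" "n > 0"
  obtains v m where "0 < m" "m \<le> n" "K = ihull v {..<m}"
proof -
  obtain W where W: "finite W" "K = convex hull W" using assms(1) by (auto simp: polytope_def)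
  define P where "P = (\<lambda>V. V \<subseteq> W \<and> convex hull V = K)"
  have "P W" using W by (simp add: P_def)
  then obtain V where V: "P V" "\<And>V'. P V' \<Longrightarrow> card V \<le> card V'"
    using ex_has_least_nat[of P W card] by blast
  have finV: "finite V" using V(1) W(1) finite_subset by (auto simp: P_def)
  have "x extreme_point_of K" if x: "x \<in> V" for x
  proof -
    have "x \<notin> convex hull (V - {x})"
    proof
      assume "x \<in> convex hull (V - {x})"
      then have "convex hull (insert x (V - {x})) = convex hull (V - {x})" by (rule hull_redundant)
      then have "P (V - {x})" using V(1) x by (auto simp: P_def insert_absorb)
      then have "card V \<le> card (V - {x})" by (rule V(2))
      then show False using x finV by (metis card_Diff1_less not_le)
    qed
    then have "x extreme_point_of (convex hull (insert x (V - {x})))"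
      using finV by (intro extreme_point_of_convex_hull_insert) auto
    then show ?thesis using V(1) x by (simp add: P_def insert_absorb)
  qed
  then have sub: "V \<subseteq> {v. v extreme_point_of K}" by blast
  \<comment> \<open>An infinite set has \<open>card\<close> 0, so \<open>n > 0\<close> yields
    finiteness.\<close>
  have "finite {v. v extreme_point_of K}" using n card_ge_0_finite by blast
  then have le: "card V \<le> n" using card_mono[OF _ sub] n(1) by simp
  obtain v where v: "bij_betw v {..<card V} V"
    using ex_bij_betw_nat_finite[OF finV] by (auto simp: atLeast0LessThan)
  have "K = ihull v {..<card V}"
    using V(1) v by (simp add: ihull_eq_convex_hull[symmetric] P_def bij_betw_def)
  moreover have "V \<noteq> {}"
  proof
    assume "V = {}"
    then have "K = {}" using V(1) by (simp add: P_def)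
    then show False using n by simp
  qed
  then have "card V > 0" using finV by (simp add: card_gt_0_iff)
  ultimately show thesis using that le by blast
qed

lemma isotropy_constant_ihull:
  assumes v: "\<And>i. i < n \<Longrightarrow> v i \<in> Rd d" and simplex: "contains_simplex d (ihull v {..<n})" and d: "d > 0"
  shows "isotropy_constant d (ihull v {..<n}) \<le> sqrt 2 * sqrt (real n / real d)"
proof -
  let ?K = "ihull v {..<n}"
  have KR: "?K \<subseteq> Rd d" using v by (intro ihull_in_Rd) auto
  obtain T L where T: "invertible_affine d T" and iso: "isotropic_with d (T ` ?K) L"
    using isotropic_position_exists[of n v d, OF v simplex d] by blast
  obtain M N b where M: "mutual_inverse d M N" "b \<in> Rd d" and Teq: "\<And>x. x \<in> Rd d \<Longrightarrow> T x = mv d M x + b"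
    using invertible_affine_matrix[OF T] by blast
  have unique: "L' = L" if T': "invertible_affine d T'" and iso': "isotropic_with d (T' ` ?K) L'" for T' L'
  proof -
    obtain M' N' b' where M': "mutual_inverse d M' N'" "b' \<in> Rd d" and Teq': "\<And>x. x \<in> Rd d \<Longrightarrow> T' x = mv d M' x + b'"
      using invertible_affine_matrix[OF T'] by blast
    obtain P P' where P: "mutual_inverse d P P'" "\<And>x. x \<in> Rd d \<Longrightarrow> mv d P x = mv d M' (mv d N x)"
      using mutual_inverse_comp[OF M'(1) mutual_inverse_sym[OF M(1)]] by blast
    \<comment> \<open>\<open>T'\<close> after the inverse of \<open>T\<close>: it carries one
      isotropic image of the body to the other, so their constants can be compared.\<close>
    define S where "S = (\<lambda>y. mv d P y + (b' - mv d P b))"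
    have "S (T x) = T' x" if x: "x \<in> Rd d" for x
    proof -
      have "S (T x) = mv d P (mv d M x) + b'" by (simp add: S_def Teq[OF x] mv_add)
      then show ?thesis by (simp add: P(2) mutual_inverseD(2)[OF M(1) x] Teq'[OF x])
    qed
    then have img: "T' ` ?K = S ` (T ` ?K)" using KR unfolding image_image by (intro image_cong) auto
    have "L = L'"
      by (rule isotropic_constant_affine_unique[OF d iso iso'[unfolded img] P(1), of "b' - mv d P b"])
        (use M'(2) in \<open>auto simp: S_def\<close>)
    then show ?thesis by simp
  qed
  have "isotropy_constant d ?K = L"
    unfolding isotropy_constant_def using T iso unique by (intro the_equality) blast+
  moreover have "T ` ?K = ihull (\<lambda>i. T (v i)) {..<n}" by (rule image_ihull[OF Teq v])
  then have "L\<^sup>2 \<le> 2 * (real n / real d)"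
    using isotropic_polytope_bound[where d = d and n = n and v = "\<lambda>i. T (v i)" and L = L] iso Teq v M(2) d by (auto simp: Rd_add)
  then have "L \<le> sqrt (2 * (real n / real d))" by (rule real_le_rsqrt)
  ultimately show ?thesis by (simp only: real_sqrt_mult)
qed

theorem corollary3p5:
  shows "\<exists>C::real. C > 0 \<and>
    (\<forall>n d :: nat. \<forall>K :: (nat \<Rightarrow> real) set.
      n > 0 \<and> d > 0 \<and> K \<subseteq> Rd d \<and> polytope K \<and> affine_dim K = d \<and>
      card {v. v extreme_point_of K} = n
      \<longrightarrow> isotropy_constant d K \<le> C * sqrt (real n / real d))"
proof (intro exI[of _ "sqrt 2"] conjI allI impI)
  fix n d :: nat and K :: "(nat \<Rightarrow> real) set"
  assume H: "n > 0 \<and> d > 0 \<and> K \<subseteq> Rd d \<and> polytope K \<and> affine_dim K = d \<and>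
      card {v. v extreme_point_of K} = n"
  then have "polytope K" "card {v. v extreme_point_of K} = n" "n > 0" by auto
  then obtain v m where m: "0 < m" "m \<le> n" and K: "K = ihull v {..<m}"
    by (rule polytope_ihull_extreme)
  have v: "v i \<in> Rd d" if "i < m" for i
    using H that hull_inc[of "v i" "v ` {..<m}" convex] unfolding K by (auto simp: ihull_eq_convex_hull)
  have "contains_simplex d (ihull v {..<m})"
    by (rule affine_dim_contains_simplex[OF v m(1)]) (use H K in auto)
  then have "isotropy_constant d K \<le> sqrt 2 * sqrt (real m / real d)"
    unfolding K using v H by (intro isotropy_constant_ihull) auto
  also have "\<dots> \<le> sqrt 2 * sqrt (real n / real d)"
    using m(2) by (intro mult_left_mono real_sqrt_le_mono divide_right_mono) auto
  finally show "isotropy_constant d K \<le> sqrt 2 * sqrt (real n / real d)" .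
qed simp

end
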